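(* Let $k\ge 1$ be an integer and let $\zeta$ be a primitive root of unity of order $2k$. Define, for $|q|<1$, \[ S_4(1;q):=\frac{1}{\overline{J}_{0,1}}\sum_{n=-\infty}^{\infty}\frac{2\,q^{n(n+1)/2}}{(1+q^n)^2}. \] Then, as $q$ approaches $\zeta$ radially within the unit disk, \[ \lim_{q\rightarrow \zeta} \Big ( S_4(1;q)+\frac{J_{1}^3}{\overline{J}_{0,1}^2} -\frac{\overline{J}_{1,2}^4}{2J_1^3}\Big )=-2\sum_{n=0}^{k-1}\frac{\zeta^{n+1}(-\zeta;\zeta)_n^2}{(\zeta;\zeta^2)_{n+1}}. \]
   Context: Throughout, $q$ is a complex number with $0<|q|<1$. For $x\in\mathbb{C}$ and $n\ge 0$, $(x;q)_n:=\prod_{i=0}^{n-1}(1-xq^i)$ (also used with any other base, e.g. $(x;\zeta)_n=\prod_{i=0}^{n-1}(1-x\zeta^{i})$) and $(x;q)_\infty:=\prod_{i\ge 0}(1-xq^i)$. The theta function is $j(x;q):=(x;q)_\infty(q/x;q)_\infty(q;q)_\infty$. For integers $a$ and $m>0$: $J_{a,m}:=j(q^a;q^m)$, $J_m:=(q^m;q^m)_\infty$, and $\overline{J}_{a,m}:=j(-q^a;q^m)$. "$q$ approaches $\zeta$ radially" means $q=r\zeta$ with $r\to 1^-$. (The function $S_4(1;q)$ is the value at $\omega=1$ of the regularized series $\sum_{n\ge0}^{*}\frac{(-1)^n(q;q^2)_n}{(-\omega;q)_{n+1}(-q/\omega;q)_n}$, which is defined by the bilateral sum $\frac{1}{\overline{J}_{0,1}}\sum_{n\in\mathbb{Z}}\frac{(1+1/\omega)q^{n(n+1)/2}}{(1+\omega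 q^n)(1+q^n/\omega)}$.) *)

theory Defs
  imports "HOL-Analysis.Analysis"
begin

definition qpoch :: "complex \<Rightarrow> complex \<Rightarrow> nat \<Rightarrow> complex" where
  "qpoch x q n = (\<Prod>i<n. 1 - x * q ^ i)"

(* Meant for norm q < 1, where the product converges.  prodinf permits finitely many
   vanishing factors, the value then being 0. *)
definition qpoch_inf :: "complex \<Rightarrow> complex \<Rightarrow> complex" where
  "qpoch_inf x q = (\<Prod>i. 1 - x * q ^ i)"

definition theta :: "complex \<Rightarrow> complex \<Rightarrow> complex" where
  "theta x q = qpoch_inf x q * qpoch_inf (q / x) q * qpoch_inf q q"

definition J :: "nat \<Rightarrow> complex \<Rightarrow> complex" where
  "J m q = qpoch_inf (q ^ m) (q ^ m)"

definition Jbar :: "int \<Rightarrow> nat \<Rightarrow> complex \<Rightarrow> complex" where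
  "Jbar a m q = theta (- (q powi a)) (q ^ m)"

(* S_4(1;q), meant for 0 < norm q < 1.  The exponent n(n+1)/2 is always a nonnegative
   integer, so div is exact; the bilateral series converges absolutely, so the
   unordered sum over all integers is its value. *)
definition S4_one :: "complex \<Rightarrow> complex" where
  "S4_one q = 1 / Jbar 0 1 q *
     (\<Sum>\<^sub>\<infinity>n::int. 2 * q powi (n * (n + 1) div 2) / (1 + q powi n)\<^sup>2)"

definition primitive_root_of_unity :: "nat \<Rightarrow> complex \<Rightarrow> bool" where
  "primitive_root_of_unity n z \<longleftrightarrow> n > 0 \<and> z ^ n = 1 \<and> (\<forall>m. 0 < m \<and> m < n \<longrightarrow> z ^ m \<noteq> 1)"

end

theory Submission
  imports Defs "HOL-Real_Asymp.Real_Asymp"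
begin

text \<open>
  Let \<open>D(q) = \<Sum> q\<^bsup>n+1\<^esup> (-q;q)\<^sub>n\<^sup>2 / (q;q\<^sup>2)\<^bsub>n+1\<^esub>\<close> and
  \<open>t(q) = J\<^sub>1\<^sup>3 / Jbar\<^bsub>0,1\<^esub>\<^sup>2\<close>. For \<open>\<epsilon> = 1\<close> and \<open>\<epsilon> = -1\<close> the bilateral series
  \<open>\<Sum> (-1)\<^sup>n (q;q\<^sup>2)\<^sub>n (-\<epsilon> q\<^bsup>n+1\<^esup>;q)\<^sub>\<infinity>\<^sup>2\<close> over all integers \<open>n\<close>, Cesaro summed, is evaluated in two
  ways. The terms with \<open>n \<ge> 0\<close> give \<open>S\<^sub>4\<close> for \<open>\<epsilon> = 1\<close> (partial fractions and the \<open>q\<close>-Gauss sum)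
  and \<open>t\<close> for \<open>\<epsilon> = -1\<close>; the terms with \<open>n < 0\<close> give \<open>D\<close> and \<open>0\<close>. On the other hand, expanding the
  squares by Euler's identity and summing over \<open>n\<close> by Ramanujan's \<open>1\<psi>1\<close> sum gives a series
  \<open>\<Sum> \<epsilon>\<^sup>r W\<^sub>r\<close> over the integers, where again \<open>q\<close>-Gauss gives \<open>W\<^sub>r\<close> in closed form.
  Adding and subtracting the cases \<open>\<epsilon> = 1\<close> and \<open>\<epsilon> = -1\<close> isolates the even and the odd \<open>r\<close>:
  \<open>S\<^sub>4 + 2 D + t = ((-q;q\<^sup>2)\<^sub>\<infinity>\<^sup>2 / (q;q)\<^sub>\<infinity>) \<Sum> q\<^bsup>j(j+1)\<^esup> / (1 + q\<^bsup>2j\<^esup>)\<close> and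
  \<open>S\<^sub>4 + 2 D - t = 2 ((-q\<^sup>2;q\<^sup>2)\<^sub>\<infinity>\<^sup>2 / (q;q)\<^sub>\<infinity>) \<Sum> q\<^bsup>j*j\<^esup> / (1 + q\<^bsup>2j-1\<^esup>)\<close>.
  As \<open>q\<close> tends to \<open>\<zeta>\<close>, the right-hand side of the first identity is exponentially small for odd
  \<open>k\<close> and that of the second one for even \<open>k\<close>. So is the remaining theta quotient, which for
  even \<open>k\<close> has to be combined with \<open>2 t\<close> by Jacobi's quartic identity. Finally \<open>D(q)\<close> tends
  to the sum of its first \<open>k\<close> terms at \<open>\<zeta>\<close>, since \<open>(-\<zeta>;\<zeta>)\<^sub>n = 0\<close> for \<open>n \<ge> k\<close>.
\<close>


subsection \<open>\<open>q\<close>-Pochhammer symbols and the q-binomial theorem\<close>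

text \<open>The split by parity is forced by the denominators 1 + q^r in the closed form of the
  coefficients. At \<open>\<zeta>\<close> they vanish exactly when r is congruent to k modulo 2k, so
  the r of parity opposite to k are harmless, and the product in front of that half of the series is
  the one that decays. The terms with n >= 0 alternate without tending to 0. Hence sums over n are
  taken over neighbouring pairs, which also makes the interchanges of summation absolutely
  convergent. Near \<open>\<zeta>\<close> products are estimated through their logarithmic series.
  Nonresonant indices l cost a bounded multiple of |q|^l / l, hence in total only a power of 1 -
  |q|. Resonant indices have a favourable sign or cancel, and a single one of them supplies the
  exponential decay. The tail of the dual series is controlled by the zeros of (-q;q)_N at
  \<open>\<zeta>\<close>: each block of 2k factors contributes a factor of order 1 - |q|, and
  sufficiently many blocks outweigh the polynomial loss.\<close>

lemma qpoch_0 [simp]: "qpoch x q 0 = 1"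
  by (simp add: qpoch_def)

lemma qpoch_Suc: "qpoch x q (Suc n) = qpoch x q n * (1 - x * q ^ n)"
  by (simp add: qpoch_def)

lemma qpoch_add: "qpoch x q (m + n) = qpoch x q m * qpoch (x * q ^ m) q n"
  by (induction n) (simp_all add: qpoch_Suc power_add mult.assoc)

lemma qpoch_Suc_left: "qpoch x q (Suc n) = (1 - x) * qpoch (x * q) q n"
  using qpoch_add[of x q 1 n] by (simp add: qpoch_Suc)

lemma qpoch_eq_0_iff: "qpoch x q n = 0 \<longleftrightarrow> (\<exists>i<n. x * q ^ i = 1)"
  by (auto simp: qpoch_def)

lemma convergent_prod_qpoch:
  assumes "norm q < 1"
  shows "convergent_prod (\<lambda>i. 1 - x * q ^ i :: complex)"
proof (rule abs_convergent_prod_imp_convergent_prod)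
  have "summable (\<lambda>i. norm x * norm q ^ i)"
    using assms by (intro summable_mult summable_geometric) auto
  then show "abs_convergent_prod (\<lambda>i. 1 - x * q ^ i)"
    by (simp add: abs_convergent_prod_conv_summable norm_mult norm_power)
qed

lemma qpoch_tendsto:
  assumes "norm q < 1"
  shows "(\<lambda>n. qpoch x q n) \<longlonglongrightarrow> qpoch_inf x q"
proof -
  have "(\<lambda>n. \<Prod>i\<le>n. 1 - x * q ^ i) \<longlonglongrightarrow> qpoch_inf x q"
    unfolding qpoch_inf_def by (rule convergent_prod_LIMSEQ[OF convergent_prod_qpoch[OF assms]])
  then have "(\<lambda>n. qpoch x q (Suc n)) \<longlonglongrightarrow> qpoch_inf x q"
    by (simp add: qpoch_def lessThan_Suc_atMost)
  then show ?thesis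
    by (rule LIMSEQ_imp_Suc)
qed

lemma qpoch_inf_split:
  assumes "norm q < 1"
  shows "qpoch_inf x q = qpoch x q n * qpoch_inf (x * q ^ n) q"
proof -
  have "(\<lambda>m. qpoch x q (n + m)) \<longlonglongrightarrow> qpoch_inf x q"
    using LIMSEQ_ignore_initial_segment[OF qpoch_tendsto[OF assms, of x], of n]
    by (simp add: add.commute)
  moreover have "(\<lambda>m. qpoch x q (n + m)) \<longlonglongrightarrow> qpoch x q n * qpoch_inf (x * q ^ n) q"
    unfolding qpoch_add by (intro tendsto_intros qpoch_tendsto assms)
  ultimately show ?thesis
    by (rule LIMSEQ_unique)
qed

lemma qpoch_inf_rec:
  assumes "norm q < 1"
  shows "qpoch_inf x q = (1 - x) * qpoch_inf (x * q) q"
  using qpoch_inf_split[OF assms, of x 1] by (simp add: qpoch_Suc)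

lemma qpoch_inf_0 [simp]: "qpoch_inf 0 q = 1"
  by (simp add: qpoch_inf_def)

lemma qpoch_inf_1 [simp]:
  assumes "norm q < 1"
  shows "qpoch_inf 1 q = 0"
  by (subst qpoch_inf_rec[OF assms]) simp

lemma qpoch_inf_nonzero:
  assumes "norm q < 1" "\<And>i. x * q ^ i \<noteq> 1"
  shows "qpoch_inf x q \<noteq> 0"
  unfolding qpoch_inf_def
  by (rule prodinf_nonzero[OF convergent_prod_qpoch[OF assms(1)]]) (use assms(2) in auto)

lemma mult_power_neq_1:
  fixes q x :: complex
  assumes "norm q < 1" "norm x < 1"
  shows "x * q ^ i \<noteq> 1"
proof
  assume "x * q ^ i = 1"
  then have "norm x * norm q ^ i = 1"
    by (metis norm_mult norm_one norm_power)
  moreover have "norm x * norm q ^ i \<le> norm x * 1"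
    using assms by (intro mult_left_mono power_le_one) auto
  ultimately show False
    using assms by simp
qed

lemma qpoch_inf_nonzero':
  assumes "norm q < 1" "norm x < 1"
  shows "qpoch_inf x q \<noteq> 0"
  using qpoch_inf_nonzero[OF assms(1)] mult_power_neq_1[OF assms] by blast

lemma qpoch_nonzero':
  assumes "norm q < 1" "norm x < 1"
  shows "qpoch x q n \<noteq> 0"
  using mult_power_neq_1[OF assms] by (simp add: qpoch_eq_0_iff)

lemma qpoch_inf_base_square:
  assumes "norm q < 1"
  shows "qpoch_inf x q = qpoch_inf x (q\<^sup>2) * qpoch_inf (x * q) (q\<^sup>2)"
proof -
  have "norm (q\<^sup>2) < 1"
    using assms by (simp add: norm_power power_less_one_iff)
  moreover have "qpoch x q (2 * n) = qpoch x (q\<^sup>2) n * qpoch (x * q) (q\<^sup>2) n" for n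
    by (induction n) (simp_all add: qpoch_Suc power_mult algebra_simps power2_eq_square)
  ultimately have "(\<lambda>n. qpoch x q (2 * n)) \<longlonglongrightarrow> qpoch_inf x (q\<^sup>2) * qpoch_inf (x * q) (q\<^sup>2)"
    by (simp add: tendsto_mult qpoch_tendsto)
  moreover have "(\<lambda>n. qpoch x q (2 * n)) \<longlonglongrightarrow> qpoch_inf x q"
    using LIMSEQ_subseq_LIMSEQ[OF qpoch_tendsto[OF assms, of x], of "\<lambda>n. 2 * n"]
    by (simp add: strict_mono_def o_def)
  ultimately show ?thesis
    using LIMSEQ_unique by blast
qed

lemma qpoch_inf_mult_neg:
  assumes "norm q < 1"
  shows "qpoch_inf x q * qpoch_inf (- x) q = qpoch_inf (x\<^sup>2) (q\<^sup>2)"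
proof -
  have "norm (q\<^sup>2) < 1"
    using assms by (simp add: norm_power power_less_one_iff)
  moreover have "qpoch x q n * qpoch (- x) q n = qpoch (x\<^sup>2) (q\<^sup>2) n" for n
    by (induction n) (simp_all add: qpoch_Suc algebra_simps power2_eq_square power_mult_distrib)
  ultimately show ?thesis
    using LIMSEQ_unique[OF tendsto_mult[OF qpoch_tendsto[OF assms, of x] qpoch_tendsto[OF assms, of "-x"]]]
      qpoch_tendsto[of "q\<^sup>2" "x\<^sup>2"] by simp
qed

lemma qpoch_bounded:
  assumes "norm q < 1"
  obtains K where "K > 0" "\<And>n. norm (qpoch x q n) \<le> K"
  using convergent_imp_Bseq[OF convergentI[OF qpoch_tendsto[OF assms, of x]]]
  by (auto elim: BseqE)

lemma inverse_qpoch_bounded: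
  assumes "norm q < 1" "\<And>i. x * q ^ i \<noteq> 1"
  obtains K where "K > 0" "\<And>n. norm (inverse (qpoch x q n)) \<le> K"
proof -
  have "(\<lambda>n. inverse (qpoch x q n)) \<longlonglongrightarrow> inverse (qpoch_inf x q)"
    by (intro tendsto_inverse qpoch_tendsto qpoch_inf_nonzero assms)
  then show ?thesis
    using that convergent_imp_Bseq[OF convergentI] by (metis BseqE)
qed

lemma summable_ratio_limit:
  fixes a r :: "nat \<Rightarrow> complex"
  assumes lim: "r \<longlonglongrightarrow> L" and L: "norm L < 1" and a: "\<And>n. a (Suc n) = r n * a n"
  shows "summable (\<lambda>n. norm (a n))"
proof -
  obtain c where c: "norm L < c" "c < 1"
    using L dense by blast
  then have "eventually (\<lambda>n. norm (r n) < c) sequentially"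
    by (intro order_tendstoD(2)[OF tendsto_norm[OF lim]])
  then obtain N where N: "\<And>n. n \<ge> N \<Longrightarrow> norm (r n) < c"
    by (auto simp: eventually_sequentially)
  show ?thesis
  proof (rule summable_ratio_test[OF c(2)])
    show "norm (norm (a (Suc n))) \<le> c * norm (norm (a n))" if "n \<ge> N" for n
      using N[OF that] by (simp add: a norm_mult mult_right_mono)
  qed
qed

text \<open>With \<alpha> = z and \<beta> = a z this is the q-binomial theorem; the homogeneous form
  keeps \<alpha> = 0 available, which later yields Euler's identity and the triple product. The
  generating function \<open>f\<close> satisfies a q-difference equation, iterated from 1 towards 0,
  where \<open>f\<close> is continuous with value 1.\<close>

lemma homogeneous_q_binomial:
  assumes q: "norm q < 1" and \<alpha>: "norm \<alpha> < 1"
  shows "summable (\<lambda>n. norm ((\<Prod>i<n. \<alpha> - \<beta> * q ^ i) / qpoch q q n))" (is "summable (\<lambda>n. norm (?a n))")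
    and "(\<lambda>n. (\<Prod>i<n. \<alpha> - \<beta> * q ^ i) / qpoch q q n) sums (qpoch_inf \<beta> q / qpoch_inf \<alpha> q)"
proof -
  define a where "a = (\<lambda>n. (\<Prod>i<n. \<alpha> - \<beta> * q ^ i) / qpoch q q n)"
  have nz: "1 - q * q ^ n \<noteq> 0" for n
    using mult_power_neq_1[OF q q, of n] by simp
  have aSuc: "a (Suc n) * (1 - q * q ^ n) = a n * (\<alpha> - \<beta> * q ^ n)" for n
    using nz[of n] qpoch_nonzero'[OF q q] by (simp add: a_def qpoch_Suc field_simps)
  have "(\<lambda>n. (\<alpha> - \<beta> * q ^ n) / (1 - q * q ^ n)) \<longlonglongrightarrow> (\<alpha> - \<beta> * 0) / (1 - q * 0)"
    by (intro tendsto_intros LIMSEQ_power_zero q) auto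
  then have sm: "summable (\<lambda>n. norm (a n))"
    by (rule summable_ratio_limit) (use aSuc nz \<alpha> in \<open>auto simp: field_simps\<close>)
  define f where "f x = (\<Sum>n. a n * x ^ n)" for x
  have smx: "summable (\<lambda>n. a n * x ^ n)" if "norm x \<le> 1" for x
  proof (rule summable_comparison_test'[OF sm, of 0])
    show "norm (a n * x ^ n) \<le> norm (a n)" for n
      using that by (simp add: norm_mult norm_power mult_left_le power_le_one)
  qed
  have fe: "(1 - \<alpha> * x) * f x = (1 - \<beta> * x) * f (x * q)" if x: "norm x \<le> 1" for x
  proof -
    have xq: "norm (x * q) \<le> 1"
      using x q by (simp add: norm_mult mult_le_one)
    note s1 = smx[OF x] and s2 = smx[OF xq]
    have "f x - f (x * q) = (\<Sum>n. a n * x ^ n - a n * (x * q) ^ n)"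
      unfolding f_def by (rule suminf_diff[OF s1 s2])
    also have "\<dots> = (\<Sum>n. a (Suc n) * x ^ Suc n - a (Suc n) * (x * q) ^ Suc n)"
      using suminf_split_head[OF summable_diff[OF s1 s2]] by simp
    also have "\<dots> = (\<Sum>n. x * (\<alpha> * (a n * x ^ n) - \<beta> * (a n * (x * q) ^ n)))"
    proof (rule suminf_cong)
      fix n
      have "a (Suc n) * x ^ Suc n - a (Suc n) * (x * q) ^ Suc n = (a (Suc n) * (1 - q * q ^ n)) * x ^ Suc n"
        by (simp add: algebra_simps power_mult_distrib)
      then show "a (Suc n) * x ^ Suc n - a (Suc n) * (x * q) ^ Suc n
          = x * (\<alpha> * (a n * x ^ n) - \<beta> * (a n * (x * q) ^ n))"
        unfolding aSuc by (simp add: algebra_simps power_mult_distrib)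
    qed
    also have "\<dots> = x * (\<alpha> * f x - \<beta> * f (x * q))"
      unfolding f_def
      by (simp only: suminf_mult[OF summable_diff[OF summable_mult[OF s1] summable_mult[OF s2]]]
          suminf_diff[OF summable_mult[OF s1] summable_mult[OF s2], symmetric]
          suminf_mult[OF s1] suminf_mult[OF s2])
    finally show ?thesis
      by (simp add: algebra_simps)
  qed
  have it: "qpoch \<alpha> q N * f 1 = qpoch \<beta> q N * f (q ^ N)" for N
  proof (induction N)
    case (Suc N)
    have "norm (q ^ N) \<le> 1"
      using q by (simp add: norm_power power_le_one)
    from fe[OF this] Suc show ?case
      by (simp add: qpoch_Suc mult.commute[of q]) (metis (no_types, lifting) mult.assoc mult.commute)
  qed simp
  have "isCont f 0"
    unfolding f_def by (rule isCont_powser[of a 1]) (use smx[of 1] in auto)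
  moreover have "f 0 = 1"
    using powser_zero[of a] by (simp add: f_def a_def)
  moreover have "(\<lambda>N. q ^ N) \<longlonglongrightarrow> 0"
    by (rule LIMSEQ_power_zero[OF q])
  ultimately have f1: "(\<lambda>N. f (q ^ N)) \<longlonglongrightarrow> 1"
    using isCont_tendsto_compose by metis
  have "(\<lambda>N. qpoch \<alpha> q N * f 1) \<longlonglongrightarrow> qpoch_inf \<alpha> q * f 1"
    by (intro tendsto_intros qpoch_tendsto q)
  moreover have "(\<lambda>N. qpoch \<alpha> q N * f 1) \<longlonglongrightarrow> qpoch_inf \<beta> q * 1"
    unfolding it by (intro tendsto_intros qpoch_tendsto q f1)
  ultimately have "qpoch_inf \<alpha> q * f 1 = qpoch_inf \<beta> q"
    using LIMSEQ_unique by fastforce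
  then have "f 1 = qpoch_inf \<beta> q / qpoch_inf \<alpha> q"
    using qpoch_inf_nonzero'[OF q \<alpha>] by (simp add: field_simps)
  then show "?a sums (qpoch_inf \<beta> q / qpoch_inf \<alpha> q)"
    using summable_sums[OF smx[of 1]] by (simp add: f_def a_def)
  show "summable (\<lambda>n. norm (?a n))"
    using sm by (simp add: a_def)
qed

subsection \<open>The bilateral q-binomial theorem\<close>

lemma has_sum_int_decode:
  fixes f :: "int \<Rightarrow> complex"
  assumes "summable (\<lambda>k. norm (f (int_decode k)))"
  shows "(f has_sum (\<Sum>k. f (int_decode k))) UNIV"
proof -
  have "((\<lambda>k. f (int_decode k)) has_sum (\<Sum>k. f (int_decode k))) UNIV"
    by (rule norm_summable_imp_has_sum[OF assms summable_sums[OF summable_norm_cancel[OF assms]]])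
  then show ?thesis
    using has_sum_reindex_bij_betw[OF bij_int_decode, of f] by simp
qed

lemma tannery_int:
  fixes f :: "nat \<Rightarrow> int \<Rightarrow> complex"
  assumes lim: "\<And>n. (\<lambda>M. f M n) \<longlonglongrightarrow> g n"
    and bd: "\<And>M n. norm (f M n) \<le> h n" and sm: "h summable_on UNIV"
  shows "(\<lambda>M. infsum (f M) UNIV) \<longlonglongrightarrow> infsum g UNIV"
proof -
  have "(\<lambda>k. h (int_decode k)) summable_on UNIV"
    using sm summable_on_reindex_bij_betw[OF bij_int_decode, of h] by simp
  then have sh: "summable (\<lambda>k. h (int_decode k))"
    by (rule summable_on_imp_summable)
  note * = tannerys_theorem[of "\<lambda>k M. f M (int_decode k)" "\<lambda>k. g (int_decode k)" sequentially,
      OF lim _ sh]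
  have "eventually (\<lambda>(k, M). norm (f M (int_decode k)) \<le> h (int_decode k)) (at_top \<times>\<^sub>F sequentially)"
    by (intro always_eventually) (use bd in auto)
  note * = *[OF this trivial_limit_sequentially]
  have "(\<lambda>M. \<Sum>k. f M (int_decode k)) \<longlonglongrightarrow> (\<Sum>k. g (int_decode k))"
    and sg: "summable (\<lambda>k. norm (g (int_decode k)))"
    using * by blast+
  moreover have "infsum (f M) UNIV = (\<Sum>k. f M (int_decode k))" for M
    by (intro infsumI has_sum_int_decode summable_comparison_test'[OF sh, of 0]) (use bd in auto)
  moreover have "infsum g UNIV = (\<Sum>k. g (int_decode k))"
    by (intro infsumI has_sum_int_decode sg)
  ultimately show ?thesis
    by simp
qed

lemma summable_on_int_halves:
  fixes h :: "int \<Rightarrow> real"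
  assumes "\<And>n. h n \<ge> 0" "summable (\<lambda>n. h (int n))" "summable (\<lambda>n. h (- int n))"
  shows "h summable_on UNIV"
proof -
  have 1: "h summable_on range int"
    by (subst summable_on_reindex)
       (use assms in \<open>auto simp: o_def intro!: summable_nonneg_imp_summable_on\<close>)
  have 2: "h summable_on range (\<lambda>n. - int n)"
    by (subst summable_on_reindex)
       (use assms in \<open>auto simp: o_def inj_on_def intro!: summable_nonneg_imp_summable_on\<close>)
  have "x \<in> range int \<union> range (\<lambda>n. - int n)" for x
    by (cases x rule: int_cases2) auto
  then have "range int \<union> range (\<lambda>n. - int n) = UNIV"
    by blast
  then show ?thesis
    using summable_on_union[OF 1 2] by simp
qed

text \<open>The unilateral \<open>q\<close>-binomial theorem is applied to the terms with index \<open>n \<ge> -M\<close>,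
  re-indexed by \<open>k = n + M\<close>; the two-sided sum is the limit \<open>M \<rightarrow> \<infinity>\<close>.\<close>

lemma bilateral_q_binomial:
  fixes u :: "int \<Rightarrow> complex"
  assumes q: "norm q < 1" "q \<noteq> 0" and \<alpha>: "norm \<alpha> < 1" and \<beta>: "\<beta> \<noteq> 0"
    and u0: "u 0 = 1" and rec: "\<And>n. u (n + 1) = u n * (\<alpha> - \<beta> * q powi n)"
  shows "(\<lambda>n. norm (u n)) summable_on UNIV"
    and "(u has_sum (qpoch_inf q q * qpoch_inf \<beta> q * qpoch_inf (q / \<beta>) q /
           (qpoch_inf \<alpha> q * qpoch_inf (\<alpha> * q / \<beta>) q))) UNIV"
proof -
  define v where "v m = u (- int m)" for m
  have v0: "v 0 = 1"
    by (simp add: v_def u0)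
  have qp: "q powi (- 1 - int m) = 1 / q ^ Suc m" for m
    using q(2) by (simp add: power_int_minus power_int_diff field_simps)
  have vrec: "v m * q ^ Suc m = v (Suc m) * (\<alpha> * q ^ Suc m - \<beta>)" for m
    using rec[of "- int (Suc m)"] q(2) by (simp add: v_def qp field_simps)
  \<comment> \<open>Read backwards, the recursion never produces 0 and thereby excludes poles:
    \<alpha> q^(m+1) = \<beta> would contradict \<open>v m\<close> being nonzero.\<close>
  have vnz: "v m \<noteq> 0" for m
  proof (induction m)
    case (Suc m)
    then show ?case
      using vrec[of m] q(2) by auto
  qed (simp add: v0)
  have nz: "\<alpha> * q ^ Suc m - \<beta> \<noteq> 0" for m
    using vrec[of m] vnz[of m] q(2) by auto
  have vSuc: "v (Suc m) = q ^ Suc m / (\<alpha> * q ^ Suc m - \<beta>) * v m" for m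
    using vrec[of m] nz[of m] by (simp add: field_simps)
  have qlim: "(\<lambda>n. q ^ n) \<longlonglongrightarrow> 0"
    by (rule LIMSEQ_power_zero[OF q(1)])
  have "(\<lambda>n. \<alpha> - \<beta> * q ^ n) \<longlonglongrightarrow> \<alpha> - \<beta> * 0"
    by (intro tendsto_intros qlim)
  then have s1: "summable (\<lambda>n. norm (u (int n)))"
    by (rule summable_ratio_limit) (use rec[of "int _"] \<alpha> in \<open>auto simp: mult.commute add.commute\<close>)
  have "(\<lambda>n. q ^ Suc n / (\<alpha> * q ^ Suc n - \<beta>)) \<longlonglongrightarrow> 0 / (\<alpha> * 0 - \<beta>)"
    by (intro tendsto_intros LIMSEQ_Suc[OF qlim]) (use \<beta> in auto)
  then have "summable (\<lambda>n. norm (v n))"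
    by (rule summable_ratio_limit) (use vSuc in auto)
  then have s2: "summable (\<lambda>n. norm (u (- int n)))"
    by (simp add: v_def)
  show su: "(\<lambda>n. norm (u n)) summable_on UNIV"
    by (rule summable_on_int_halves) (use s1 s2 in auto)
  obtain K where K: "K > 0" "\<And>n. norm (inverse (qpoch q q n)) \<le> K"
    using inverse_qpoch_bounded[OF q(1), of q] mult_power_neq_1[OF q(1) q(1)] by blast
  \<comment> \<open>Up to the factor \<open>v M\<close> these are the unilateral terms for \<beta> /
    q^M, shifted by M. The weights 1 / (q;q)_(n+M) are bounded and tend to 1 / (q;q)_inf.\<close>
  define f where "f M n = (if n \<ge> - int M then u n * inverse (qpoch q q (nat (n + int M))) else 0)" for M n
  define R where "R M = qpoch (q / \<beta>) q M / qpoch (\<alpha> * q / \<beta>) q M" for M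
  have fac: "\<alpha> * q / \<beta> * q ^ i \<noteq> 1" for i
    using nz[of i] \<beta> by (simp add: field_simps)
  \<comment> \<open>\<open>v M\<close> compensates for the first M factors of (\<beta> / q^M;q)_inf,
    which grow with M; the product is a quotient with a limit.\<close>
  have vR: "v M * qpoch (\<beta> / q ^ M) q M = R M" for M
  proof (induction M)
    case (Suc M)
    have "v (Suc M) * qpoch (\<beta> / q ^ Suc M) q (Suc M) =
      (v M * qpoch (\<beta> / q ^ M) q M) * (q ^ Suc M / (\<alpha> * q ^ Suc M - \<beta>) * (1 - \<beta> / q ^ Suc M))"
      using q(2) unfolding vSuc qpoch_Suc_left by (simp add: field_simps)
    also have "q ^ Suc M / (\<alpha> * q ^ Suc M - \<beta>) * (1 - \<beta> / q ^ Suc M) =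
        (1 - q / \<beta> * q ^ M) / (1 - \<alpha> * q / \<beta> * q ^ M)"
    proof -
      have *: "(Q - \<beta>) / D = Q / D * (1 - \<beta> / Q)" if "Q \<noteq> 0" for Q D
        using that by (simp add: right_diff_distrib diff_divide_distrib)
      have "1 - \<alpha> * q / \<beta> * q ^ M = (\<beta> - \<alpha> * q ^ Suc M) / \<beta>" "1 - q / \<beta> * q ^ M = (\<beta> - q ^ Suc M) / \<beta>"
        using \<beta> by (simp_all add: field_simps)
      then have "(1 - q / \<beta> * q ^ M) / (1 - \<alpha> * q / \<beta> * q ^ M) = (\<beta> - q ^ Suc M) / (\<beta> - \<alpha> * q ^ Suc M)"
        using \<beta> by simp
      also have "\<dots> = (q ^ Suc M - \<beta>) / (\<alpha> * q ^ Suc M - \<beta>)"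
        by (metis minus_diff_eq minus_divide_divide)
      also have "\<dots> = q ^ Suc M / (\<alpha> * q ^ Suc M - \<beta>) * (1 - \<beta> / q ^ Suc M)"
        using *[of "q ^ Suc M" "\<alpha> * q ^ Suc M - \<beta>"] q(2) by simp
      finally show ?thesis by simp
    qed
    finally show ?case
      unfolding Suc.IH by (simp add: R_def qpoch_Suc)
  qed (simp add: v0 R_def)
  have uM: "u (int k - int M) = v M * (\<Prod>i<k. \<alpha> - \<beta> / q ^ M * q ^ i)" for k M
  proof (induction k)
    case (Suc k)
    have "u (int (Suc k) - int M) = u (int k - int M) * (\<alpha> - \<beta> * q powi (int k - int M))"
      using rec[of "int k - int M"] by (simp add: algebra_simps)
    then show ?case
      using Suc q(2) by (simp add: power_int_diff)
  qed (simp add: v_def)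
  have fM: "infsum (f M) UNIV = R M * (qpoch_inf \<beta> q / qpoch_inf \<alpha> q)" for M
  proof -
    have hs: "(\<lambda>k. (\<Prod>i<k. \<alpha> - \<beta> / q ^ M * q ^ i) / qpoch q q k) sums
        (qpoch_inf (\<beta> / q ^ M) q / qpoch_inf \<alpha> q)"
      and hn: "summable (\<lambda>k. norm ((\<Prod>i<k. \<alpha> - \<beta> / q ^ M * q ^ i) / qpoch q q k))"
      using homogeneous_q_binomial[OF q(1) \<alpha>, of "\<beta> / q ^ M"] by auto
    have "((\<lambda>k. v M * ((\<Prod>i<k. \<alpha> - \<beta> / q ^ M * q ^ i) / qpoch q q k)) has_sum
        (v M * (qpoch_inf (\<beta> / q ^ M) q / qpoch_inf \<alpha> q))) UNIV"
      by (intro has_sum_cmult_right norm_summable_imp_has_sum hs hn)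
    moreover have "v M * ((\<Prod>i<k. \<alpha> - \<beta> / q ^ M * q ^ i) / qpoch q q k) = f M (int k - int M)" for k
      by (simp add: f_def uM divide_inverse)
    ultimately have "((\<lambda>k. f M (int k - int M)) has_sum
        (v M * (qpoch_inf (\<beta> / q ^ M) q / qpoch_inf \<alpha> q))) UNIV"
      by simp
    then have "(f M has_sum (v M * (qpoch_inf (\<beta> / q ^ M) q / qpoch_inf \<alpha> q))) (range (\<lambda>k. int k - int M))"
      by (subst has_sum_reindex) (auto simp: inj_on_def o_def)
    moreover have "f M n = 0" if "n \<notin> range (\<lambda>k. int k - int M)" for n
    proof -
      have "\<not> n \<ge> - int M"
      proof
        assume "n \<ge> - int M"
        then have "n = int (nat (n + int M)) - int M"
          by simp
        with that show False
          by blast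
      qed
      then show ?thesis
        by (simp add: f_def)
    qed
    ultimately have "(f M has_sum (v M * (qpoch_inf (\<beta> / q ^ M) q / qpoch_inf \<alpha> q))) UNIV"
      by (subst has_sum_cong_neutral[where T = "range (\<lambda>k. int k - int M)" and g = "f M"]) auto
    moreover have "qpoch_inf (\<beta> / q ^ M) q = qpoch (\<beta> / q ^ M) q M * qpoch_inf \<beta> q"
      using qpoch_inf_split[OF q(1), of "\<beta> / q ^ M" M] q(2) by simp
    ultimately show ?thesis
      using vR[of M] by (simp add: infsumI mult.assoc[symmetric])
  qed
  have "(\<lambda>M. infsum (f M) UNIV) \<longlonglongrightarrow> (\<Sum>\<^sub>\<infinity>n. u n * inverse (qpoch_inf q q))"
  proof (rule tannery_int)
    show "(\<lambda>n. norm (u n) * K) summable_on UNIV"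
      by (intro summable_on_cmult_left su)
    show "norm (f M n) \<le> norm (u n) * K" for M n
      using K(1,2) by (auto simp: f_def norm_mult intro!: mult_left_mono)
    show "(\<lambda>M. f M n) \<longlonglongrightarrow> u n * inverse (qpoch_inf q q)" for n
    proof -
      have "filterlim (\<lambda>M. nat (n + int M)) at_top sequentially"
        unfolding filterlim_at_top eventually_sequentially
      proof (intro allI)
        fix Z :: nat
        show "\<exists>N. \<forall>M\<ge>N. Z \<le> nat (n + int M)"
          by (intro exI[of _ "nat (int Z - n)"]) auto
      qed
      then have "(\<lambda>M. qpoch q q (nat (n + int M))) \<longlonglongrightarrow> qpoch_inf q q"
        by (rule filterlim_compose[OF qpoch_tendsto[OF q(1)]])
      then have "(\<lambda>M. u n * inverse (qpoch q q (nat (n + int M)))) \<longlonglongrightarrow> u n * inverse (qpoch_inf q q)"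
        by (intro tendsto_intros) (use qpoch_inf_nonzero'[OF q(1) q(1)] in auto)
      moreover have "eventually (\<lambda>M. u n * inverse (qpoch q q (nat (n + int M))) = f M n) sequentially"
        unfolding eventually_sequentially by (intro exI[of _ "nat (- n)"]) (auto simp: f_def)
      ultimately show ?thesis
        by (rule Lim_transform_eventually)
    qed
  qed
  moreover have "(\<lambda>M. infsum (f M) UNIV) \<longlonglongrightarrow>
      qpoch_inf (q / \<beta>) q / qpoch_inf (\<alpha> * q / \<beta>) q * (qpoch_inf \<beta> q / qpoch_inf \<alpha> q)"
    unfolding fM R_def by (intro tendsto_intros qpoch_tendsto qpoch_inf_nonzero q fac)
  ultimately have "(\<Sum>\<^sub>\<infinity>n. u n * inverse (qpoch_inf q q)) =
      qpoch_inf (q / \<beta>) q / qpoch_inf (\<alpha> * q / \<beta>) q * (qpoch_inf \<beta> q / qpoch_inf \<alpha> q)"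
    by (rule LIMSEQ_unique)
  then have "infsum u UNIV * inverse (qpoch_inf q q) =
      qpoch_inf (q / \<beta>) q / qpoch_inf (\<alpha> * q / \<beta>) q * (qpoch_inf \<beta> q / qpoch_inf \<alpha> q)"
    by (simp add: infsum_cmult_left')
  then have "infsum u UNIV = qpoch_inf q q * qpoch_inf \<beta> q * qpoch_inf (q / \<beta>) q /
           (qpoch_inf \<alpha> q * qpoch_inf (\<alpha> * q / \<beta>) q)"
    using qpoch_inf_nonzero'[OF q(1) q(1)] by (simp add: field_simps)
  moreover have "u summable_on UNIV"
    using abs_summable_summable[OF su] .
  ultimately show "(u has_sum (qpoch_inf q q * qpoch_inf \<beta> q * qpoch_inf (q / \<beta>) q /
           (qpoch_inf \<alpha> q * qpoch_inf (\<alpha> * q / \<beta>) q))) UNIV"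
    by (simp add: has_sum_iff)
qed

subsection \<open>An even q-Gauss sum\<close>

text \<open>The \<open>q\<close>-Gauss sum with upper parameters \<open>a, -a\<close>, where \<open>A = a\<^sup>2\<close>. The argument
  \<open>-c/A\<close> may lie on the unit circle, where only the Abel-summed form converges.
  Both forms follow from telescoping in \<open>c \<mapsto> c q\<close>.\<close>

definition gauss_coeff :: "complex \<Rightarrow> complex \<Rightarrow> complex \<Rightarrow> nat \<Rightarrow> complex" where
  "gauss_coeff q A c n = qpoch A (q\<^sup>2) n / (qpoch q q n * qpoch c q n)"

text \<open>Backward difference with s(-1) = 0. The power series of \<open>bdiff s\<close> in z is 1
  - z times that of s, so at z = -1 its sum is twice the Cesaro value of the alternating series of
  s.\<close>

definition bdiff :: "(nat \<Rightarrow> complex) \<Rightarrow> nat \<Rightarrow> complex" where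
  "bdiff s n = s n - (if n = 0 then 0 else s (n - 1))"

lemma bdiff_simps [simp]: "bdiff s 0 = s 0" "bdiff s (Suc n) = s (Suc n) - s n"
  by (simp_all add: bdiff_def)

lemma norm_square_lt_1: "norm (q\<^sup>2 :: complex) < 1" if "norm q < 1"
  using that by (simp add: norm_power power_less_one_iff)

lemma norm_mult_lt_1:
  fixes a b :: complex
  assumes "norm a < 1" "norm b \<le> 1"
  shows "norm (a * b) < 1"
  by (metis assms linorder_not_less mult_left_le norm_ge_zero norm_mult order_trans)

text \<open>Uniformity in N comes from (c q^N;q)_n = (c;q)_(N+n) / (c;q)_N.\<close>

lemma gauss_coeff_bounded:
  assumes q: "norm q < 1" and c: "norm c < 1"
  obtains K where "K > 0" "\<And>N n. norm (gauss_coeff q A (c * q ^ N) n) \<le> K"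
proof -
  obtain K1 where K1: "K1 > 0" "\<And>n. norm (qpoch A (q\<^sup>2) n) \<le> K1"
    using qpoch_bounded[OF norm_square_lt_1[OF q]] by metis
  obtain K2 where K2: "K2 > 0" "\<And>n. norm (inverse (qpoch q q n)) \<le> K2"
    using inverse_qpoch_bounded[OF q, of q] mult_power_neq_1[OF q q] by metis
  obtain K3 where K3: "K3 > 0" "\<And>n. norm (qpoch c q n) \<le> K3"
    using qpoch_bounded[OF q] by metis
  obtain K4 where K4: "K4 > 0" "\<And>n. norm (inverse (qpoch c q n)) \<le> K4"
    using inverse_qpoch_bounded[OF q, of c] mult_power_neq_1[OF q c] by metis
  have "norm (gauss_coeff q A (c * q ^ N) n) \<le> K1 * K2 * (K3 * K4)" for N n
  proof -
    have "gauss_coeff q A (c * q ^ N) n =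
        qpoch A (q\<^sup>2) n * inverse (qpoch q q n) * (qpoch c q N * inverse (qpoch c q (N + n)))"
      using qpoch_nonzero'[OF q c, of N] by (simp add: gauss_coeff_def qpoch_add divide_simps)
    then show ?thesis
      using K1 K2 K3 K4 by (auto simp: norm_mult intro!: mult_mono)
  qed
  then show ?thesis
    using that[of "K1 * K2 * (K3 * K4)"] K1 K2 K3 K4 by simp
qed

text \<open>The contiguous relation between c and c q at the level of partial sums. The remainder
  carries z^(N+1) q^N, so it vanishes in the limit as soon as |z q| < 1, and z itself may lie on the
  unit circle.\<close>

lemma gauss_telescope:
  assumes q: "norm q < 1" and c: "norm c < 1" and A: "A \<noteq> 0"
  defines "s \<equiv> gauss_coeff q A c" and "z \<equiv> - c / A"
  shows "(\<Sum>n<Suc N. (1 - c) * (z ^ n * bdiff s n) -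
            (1 - c\<^sup>2 / A) * ((z * q) ^ n * gauss_coeff q A (c * q) n)) =
         (1 - c) * z ^ Suc N * s N * q ^ N * (A * q ^ N - c) / (1 - c * q ^ N)"
proof -
  have c1: "1 - c * q ^ n \<noteq> 0" for n
    using mult_power_neq_1[OF q c] by simp
  have q1: "1 - q * q ^ n \<noteq> 0" for n
    using mult_power_neq_1[OF q q] by simp
  have sq: "gauss_coeff q A (c * q) n = s n * (1 - c) / (1 - c * q ^ n)" for n
  proof -
    have "(1 - c) * qpoch (c * q) q n = qpoch c q n * (1 - c * q ^ n)"
      by (metis qpoch_Suc qpoch_Suc_left)
    moreover have "qpoch (c * q) q n \<noteq> 0"
      using qpoch_nonzero'[OF q c, of "Suc n"] by (simp add: qpoch_Suc_left)
    moreover have "1 - c \<noteq> 0"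
      using c1[of 0] by simp
    ultimately show ?thesis
      using qpoch_nonzero'[OF q c, of n] qpoch_nonzero'[OF q q, of n] c1[of n]
      by (simp add: s_def gauss_coeff_def frac_eq_eq)
  qed
  have sSuc: "s (Suc n) = s n * (1 - A * (q ^ n)\<^sup>2) / ((1 - q * q ^ n) * (1 - c * q ^ n))" for n
    by (simp add: s_def gauss_coeff_def qpoch_Suc power_mult[symmetric] mult.commute)
  show ?thesis
  proof (induction N)
    case 0
    have "1 - c \<noteq> 0"
      using c1[of 0] by simp
    then show ?case
      using A by (simp add: sq z_def field_simps power2_eq_square s_def gauss_coeff_def)
  next
    case (Suc N)
    define Q where "Q = q ^ N"
    define x where "x = s N * z ^ Suc N"
    have nz: "1 - q * Q \<noteq> 0" "1 - c * Q \<noteq> 0" "1 - c * (q * Q) \<noteq> 0"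
      using q1[of N] c1[of N] c1[of "Suc N"] by (simp_all add: Q_def)
    define \<rho> where "\<rho> = (1 - A * Q\<^sup>2) / ((1 - q * Q) * (1 - c * Q))"
    have \<rho>: "\<rho> * ((1 - q * Q) * (1 - c * Q)) = 1 - A * Q\<^sup>2"
      using nz by (simp add: \<rho>_def)
    have sS: "s (Suc N) = s N * \<rho>"
      by (simp add: sSuc \<rho>_def Q_def)
    have zA: "c = - z * A"
      using A by (simp add: z_def)
    \<comment> \<open>The induction step divided by \<open>(1 - c) * x\<close>, with \<rho> the
      ratio of consecutive coefficients. It splits into two halves, \<open>X - 1\<close> and
      \<open>\<rho> - B - E\<close>, which equal \<rho> (1 - q Q) up to opposite signs.\<close>
    have key: "Q * (A * Q - c) / (1 - c * Q) + (\<rho> - 1) - (1 + z * c) * (q * Q) * \<rho> / (1 - c * (q * Q))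
       = z * \<rho> * (q * Q) * (A * (q * Q) - c) / (1 - c * (q * Q))"
    proof -
      define X B E where "X = Q * (A * Q - c) / (1 - c * Q)"
        and "B = (1 + z * c) * (q * Q) * \<rho> / (1 - c * (q * Q))"
        and "E = z * \<rho> * (q * Q) * (A * (q * Q) - c) / (1 - c * (q * Q))"
      have 1: "X - 1 = - \<rho> * (1 - q * Q)"
        using nz \<rho> by (simp add: X_def field_simps power2_eq_square)
      have "\<rho> - B - E
          = \<rho> * ((1 - c * (q * Q)) - (1 + z * c) * (q * Q) - z * (q * Q) * (A * (q * Q) - c)) / (1 - c * (q * Q))"
      proof -
        have "\<rho> - b * \<rho> / D - z * \<rho> * t * e / D = \<rho> * (D - b - z * t * e) / D" if "D \<noteq> 0" for b t e D
          using that by (simp add: diff_divide_distrib right_diff_distrib mult_ac)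
        from this[OF nz(3)] show ?thesis
          unfolding B_def E_def by simp
      qed
      also have "(1 - c * (q * Q)) - (1 + z * c) * (q * Q) - z * (q * Q) * (A * (q * Q) - c)
          = (1 - q * Q) * (1 - c * (q * Q))"
        by (simp add: zA algebra_simps)
      finally have 2: "\<rho> - B - E = \<rho> * (1 - q * Q)"
        using nz by simp
      have "X + (\<rho> - 1) - B - E = (X - 1) + (\<rho> - B - E)"
        by simp
      also have "\<dots> = 0"
        unfolding 1 2 by simp
      finally show ?thesis
        unfolding X_def[symmetric] B_def[symmetric] E_def[symmetric] by simp
    qed
    have cA: "1 - c\<^sup>2 / A = 1 + z * c"
      using A by (simp add: z_def power2_eq_square)
    have "(1 - c) * z ^ Suc N * s N * q ^ N * (A * q ^ N - c) / (1 - c * q ^ N) +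
       ((1 - c) * (z ^ Suc N * bdiff s (Suc N)) -
            (1 - c\<^sup>2 / A) * ((z * q) ^ Suc N * gauss_coeff q A (c * q) (Suc N)))
      = (1 - c) * x * (Q * (A * Q - c) / (1 - c * Q) + (\<rho> - 1) - (1 + z * c) * (q * Q) * \<rho> / (1 - c * (q * Q)))"
      unfolding cA sq sS bdiff_simps by (simp add: x_def Q_def power_mult_distrib field_simps)
    also have "\<dots> = (1 - c) * z ^ Suc (Suc N) * s (Suc N) * q ^ Suc N * (A * q ^ Suc N - c) / (1 - c * q ^ Suc N)"
      unfolding key sS by (simp add: x_def Q_def)
    finally show ?case
      using Suc.IH by simp
  qed
qed

lemma gauss_step:
  assumes q: "norm q < 1" and c: "norm c < 1" and A: "A \<noteq> 0" and z: "norm (c * q / A) < 1"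
  shows "summable (\<lambda>n. norm ((- c * q / A) ^ n * gauss_coeff q A (c * q) n))"
    and "(\<lambda>n. (1 - c) * ((- c / A) ^ n * bdiff (gauss_coeff q A c) n)) sums
      ((1 - c\<^sup>2 / A) * (\<Sum>n. (- c * q / A) ^ n * gauss_coeff q A (c * q) n))"
proof -
  define z where "z = - c / A"
  have z1: "norm (z * q) < 1"
    using assms(4) by (simp add: z_def)
  obtain K where K: "K > 0" "\<And>N n. norm (gauss_coeff q A (c * q ^ N) n) \<le> K"
    using gauss_coeff_bounded[OF q c] by metis
  have sg: "summable (\<lambda>n. norm ((z * q) ^ n * gauss_coeff q A (c * q) n))"
  proof (rule summable_comparison_test'[of "\<lambda>n. norm (z * q) ^ n * K" 0])
    show "summable (\<lambda>n. norm (z * q) ^ n * K)"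
      using z1 by (intro summable_mult2 summable_geometric) auto
    show "norm (norm ((z * q) ^ n * gauss_coeff q A (c * q) n)) \<le> norm (z * q) ^ n * K" for n
      using K(2)[of 1 n] by (simp add: norm_mult norm_power mult_left_mono)
  qed
  then show "summable (\<lambda>n. norm ((- c * q / A) ^ n * gauss_coeff q A (c * q) n))"
    by (simp add: z_def)
  have "(\<lambda>N. (1 - c) * z ^ Suc N * gauss_coeff q A c N * q ^ N * (A * q ^ N - c) / (1 - c * q ^ N)) \<longlonglongrightarrow> 0"
  proof -
    have "(\<lambda>N. norm ((z * q) ^ N) * K) \<longlonglongrightarrow> norm (0 :: complex) * K"
      by (intro tendsto_intros LIMSEQ_power_zero z1)
    then have "(\<lambda>N. norm ((z * q) ^ N) * K) \<longlonglongrightarrow> 0"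
      by simp
    then have "(\<lambda>N. (z * q) ^ N * gauss_coeff q A c N) \<longlonglongrightarrow> 0"
      by (rule Lim_null_comparison[rotated])
         (use K(2)[of 0] in \<open>auto simp: norm_mult mult_left_mono\<close>)
    moreover have "(\<lambda>N. q ^ N) \<longlonglongrightarrow> 0"
      by (rule LIMSEQ_power_zero[OF q])
    ultimately have "(\<lambda>N. (1 - c) * z * ((z * q) ^ N * gauss_coeff q A c N) * (A * q ^ N - c) / (1 - c * q ^ N))
        \<longlonglongrightarrow> (1 - c) * z * 0 * (A * 0 - c) / (1 - c * 0)"
      by (intro tendsto_intros) (use q in auto)
    then show ?thesis
      by (simp add: power_mult_distrib mult_ac)
  qed
  then have "(\<lambda>N. \<Sum>n<Suc N. (1 - c) * (z ^ n * bdiff (gauss_coeff q A c) n) -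
            (1 - c\<^sup>2 / A) * ((z * q) ^ n * gauss_coeff q A (c * q) n)) \<longlonglongrightarrow> 0"
    unfolding z_def gauss_telescope[OF q c A] .
  then have "(\<lambda>n. (1 - c) * (z ^ n * bdiff (gauss_coeff q A c) n) -
            (1 - c\<^sup>2 / A) * ((z * q) ^ n * gauss_coeff q A (c * q) n)) sums 0"
    unfolding sums_def by (rule LIMSEQ_imp_Suc)
  moreover have "(\<lambda>n. (1 - c\<^sup>2 / A) * ((z * q) ^ n * gauss_coeff q A (c * q) n)) sums
       ((1 - c\<^sup>2 / A) * (\<Sum>n. (z * q) ^ n * gauss_coeff q A (c * q) n))"
    by (intro sums_mult summable_sums summable_norm_cancel[OF sg])
  ultimately show "(\<lambda>n. (1 - c) * ((- c / A) ^ n * bdiff (gauss_coeff q A c) n)) sums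
      ((1 - c\<^sup>2 / A) * (\<Sum>n. (- c * q / A) ^ n * gauss_coeff q A (c * q) n))"
    using sums_add by (fastforce simp: z_def)
qed

lemma sums_bdiff:
  assumes "summable (\<lambda>n. z ^ n * s n)"
  shows "(\<lambda>n. z ^ n * bdiff s n) sums ((1 - z) * (\<Sum>n. z ^ n * s n))"
proof -
  define S where "S = (\<Sum>n. z ^ n * s n)"
  have 1: "(\<lambda>n. z ^ n * s n) sums S"
    unfolding S_def by (rule summable_sums[OF assms])
  have "(\<lambda>n. if n = 0 then 0 else z ^ n * s (n - 1)) sums (z * S)"
    using sums_mult[OF 1, of z] sums_Suc_iff[of "\<lambda>n. if n = 0 then 0 else z ^ n * s (n - 1)" "z * S"]
    by (simp add: mult.assoc)
  from sums_diff[OF 1 this] show ?thesis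
    unfolding S_def[symmetric] by (simp add: bdiff_def algebra_simps if_distrib cong: if_cong)
qed

text \<open>\<open>gauss_step\<close> and \<open>sums_bdiff\<close> together express
  \<open>\<Psi> N\<close> by \<open>\<Psi> (Suc N)\<close>. Iteration leads to the limit 1, because
  only the term n = 0 survives when the argument z q^N tends to 0.\<close>

lemma even_q_gauss:
  assumes q: "norm q < 1" and c: "norm c < 1" and A: "A \<noteq> 0" and z: "norm (c / A) < 1"
  shows "(\<lambda>n. (- c / A) ^ n * gauss_coeff q A c n) sums
     (qpoch_inf (c\<^sup>2 / A) (q\<^sup>2) / (qpoch_inf c q * qpoch_inf (- c / A) q))"
proof -
  define z where "z = - c / A"
  have nz: "norm z < 1"
    using z by (simp add: z_def)
  obtain K where K: "K > 0" "\<And>N n. norm (gauss_coeff q A (c * q ^ N) n) \<le> K"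
    using gauss_coeff_bounded[OF q c] by metis
  have gz: "summable (\<lambda>n. norm z ^ n * K)"
    using nz by (intro summable_mult2 summable_geometric) auto
  have bd: "norm ((z * q ^ N) ^ n * gauss_coeff q A (c * q ^ N) n) \<le> norm z ^ n * K" for N n
  proof -
    have "norm (z * q ^ N) \<le> norm z"
      using q by (simp add: norm_mult norm_power mult_left_le power_le_one)
    then show ?thesis
      using K by (auto simp: norm_mult norm_power intro!: mult_mono power_mono)
  qed
  define \<Psi> where "\<Psi> N = (\<Sum>n. (z * q ^ N) ^ n * gauss_coeff q A (c * q ^ N) n)" for N
  have sN: "summable (\<lambda>n. (z * q ^ N) ^ n * gauss_coeff q A (c * q ^ N) n)" for N
    by (rule summable_comparison_test'[OF gz, of 0]) (use bd in auto)
  have step: "(1 - c * q ^ N) * (1 - z * q ^ N) * \<Psi> N = (1 - c\<^sup>2 / A * (q\<^sup>2) ^ N) * \<Psi> (Suc N)" for N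
  proof -
    have cN: "norm (c * q ^ N) < 1"
      by (smt (verit) c norm_ge_zero norm_mult norm_power mult_left_le power_le_one q)
    have "norm (z * q ^ N * q) < 1"
      by (smt (verit) nz norm_ge_zero norm_mult norm_power mult_left_le power_le_one q)
    then have "norm (c * q ^ N * q / A) < 1"
      by (simp add: z_def)
    from gauss_step(2)[OF q cN A this]
    have "(\<lambda>n. (1 - c * q ^ N) * ((z * q ^ N) ^ n * bdiff (gauss_coeff q A (c * q ^ N)) n)) sums
        ((1 - (c * q ^ N)\<^sup>2 / A) * \<Psi> (Suc N))"
      by (simp add: z_def \<Psi>_def mult_ac)
    moreover have "(\<lambda>n. (1 - c * q ^ N) * ((z * q ^ N) ^ n * bdiff (gauss_coeff q A (c * q ^ N)) n)) sums
        ((1 - c * q ^ N) * ((1 - z * q ^ N) * \<Psi> N))"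
      unfolding \<Psi>_def by (intro sums_mult sums_bdiff sN)
    ultimately have "(1 - (c * q ^ N)\<^sup>2 / A) * \<Psi> (Suc N) = (1 - c * q ^ N) * ((1 - z * q ^ N) * \<Psi> N)"
      by (rule sums_unique2)
    then show ?thesis
      by (simp add: power_mult_distrib power_mult[symmetric] mult.commute)
  qed
  have it: "qpoch c q N * qpoch z q N * \<Psi> 0 = qpoch (c\<^sup>2 / A) (q\<^sup>2) N * \<Psi> N" for N
  proof (induction N)
    case (Suc N)
    have "qpoch c q (Suc N) * qpoch z q (Suc N) * \<Psi> 0 =
        (qpoch c q N * qpoch z q N * \<Psi> 0) * ((1 - c * q ^ N) * (1 - z * q ^ N))"
      by (simp add: qpoch_Suc)
    also have "\<dots> = qpoch (c\<^sup>2 / A) (q\<^sup>2) N * ((1 - c * q ^ N) * (1 - z * q ^ N) * \<Psi> N)"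
      unfolding Suc.IH by (simp only: mult_ac)
    finally show ?case
      unfolding step by (simp add: qpoch_Suc)
  qed simp
  have q0: "(\<lambda>N. q ^ N) \<longlonglongrightarrow> 0"
    by (rule LIMSEQ_power_zero[OF q])
  have "(\<lambda>N. \<Psi> N) \<longlonglongrightarrow> (\<Sum>n. (z * 0) ^ n * (qpoch A (q\<^sup>2) n / (qpoch q q n * qpoch (c * 0) q n)))"
    unfolding \<Psi>_def
  proof (intro tannerys_theorem[THEN conjunct2, THEN conjunct2, OF _ _ gz])
    show "(\<lambda>N. (z * q ^ N) ^ n * gauss_coeff q A (c * q ^ N) n) \<longlonglongrightarrow>
        (z * 0) ^ n * (qpoch A (q\<^sup>2) n / (qpoch q q n * qpoch (c * 0) q n))" for n
      unfolding gauss_coeff_def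
      by (intro tendsto_intros q0 tendsto_prod[of _ _ _ sequentially, folded qpoch_def])
         (use qpoch_nonzero'[OF q q] q in \<open>auto simp: qpoch_def intro!: tendsto_eq_intros q0\<close>)
    show "\<forall>\<^sub>F (n, N) in sequentially \<times>\<^sub>F sequentially.
       norm ((z * q ^ N) ^ n * gauss_coeff q A (c * q ^ N) n) \<le> norm z ^ n * K"
      by (intro always_eventually) (use bd in auto)
  qed auto
  moreover have "(\<Sum>n. (z * 0) ^ n * (qpoch A (q\<^sup>2) n / (qpoch q q n * qpoch (c * 0) q n))) = 1"
    using powser_zero[of "\<lambda>n. qpoch A (q\<^sup>2) n / (qpoch q q n * qpoch (c * 0) q n)"] by (simp add: mult.commute)
  ultimately have \<Psi>1: "(\<lambda>N. \<Psi> N) \<longlonglongrightarrow> 1"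
    by simp
  have "(\<lambda>N. qpoch c q N * qpoch z q N * \<Psi> 0) \<longlonglongrightarrow> qpoch_inf c q * qpoch_inf z q * \<Psi> 0"
    by (intro tendsto_intros qpoch_tendsto q)
  moreover have "(\<lambda>N. qpoch c q N * qpoch z q N * \<Psi> 0) \<longlonglongrightarrow> qpoch_inf (c\<^sup>2 / A) (q\<^sup>2) * 1"
    unfolding it by (intro tendsto_intros qpoch_tendsto \<Psi>1 norm_square_lt_1 q)
  ultimately have "qpoch_inf c q * qpoch_inf z q * \<Psi> 0 = qpoch_inf (c\<^sup>2 / A) (q\<^sup>2)"
    using LIMSEQ_unique by fastforce
  then have "\<Psi> 0 = qpoch_inf (c\<^sup>2 / A) (q\<^sup>2) / (qpoch_inf c q * qpoch_inf z q)"
    using qpoch_inf_nonzero'[OF q c] qpoch_inf_nonzero'[OF q nz] by (simp add: field_simps)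
  then show ?thesis
    using summable_sums[OF sN[of 0]] by (simp add: \<Psi>_def z_def)
qed

text \<open>Differencing contributes the factor 1 + c/A, which cancels the first factor of
  (-c/A;q)_inf. What remains still makes sense for |c/A| = 1; the case used later is c = A.\<close>

lemma even_q_gauss_abel:
  assumes q: "norm q < 1" and c: "norm c < 1" and A: "A \<noteq> 0" and z: "norm (c * q / A) < 1"
  shows "(\<lambda>n. (- c / A) ^ n * bdiff (gauss_coeff q A c) n) sums
     (qpoch_inf (c\<^sup>2 / A) (q\<^sup>2) / (qpoch_inf c q * qpoch_inf (- c * q / A) q))"
proof -
  have c1: "1 - c \<noteq> 0"
    using c by auto
  have cq: "norm (c * q) < 1"
    using c q by (intro norm_mult_lt_1) auto
  have "(\<Sum>n. (- c * q / A) ^ n * gauss_coeff q A (c * q) n) =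
      qpoch_inf ((c * q)\<^sup>2 / A) (q\<^sup>2) / (qpoch_inf (c * q) q * qpoch_inf (- c * q / A) q)"
    using sums_unique[OF even_q_gauss[OF q cq A z]] by simp
  moreover have "(1 - c\<^sup>2 / A) * qpoch_inf ((c * q)\<^sup>2 / A) (q\<^sup>2) = qpoch_inf (c\<^sup>2 / A) (q\<^sup>2)"
    using qpoch_inf_rec[OF norm_square_lt_1[OF q], of "c\<^sup>2 / A"] by (simp add: power_mult_distrib)
  moreover have "(1 - c) * qpoch_inf (c * q) q = qpoch_inf c q"
    using qpoch_inf_rec[OF q, of c] by simp
  moreover have "(\<lambda>n. (- c / A) ^ n * bdiff (gauss_coeff q A c) n) sums
      ((1 - c\<^sup>2 / A) * (\<Sum>n. (- c * q / A) ^ n * gauss_coeff q A (c * q) n) / (1 - c))"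
    using sums_divide[OF gauss_step(2)[OF q c A z], of "1 - c"] c1 by simp
  ultimately show ?thesis
    by (simp add: mult.assoc[symmetric] mult.commute)
qed

subsection \<open>Partial fractions and the alternating series for \<open>S\<^sub>4\<close>\<close>

lemma summable_on_product:
  fixes a :: "'a \<Rightarrow> real" and b :: "'b \<Rightarrow> real"
  assumes a: "a summable_on A" "\<And>x. a x \<ge> 0" and b: "b summable_on B" "\<And>y. b y \<ge> 0"
  shows "(\<lambda>(x, y). a x * b y) summable_on A \<times> B"
proof -
  have "(\<lambda>p. norm (a (fst p) * b (snd p))) summable_on A \<times> B"
    unfolding Infinite_Sum.abs_summable_on_Sigma_iff
    using a b by (auto simp: abs_mult infsum_cmult_right' infsum_nonneg intro!: summable_on_cmult_left summable_on_cmult_right)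
  then show ?thesis
    using a(2) b(2) by (simp add: case_prod_unfold)
qed

lemma summable_on_product_bound:
  fixes f :: "'a \<Rightarrow> 'b \<Rightarrow> complex"
  assumes a: "a summable_on A" "\<And>x. a x \<ge> 0" and b: "b summable_on B" "\<And>y. b y \<ge> 0"
    and f: "\<And>x y. x \<in> A \<Longrightarrow> y \<in> B \<Longrightarrow> norm (f x y) \<le> a x * b y"
  shows "(\<lambda>(x, y). f x y) summable_on A \<times> B"
proof (rule abs_summable_summable)
  show "(\<lambda>p. norm (case p of (x, y) \<Rightarrow> f x y)) summable_on A \<times> B"
    by (rule Infinite_Sum.abs_summable_on_comparison_test'[OF summable_on_product[OF a b]]) (use f in auto)
qed

lemma has_sum_nat_suminf:
  fixes f :: "nat \<Rightarrow> complex"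
  assumes "f summable_on UNIV"
  shows "infsum f UNIV = (\<Sum>n. f n)" "summable f"
  using has_sum_imp_sums[OF has_sum_infsum[OF assms]] by (simp_all add: sums_iff)

lemma has_sum_int_split:
  fixes f :: "int \<Rightarrow> complex"
  assumes "f summable_on UNIV"
  shows "summable (\<lambda>n. f (int n))" "summable (\<lambda>n. f (- int (Suc n)))"
    and "infsum f UNIV = (\<Sum>n. f (int n)) + (\<Sum>n. f (- int (Suc n)))"
proof -
  have "n \<in> range int \<union> range (\<lambda>n. - int (Suc n))" for n
    by (cases n) auto
  then have U: "UNIV = range int \<union> range (\<lambda>n. - int (Suc n))"
    by blast
  have s: "f summable_on range int" "f summable_on range (\<lambda>n. - int (Suc n))"
    using assms summable_on_subset_banach by blast+
  have inj: "inj int" "inj (\<lambda>n. - int (Suc n))"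
    by (auto simp: inj_def)
  have sn: "(\<lambda>n. f (int n)) summable_on UNIV" "(\<lambda>n. f (- int (Suc n))) summable_on UNIV"
    using s unfolding summable_on_reindex[OF inj(1)] summable_on_reindex[OF inj(2)] by (simp_all add: o_def)
  then show "summable (\<lambda>n. f (int n))" "summable (\<lambda>n. f (- int (Suc n)))"
    by (auto intro: has_sum_nat_suminf(2))
  have "infsum f UNIV = infsum f (range int \<union> range (\<lambda>n. - int (Suc n)))"
    by (rule arg_cong[OF U])
  also have "\<dots> = infsum f (range int) + infsum f (range (\<lambda>n. - int (Suc n)))"
    by (rule infsum_Un_disjoint) (use s in auto)
  also have "\<dots> = (\<Sum>n. f (int n)) + (\<Sum>n. f (- int (Suc n)))"
    unfolding infsum_reindex[OF inj(1)] infsum_reindex[OF inj(2)] o_def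
    using has_sum_nat_suminf(1)[OF sn(1)] has_sum_nat_suminf(1)[OF sn(2)] by simp
  finally show "infsum f UNIV = (\<Sum>n. f (int n)) + (\<Sum>n. f (- int (Suc n)))" .
qed

definition tri :: "nat \<Rightarrow> nat" where
  "tri n = n * (n + 1) div 2"

lemma tri_0 [simp]: "tri 0 = 0"
  by (simp add: tri_def)

lemma tri_Suc: "tri (Suc n) = tri n + Suc n"
  by (simp add: tri_def)

lemma tri_ge: "n \<le> tri n"
  by (induction n) (simp_all add: tri_Suc)

lemma two_tri: "2 * tri n = n * n + n"
  by (induction n) (simp_all add: tri_Suc)

lemma one_plus_power_nonzero:
  fixes q :: complex
  assumes "norm q < 1"
  shows "1 + q ^ n \<noteq> 0"
proof (cases n)
  case (Suc m)
  define X where "X = (- q) * q ^ m"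
  have "X \<noteq> 1"
    unfolding X_def by (rule mult_power_neq_1) (use assms in auto)
  moreover have "1 + q ^ n = 1 - X"
    by (simp add: Suc X_def)
  ultimately show ?thesis
    by simp
qed simp

lemma one_plus_power_lower:
  fixes q :: complex
  assumes "norm q < 1"
  shows "1 - norm q \<le> norm (1 + q ^ n)"
proof -
  have "norm q ^ n \<le> norm q" if "n \<noteq> 0"
    using that assms power_decreasing[of 1 n "norm q"] by simp
  then have "1 - norm q \<le> 1 - norm (q ^ n) \<or> n = 0"
    unfolding norm_power by linarith
  moreover have "1 - norm (q ^ n) \<le> norm (1 + q ^ n)"
    using norm_diff_ineq[of 1 "q ^ n"] by simp
  moreover have "1 - norm q \<le> 2"
    using norm_ge_zero[of q] by linarith
  ultimately show ?thesis
    by auto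
qed

text \<open>Convention: \<open>1 / (q;q)\<^sub>m = 0\<close> for negative \<open>m\<close>.\<close>

definition inv_qfact :: "complex \<Rightarrow> nat \<Rightarrow> nat \<Rightarrow> complex" where
  "inv_qfact q n j = (if j \<le> n then inverse (qpoch q q (n - j)) else 0)"

text \<open>Up to the factor (-1)^j / 2 this is the sum of the terms j and -j in the bilateral
  series of S_4, or the single middle term if j = 0; see \<open>S4_coeff_sum\<close>.\<close>

definition pf_weight :: "complex \<Rightarrow> nat \<Rightarrow> complex" where
  "pf_weight q j = (if j = 0 then 1 else 4 * (- 1) ^ j * q ^ tri j / (1 + q ^ j))"

lemma inv_qfact_Suc_right:
  assumes "norm q < 1" "j \<le> n"
  shows "inv_qfact q n (Suc j) = inv_qfact q n j * (1 - q ^ (n - j))"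
proof (cases "j = n")
  case False
  then obtain m where m: "n = j + Suc m"
    using assms(2) less_imp_Suc_add[of j n] by auto
  have "1 - q * q ^ m \<noteq> 0"
    using mult_power_neq_1[OF assms(1,1)] by simp
  then show ?thesis
    by (simp add: m inv_qfact_def qpoch_Suc)
qed (simp add: inv_qfact_def)

lemma inv_qfact_Suc_Suc: "inv_qfact q (Suc n) (Suc j) = inv_qfact q n j"
  by (simp add: inv_qfact_def)

text \<open>A Bailey pair relative to 1, proved by telescoping of WZ type: (1 + q^N)^2 times the
  summand for N, minus the summand for N - 1, is a difference in j of an explicit function, so the
  sums over j satisfy the recursion of 1 / (-q;q)_n^2.\<close>

lemma partial_fraction:
  assumes q: "norm q < 1"
  shows "(\<Sum>j\<le>n. pf_weight q j * inv_qfact q n j / qpoch q q (n + j)) = 1 / (qpoch (- q) q n)\<^sup>2"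
proof (induction n)
  case 0
  then show ?case
    by (simp add: pf_weight_def inv_qfact_def)
next
  case (Suc n)
  define N where "N = Suc n"
  define Q where "Q = q ^ N"
  have nz: "1 - q ^ Suc i \<noteq> 0" for i
    using mult_power_neq_1[OF q q, of i] by simp
  have Q1: "1 - Q \<noteq> 0"
    using nz[of n] by (simp add: Q_def N_def)
  have pz: "qpoch q q i \<noteq> 0" for i
    by (rule qpoch_nonzero'[OF q q])
  \<comment> \<open>The telescoping certificate. It vanishes at i = N because of
    \<open>inv_qfact\<close>, and \<open>g 0\<close> equals the contribution of j = 0, so everything
    cancels.\<close>
  define g where "g i = 4 * (- 1) ^ i * q ^ tri i * Q / (1 - Q) * inv_qfact q N (Suc i) / qpoch q q (N + i)" for i
  define h where "h i = 4 * (- 1) ^ Suc i * Q * q ^ tri i * (1 + q ^ Suc i) * inv_qfact q N (Suc i) / qpoch q q (N + Suc i)" for i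
  have gh: "g (Suc i) - g i = h i" if "Suc i \<le> N" for i
  proof -
    define P where "P = inv_qfact q N (Suc i)"
    define D where "D = qpoch q q (N + i)"
    have D: "D \<noteq> 0" using pz by (simp add: D_def)
    have d: "1 - Q * q ^ Suc i \<noteq> 0"
      using nz[of "N + i"] by (simp add: Q_def power_add mult_ac)
    have e1: "qpoch q q (N + Suc i) = D * (1 - Q * q ^ Suc i)"
      by (simp add: D_def qpoch_Suc Q_def power_add mult_ac)
    have e2: "inv_qfact q N (Suc (Suc i)) = P * (1 - q ^ (N - Suc i))"
      using inv_qfact_Suc_right[OF q that] by (simp add: P_def)
    have e3: "q ^ Suc i * q ^ (N - Suc i) = Q"
      unfolding power_add[symmetric] Q_def using that by (simp only: le_add_diff_inverse)
    define X where "X = 4 * (- 1) ^ Suc i * q ^ tri i * Q / (1 - Q) * P / (D * (1 - Q * q ^ Suc i))"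
    have "g (Suc i) = X * (q ^ Suc i * (1 - q ^ (N - Suc i)))"
      unfolding g_def e1 e2 X_def tri_Suc power_add by (simp add: mult_ac)
    moreover have "g i = - (X * (1 - Q * q ^ Suc i))"
      unfolding g_def X_def P_def[symmetric] D_def[symmetric] using d by simp
    ultimately have "g (Suc i) - g i = X * (q ^ Suc i * (1 - q ^ (N - Suc i)) + (1 - Q * q ^ Suc i))"
      by (simp add: distrib_left)
    also have "q ^ Suc i * (1 - q ^ (N - Suc i)) + (1 - Q * q ^ Suc i) = (1 + q ^ Suc i) * (1 - Q)"
      unfolding right_diff_distrib e3 by (simp add: algebra_simps)
    also have "X * ((1 + q ^ Suc i) * (1 - Q)) = h i"
      unfolding X_def h_def e1 P_def[symmetric] using Q1 by simp
    finally show ?thesis .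
  qed
  have tel: "(\<Sum>i<N. h i) = - g 0"
  proof -
    have "(\<Sum>i<N. h i) = (\<Sum>i<N. g (Suc i) - g i)"
      by (intro sum.cong) (use gh in auto)
    also have "\<dots> = g N - g 0"
      by (rule sum_lessThan_telescope)
    finally show ?thesis
      by (simp add: g_def inv_qfact_def)
  qed
  define F where "F m j = pf_weight q j * inv_qfact q m j / qpoch q q (m + j)" for m j
  have diff: "(1 + Q)\<^sup>2 * F N (Suc i) - F n (Suc i) = h i" if "Suc i \<le> N" for i
  proof -
    define P where "P = inv_qfact q N (Suc i)"
    define D where "D = qpoch q q (N + i)"
    have D: "D \<noteq> 0" using pz by (simp add: D_def)
    have d: "1 - Q * q ^ Suc i \<noteq> 0"
      using nz[of "N + i"] by (simp add: Q_def power_add mult_ac)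
    have e1: "qpoch q q (N + Suc i) = D * (1 - Q * q ^ Suc i)" "qpoch q q (n + Suc i) = D"
      by (simp_all add: D_def qpoch_Suc Q_def power_add mult_ac N_def)
    have e2: "inv_qfact q n (Suc i) = P * (1 - q ^ (N - Suc i))"
      using inv_qfact_Suc_right[OF q that] by (simp add: P_def N_def inv_qfact_Suc_Suc)
    have e3: "q ^ Suc i * q ^ (N - Suc i) = Q"
      unfolding power_add[symmetric] Q_def using that by (simp only: le_add_diff_inverse)
    have w: "pf_weight q (Suc i) = 4 * (- 1) ^ Suc i * (q ^ tri i * q ^ Suc i) / (1 + q ^ Suc i)"
      by (simp add: pf_weight_def tri_Suc power_add)
    have op: "1 + q ^ Suc i \<noteq> 0"
      using one_plus_power_nonzero[OF q] .
    define R where "R = q ^ (N - Suc i)"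
    have "(1 + Q)\<^sup>2 * F N (Suc i) - F n (Suc i) =
        pf_weight q (Suc i) * P / (D * (1 - Q * q ^ Suc i)) * ((1 + Q)\<^sup>2 - (1 - R) * (1 - Q * q ^ Suc i))"
      unfolding F_def e1 e2 P_def[symmetric] R_def[symmetric] using D d by (simp add: field_simps)
    also have "\<dots> = 4 * (- 1) ^ Suc i * q ^ tri i * P / (D * (1 - Q * q ^ Suc i)) *
        ((q ^ Suc i * ((1 + Q)\<^sup>2 - (1 - R) * (1 - Q * q ^ Suc i))) / (1 + q ^ Suc i))"
      unfolding w by (simp add: mult_ac)
    also have "q ^ Suc i * ((1 + Q)\<^sup>2 - (1 - R) * (1 - Q * q ^ Suc i)) = Q * (1 + q ^ Suc i) * (1 + q ^ Suc i)"
    proof -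
      have "q ^ Suc i * ((1 + Q)\<^sup>2 - (1 - R) * (1 - Q * q ^ Suc i)) =
          q ^ Suc i * (2 * Q + Q\<^sup>2 + Q * q ^ Suc i) + (q ^ Suc i * R) * (1 - Q * q ^ Suc i)"
        by (simp add: algebra_simps power2_eq_square)
      also have "q ^ Suc i * R = Q"
        unfolding R_def by (rule e3)
      finally show ?thesis
        by (simp add: algebra_simps power2_eq_square)
    qed
    also have "Q * (1 + q ^ Suc i) * (1 + q ^ Suc i) / (1 + q ^ Suc i) = Q * (1 + q ^ Suc i)"
      using op by simp
    finally show ?thesis
      unfolding h_def e1 P_def[symmetric] by (simp add: mult_ac)
  qed
  have zero: "(1 + Q)\<^sup>2 * F N 0 - F n 0 = g 0"
  proof -
    define p where "p = qpoch q q n"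
    have pN: "qpoch q q N = p * (1 - Q)"
      by (simp add: p_def N_def qpoch_Suc Q_def)
    have p: "p \<noteq> 0"
      using pz by (simp add: p_def)
    have "F n 0 = 1 / p\<^sup>2"
      by (simp add: F_def pf_weight_def inv_qfact_def p_def power2_eq_square divide_inverse)
    also have "\<dots> = (1 - Q)\<^sup>2 / (p * (1 - Q))\<^sup>2"
      using Q1 by (simp add: power_mult_distrib)
    finally have "(1 + Q)\<^sup>2 * F N 0 - F n 0 = ((1 + Q)\<^sup>2 - (1 - Q)\<^sup>2) / (p * (1 - Q))\<^sup>2"
      by (simp add: F_def pf_weight_def inv_qfact_def pN diff_divide_distrib)
         (simp add: power2_eq_square divide_inverse)
    also have "(1 + Q)\<^sup>2 - (1 - Q)\<^sup>2 = 4 * Q"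
      by (simp add: power2_eq_square algebra_simps)
    also have "4 * Q / (p * (1 - Q))\<^sup>2 = g 0"
      using p Q1 unfolding g_def
      by (simp add: inv_qfact_def pN N_def[symmetric] p_def[symmetric] power2_eq_square divide_inverse)
         (simp add: N_def p_def)
    finally show ?thesis .
  qed
  have sN: "(\<Sum>j\<le>N. F m j) = F m 0 + (\<Sum>i<N. F m (Suc i))" for m
    by (subst lessThan_Suc_atMost[symmetric], subst sum.lessThan_Suc_shift) simp
  have "(1 + Q)\<^sup>2 * (\<Sum>j\<le>N. F N j) - (\<Sum>j\<le>N. F n j) =
      ((1 + Q)\<^sup>2 * F N 0 - F n 0) + (\<Sum>i<N. (1 + Q)\<^sup>2 * F N (Suc i) - F n (Suc i))"
    unfolding sN by (simp add: algebra_simps sum_subtractf sum_distrib_left)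
  also have "(\<Sum>i<N. (1 + Q)\<^sup>2 * F N (Suc i) - F n (Suc i)) = (\<Sum>i<N. h i)"
    by (intro sum.cong) (use diff in auto)
  finally have "(1 + Q)\<^sup>2 * (\<Sum>j\<le>N. F N j) = (\<Sum>j\<le>N. F n j)"
    unfolding tel zero by simp
  also have "(\<Sum>j\<le>N. F n j) = 1 / (qpoch (- q) q n)\<^sup>2"
    using Suc.IH by (simp add: N_def F_def inv_qfact_def)
  finally have "(\<Sum>j\<le>N. F N j) = 1 / (qpoch (- q) q n)\<^sup>2 / (1 + Q)\<^sup>2"
    using one_plus_power_nonzero[OF q, of N]
    by (subst nonzero_eq_divide_eq) (simp_all add: Q_def mult.commute)
  then show ?case
    by (simp add: F_def N_def Q_def qpoch_Suc power_mult_distrib)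
qed

definition pf_term :: "complex \<Rightarrow> nat \<Rightarrow> nat \<Rightarrow> complex" where
  "pf_term q j n = qpoch q (q\<^sup>2) n * inv_qfact q n j / qpoch q q (n + j)"

text \<open>Euler's theorem on odd and distinct parts, obtained after multiplying by
  (q^2;q^2)_inf.\<close>

lemma qpoch_odd_even_eq_1:
  assumes q: "norm q < 1"
  shows "qpoch_inf q (q\<^sup>2) * qpoch_inf (- q) q = 1"
proof -
  have "qpoch_inf q (q\<^sup>2) * qpoch_inf (- q) q * qpoch_inf (q\<^sup>2) (q\<^sup>2) =
      (qpoch_inf q (q\<^sup>2) * qpoch_inf (q * q) (q\<^sup>2)) * qpoch_inf (- q) q"
    by (simp add: power2_eq_square)
  also have "\<dots> = qpoch_inf (q\<^sup>2) (q\<^sup>2)"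
    unfolding qpoch_inf_base_square[OF q, symmetric] by (rule qpoch_inf_mult_neg[OF q])
  finally show ?thesis
    using qpoch_inf_nonzero'[OF norm_square_lt_1[OF q] norm_square_lt_1[OF q]] by simp
qed

text \<open>The terms start at n = j. Shifted by j they form an even q-Gauss series with A = c =
  q^(2j+1), hence with argument exactly -1, which is why the Abel form is required. The value
  depends on j only through a sign.\<close>

lemma pf_term_sums:
  assumes q: "norm q < 1" "q \<noteq> 0"
  shows "(\<lambda>n. (- 1) ^ n * bdiff (pf_term q j) n) sums ((- 1) ^ j / (qpoch_inf q q * (qpoch_inf (- q) q)\<^sup>2))"
proof -
  define c where "c = q ^ (2 * j + 1)"
  have c: "norm c < 1"
    unfolding c_def norm_power using power_less_one_iff[of "norm q" "2 * j + 1"] q(1) by simp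
  have c0: "c \<noteq> 0"
    using q by (simp add: c_def)
  define C where "C = qpoch q (q\<^sup>2) j / qpoch q q (2 * j)"
  have pt: "pf_term q j (m + j) = C * gauss_coeff q c c m" for m
  proof -
    have "qpoch q (q\<^sup>2) (m + j) = qpoch q (q\<^sup>2) j * qpoch c (q\<^sup>2) m"
      using qpoch_add[of q "q\<^sup>2" j m] by (simp add: c_def add.commute power_mult)
    moreover have "qpoch q q (m + j + j) = qpoch q q (2 * j) * qpoch c q m"
      using qpoch_add[of q q "2 * j" m] by (simp add: c_def mult_2 add_ac)
    ultimately show ?thesis
      by (simp add: pf_term_def C_def inv_qfact_def gauss_coeff_def divide_inverse mult_ac)
  qed
  have z: "pf_term q j n = 0" if "n < j" for n
    using that by (simp add: pf_term_def inv_qfact_def)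
  have b0: "bdiff (pf_term q j) n = 0" if "n < j" for n
    using that z by (simp add: bdiff_def)
  have b1: "bdiff (pf_term q j) (m + j) = C * bdiff (gauss_coeff q c c) m" for m
  proof (cases m)
    case 0
    then show ?thesis
      using z pt[of 0] by (cases j) (simp_all)
  next
    case (Suc k)
    then show ?thesis
      using pt[of k] pt[of "Suc k"] by (simp add: algebra_simps)
  qed
  have "(\<lambda>m. (- 1) ^ j * C * ((- c / c) ^ m * bdiff (gauss_coeff q c c) m)) sums
      ((- 1) ^ j * C * (qpoch_inf (c\<^sup>2 / c) (q\<^sup>2) / (qpoch_inf c q * qpoch_inf (- c * q / c) q)))"
    by (intro sums_mult even_q_gauss_abel) (use q c c0 in auto)
  then have "(\<lambda>m. (- 1) ^ (m + j) * bdiff (pf_term q j) (m + j)) sums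
      ((- 1) ^ j * C * (qpoch_inf c (q\<^sup>2) / (qpoch_inf c q * qpoch_inf (- q) q)))"
    using c0 by (simp add: b1 power_add mult_ac power2_eq_square)
  then have "(\<lambda>n. (- 1) ^ n * bdiff (pf_term q j) n) sums
      ((- 1) ^ j * C * (qpoch_inf c (q\<^sup>2) / (qpoch_inf c q * qpoch_inf (- q) q)))"
    by (subst (asm) sums_zero_iff_shift) (use b0 in auto)
  also have "(- 1) ^ j * C * (qpoch_inf c (q\<^sup>2) / (qpoch_inf c q * qpoch_inf (- q) q)) =
      (- 1) ^ j * (qpoch_inf q (q\<^sup>2) / (qpoch_inf q q * qpoch_inf (- q) q))"
  proof -
    have "qpoch_inf q (q\<^sup>2) = qpoch q (q\<^sup>2) j * qpoch_inf c (q\<^sup>2)"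
      using qpoch_inf_split[OF norm_square_lt_1[OF q(1)], of q j] by (simp add: c_def power_mult)
    moreover have "qpoch_inf q q = qpoch q q (2 * j) * qpoch_inf c q"
      using qpoch_inf_split[OF q(1), of q "2 * j"] by (simp add: c_def)
    ultimately show ?thesis
      by (simp add: C_def mult.assoc)
  qed
  also have "qpoch_inf q (q\<^sup>2) / (qpoch_inf q q * qpoch_inf (- q) q) = 1 / (qpoch_inf q q * (qpoch_inf (- q) q)\<^sup>2)"
  proof -
    have "qpoch_inf q (q\<^sup>2) = 1 / qpoch_inf (- q) q"
      using qpoch_odd_even_eq_1[OF q(1)] qpoch_inf_nonzero'[of q "- q"] q
      by (simp add: field_simps)
    then show ?thesis
      by (simp add: power2_eq_square)
  qed
  finally show ?thesis
    by simp
qed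

lemma suminf_swap:
  fixes f :: "nat \<Rightarrow> nat \<Rightarrow> complex"
  assumes "(\<lambda>(n, j). f n j) summable_on UNIV \<times> UNIV"
  shows "(\<lambda>n. \<Sum>j. f n j) sums (\<Sum>j. \<Sum>n. f n j)"
proof -
  have sw: "(\<lambda>(j, n). f n j) summable_on UNIV \<times> UNIV"
    using assms summable_on_swap[of "\<lambda>(n, j). f n j" UNIV UNIV] by simp
  have "f n summable_on UNIV" for n
    using summable_on_SigmaD1[of f UNIV "\<lambda>_. UNIV" n] assms by simp
  then have 1: "infsum (f n) UNIV = (\<Sum>j. f n j)" for n
    by (rule has_sum_nat_suminf(1))
  have "(\<lambda>n. f n j) summable_on UNIV" for j
    using summable_on_SigmaD1[of "\<lambda>j n. f n j" UNIV "\<lambda>_. UNIV" j] sw by simp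
  then have 2: "infsum (\<lambda>n. f n j) UNIV = (\<Sum>n. f n j)" for j
    by (rule has_sum_nat_suminf(1))
  have s1: "(\<lambda>n. infsum (f n) UNIV) summable_on UNIV"
    using summable_on_Sigma_banach[of f UNIV "\<lambda>_. UNIV"] assms by simp
  have s2: "(\<lambda>j. infsum (\<lambda>n. f n j) UNIV) summable_on UNIV"
    using summable_on_Sigma_banach[of "\<lambda>j n. f n j" UNIV "\<lambda>_. UNIV"] sw by simp
  have "infsum (\<lambda>n. infsum (f n) UNIV) UNIV = infsum (\<lambda>j. infsum (\<lambda>n. f n j) UNIV) UNIV"
    using infsum_swap_banach[OF assms] by simp
  then have "(\<Sum>n. \<Sum>j. f n j) = (\<Sum>j. \<Sum>n. f n j)"
    using has_sum_nat_suminf(1)[OF s1] has_sum_nat_suminf(1)[OF s2] by (simp add: 1 2)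
  moreover have "summable (\<lambda>n. \<Sum>j. f n j)"
    using has_sum_nat_suminf(2)[OF s1] by (simp add: 1)
  ultimately show ?thesis
    by (simp add: sums_iff)
qed

lemma one_minus_power_lower:
  fixes q :: complex
  assumes "norm q < 1" "n > 0"
  shows "1 - norm q \<le> norm (1 - q ^ n)"
proof -
  have "norm q ^ n \<le> norm q"
    using assms power_decreasing[of 1 n "norm q"] by simp
  then have "1 - norm q \<le> 1 - norm (q ^ n)"
    unfolding norm_power by linarith
  moreover have "1 - norm (q ^ n) \<le> norm (1 - q ^ n)"
    using norm_triangle_ineq2[of 1 "q ^ n"] by simp
  ultimately show ?thesis
    by linarith
qed

text \<open>\<open>pf_term q j n\<close> itself has a nonzero limit in n; only its differences
  decay, geometrically in n - j and uniformly in j. This permits exchanging the sums over n and j in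
  \<open>S4_alternating\<close>.\<close>

lemma pf_term_diff_bound:
  assumes q: "norm q < 1"
  obtains K where "K > 0" "\<And>n j. j \<le> n \<Longrightarrow> norm (bdiff (pf_term q j) n) \<le> K * norm q ^ (n - j)"
proof -
  obtain K1 where K1: "K1 > 0" "\<And>n. norm (qpoch q (q\<^sup>2) n) \<le> K1"
    using qpoch_bounded[OF norm_square_lt_1[OF q]] by metis
  obtain K2 where K2: "K2 > 0" "\<And>n. norm (inverse (qpoch q q n)) \<le> K2"
    using inverse_qpoch_bounded[OF q, of q] mult_power_neq_1[OF q q] by metis
  define r where "r = norm q"
  define K where "K = K1 * K2 * K2"
  have K0: "K > 0"
    using K1 K2 by (simp add: K_def)
  have r: "0 \<le> r" "r < 1"
    using q by (simp_all add: r_def)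
  have pt: "norm (pf_term q j n) \<le> K" for j n
  proof -
    have "norm (inv_qfact q n j) \<le> K2"
      using K2 by (simp add: inv_qfact_def)
    then show ?thesis
      unfolding pf_term_def K_def divide_inverse norm_mult
      using K1 K2 by (intro mult_mono) auto
  qed
  have pd: "norm (pf_term q j (Suc n) - pf_term q j n) \<le> 4 * K / (1 - r)\<^sup>2 * r ^ (Suc n - j)" if "j \<le> n" for j n
  proof -
    define a where "a = q ^ (Suc n - j)"
    define b where "b = q ^ (Suc n + j)"
    have a1: "1 - r \<le> norm (1 - a)" and b1: "1 - r \<le> norm (1 - b)"
      using that one_minus_power_lower[OF q] by (auto simp: a_def b_def r_def simp del: power_Suc)
    then have ab: "1 - a \<noteq> 0" "1 - b \<noteq> 0"
      using r by auto
    have "inv_qfact q (Suc n) j * (1 - a) = inv_qfact q n j"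
      using inv_qfact_Suc_right[OF q, of j "Suc n"] that by (simp add: a_def inv_qfact_Suc_Suc)
    then have i1: "inv_qfact q (Suc n) j = inv_qfact q n j / (1 - a)"
      using ab by (simp add: field_simps)
    have "pf_term q j (Suc n) = pf_term q j n * ((1 - q ^ (2 * n + 1)) / ((1 - a) * (1 - b)))"
      unfolding pf_term_def i1
      by (simp add: qpoch_Suc b_def power_mult[symmetric] mult_ac)
    then have "pf_term q j (Suc n) - pf_term q j n =
        pf_term q j n * ((1 - q ^ (2 * n + 1)) / ((1 - a) * (1 - b)) - 1)"
      by (simp add: algebra_simps)
    also have "(1 - q ^ (2 * n + 1)) / ((1 - a) * (1 - b)) - 1 =
        (a + b - a * b - q ^ (2 * n + 1)) / ((1 - a) * (1 - b))"
      using ab by (simp add: divide_simps) (simp add: algebra_simps)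
    finally have "norm (pf_term q j (Suc n) - pf_term q j n) =
        norm (pf_term q j n) * (norm (a + b - a * b - q ^ (2 * n + 1)) / (norm (1 - a) * norm (1 - b)))"
      by (simp add: norm_mult norm_divide)
    also have "\<dots> \<le> K * (4 * r ^ (Suc n - j) / ((1 - r) * (1 - r)))"
    proof (intro mult_mono frac_le pt)
      have "norm a \<le> r ^ (Suc n - j)"
        by (simp add: a_def r_def norm_power)
      moreover have "norm b \<le> r ^ (Suc n - j)"
        unfolding b_def norm_power r_def[symmetric] by (rule power_decreasing) (use r in auto)
      moreover have "norm (a * b) \<le> r ^ (Suc n - j)"
        unfolding a_def b_def power_add[symmetric] norm_power r_def[symmetric]
        by (rule power_decreasing) (use r in auto)
      moreover have "norm (q ^ (2 * n + 1)) \<le> r ^ (Suc n - j)"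
        unfolding norm_power r_def[symmetric] by (rule power_decreasing) (use r in auto)
      ultimately show "norm (a + b - a * b - q ^ (2 * n + 1)) \<le> 4 * r ^ (Suc n - j)"
        by norm
    qed (use r a1 b1 K0 in auto)
    finally show ?thesis
      by (simp add: power2_eq_square mult_ac)
  qed
  define L where "L = K + 4 * K / (1 - r)\<^sup>2"
  have L: "L > 0" "K \<le> L" "4 * K / (1 - r)\<^sup>2 \<le> L"
    using K0 r by (auto simp: L_def intro!: add_pos_nonneg)
  have "norm (bdiff (pf_term q j) n) \<le> L * r ^ (n - j)" if jn: "j \<le> n" for n j
  proof (cases "n = j")
    case True
    have "bdiff (pf_term q j) j = pf_term q j j"
      by (cases j) (simp_all add: pf_term_def inv_qfact_def)
    then show ?thesis
      using pt[of j j] L True by simp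
  next
    case False
    then obtain m where m: "n = Suc m" "j \<le> m"
      using jn by (cases n) auto
    have "norm (bdiff (pf_term q j) n) \<le> 4 * K / (1 - r)\<^sup>2 * r ^ (Suc m - j)"
      using pd[OF m(2)] m(1) by simp
    also have "\<dots> \<le> L * r ^ (Suc m - j)"
      using L r by (intro mult_right_mono) auto
    finally show ?thesis
      by (simp add: m)
  qed
  then show ?thesis
    using that L(1) by (simp add: r_def)
qed

lemma pf_weight_bound:
  assumes q: "norm q < 1"
  shows "norm (pf_weight q j) \<le> 4 / (1 - norm q) * norm q ^ tri j"
proof (cases "j = 0")
  case True
  have "norm q \<ge> 0" by simp
  then have "1 - norm q \<le> 4"
    by linarith
  then show ?thesis
    using True q by (simp add: pf_weight_def field_simps)
next
  case False
  then have "norm (pf_weight q j) = 4 * norm q ^ tri j / norm (1 + q ^ j)"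
    by (simp add: pf_weight_def norm_mult norm_divide norm_power)
  also have "\<dots> \<le> 4 * norm q ^ tri j / (1 - norm q)"
    using one_plus_power_lower[OF q, of j] q by (intro divide_left_mono) (auto intro!: mult_pos_pos)
  finally show ?thesis
    by simp
qed

lemma S4_coeff_sum:
  assumes q: "norm q < 1" "q \<noteq> 0"
  shows "(\<Sum>\<^sub>\<infinity>n::int. 2 * q powi (n * (n + 1) div 2) / (1 + q powi n)\<^sup>2) =
      1 / 2 * (\<Sum>j. (- 1) ^ j * pf_weight q j)"
    and "summable (\<lambda>j. (- 1) ^ j * pf_weight q j)"
proof -
  define f where "f n = 2 * q powi (n * (n + 1) div 2) / (1 + q powi n)\<^sup>2" for n :: int
  define r where "r = norm q"
  have r: "0 \<le> r" "r < 1"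
    using q by (simp_all add: r_def)
  have tr: "int n * (int n + 1) div 2 = int (tri n)" for n
    by (simp add: tri_def zdiv_int algebra_simps)
  have tr': "- int (Suc n) * (- int (Suc n) + 1) div 2 = int (tri n)" for n
    by (simp add: tri_def zdiv_int algebra_simps)
  have f1: "f (int n) = 2 * q ^ tri n / (1 + q ^ n)\<^sup>2" for n
    unfolding f_def tr by simp
  have f2: "f (- int (Suc n)) = 2 * q ^ tri n * (q ^ Suc n)\<^sup>2 / (1 + q ^ Suc n)\<^sup>2" for n
  proof -
    have "1 + q powi (- int (Suc n)) = (1 + q ^ Suc n) / q ^ Suc n"
      using q(2) unfolding power_int_minus power_int_of_nat by (simp add: field_simps)
    then show ?thesis
      unfolding f_def tr' by (simp add: power_divide)
  qed
  \<comment> \<open>The terms for Q and 1/Q have numerators proportional to Q and Q^2 over (1 +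
    Q)^2; their sum loses one factor 1 + Q and becomes a partial fraction weight.\<close>
  have f3: "f (int (Suc n)) + f (- int (Suc n)) = 1 / 2 * ((- 1) ^ Suc n * pf_weight q (Suc n))" for n
  proof -
    define Q where "Q = q ^ Suc n"
    have Q: "1 + Q \<noteq> 0"
      unfolding Q_def by (rule one_plus_power_nonzero[OF q(1)])
    have "f (int (Suc n)) + f (- int (Suc n)) = 2 * q ^ tri n * (Q * (1 + Q)) / (1 + Q)\<^sup>2"
      unfolding f1 f2 Q_def[symmetric] tri_Suc power_add
      by (simp add: add_divide_distrib[symmetric] algebra_simps power2_eq_square)
    also have "\<dots> = 2 * q ^ tri n * Q / (1 + Q)"
      using Q by (simp add: power2_eq_square)
    also have "\<dots> = 1 / 2 * ((- 1) ^ Suc n * pf_weight q (Suc n))"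
    proof -
      have "((- 1) ^ Suc n * (- 1) ^ Suc n :: complex) = 1"
        by (simp flip: power_mult_distrib)
      then show ?thesis
        unfolding pf_weight_def tri_Suc power_add Q_def[symmetric]
        by (simp add: mult.assoc[symmetric] del: power_Suc)
    qed
    finally show ?thesis .
  qed
  have gs: "summable (\<lambda>n. C * r ^ n)" for C
    using r by (intro summable_mult summable_geometric) auto
  have lower: "(1 - r)\<^sup>2 \<le> (norm (1 + q ^ n))\<^sup>2" for n
    using one_plus_power_lower[OF q(1), of n] r by (intro power_mono) (auto simp: r_def)
  have tri_r: "r ^ tri n \<le> r ^ n" for n
    using r tri_ge[of n] by (intro power_decreasing) auto
  have b1: "norm (f (int n)) \<le> 2 / (1 - r)\<^sup>2 * r ^ n" for n
  proof -
    have "norm (f (int n)) = 2 * r ^ tri n / (norm (1 + q ^ n))\<^sup>2"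
      unfolding f1 by (simp add: norm_divide norm_mult norm_power r_def)
    also have "\<dots> \<le> 2 * r ^ n / (1 - r)\<^sup>2"
      using r tri_r[of n] lower[of n] by (intro frac_le) auto
    finally show ?thesis by simp
  qed
  have b2: "norm (f (- int n)) \<le> 2 / (1 - r)\<^sup>2 * r ^ n" for n
  proof (cases n)
    case 0
    then show ?thesis
      using b1[of 0] by simp
  next
    case (Suc m)
    have "norm (f (- int (Suc m))) = 2 * (r ^ tri m * (r ^ Suc m * r ^ Suc m)) / (norm (1 + q ^ Suc m))\<^sup>2"
      unfolding f2 by (simp add: norm_divide norm_mult norm_power r_def power2_eq_square)
    also have "\<dots> \<le> 2 * r ^ Suc m / (1 - r)\<^sup>2"
    proof (intro frac_le mult_left_mono lower)
      have "r ^ tri m * (r ^ Suc m * r ^ Suc m) = r ^ (tri m + (Suc m + Suc m))"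
        by (simp only: power_add)
      also have "\<dots> \<le> r ^ Suc m"
        using r by (intro power_decreasing) auto
      finally show "r ^ tri m * (r ^ Suc m * r ^ Suc m) \<le> r ^ Suc m" .
    qed (use r in auto)
    finally show ?thesis
      by (simp add: Suc)
  qed
  have "(\<lambda>n. norm (f n)) summable_on UNIV"
    by (rule summable_on_int_halves)
       (use b1 b2 in \<open>auto intro!: summable_comparison_test'[OF gs[of "2 / (1 - r)\<^sup>2"], of 0]\<close>)
  then have sf: "f summable_on UNIV"
    by (rule abs_summable_summable)
  note sp = has_sum_int_split[OF sf]
  have s1: "summable (\<lambda>n. f (int (Suc n)))"
    using sp(1) by (subst summable_Suc_iff)
  have "summable (\<lambda>n. 1 / 2 * ((- 1) ^ Suc n * pf_weight q (Suc n)))"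
    using summable_add[OF s1 sp(2)] unfolding f3 .
  then have "summable (\<lambda>n. 2 * (1 / 2 * ((- 1) ^ Suc n * pf_weight q (Suc n))))"
    by (rule summable_mult)
  then have sw: "summable (\<lambda>n. (- 1) ^ Suc n * pf_weight q (Suc n))"
    by simp
  then show sw': "summable (\<lambda>j. (- 1) ^ j * pf_weight q j)"
    using summable_Suc_iff[of "\<lambda>j. (- 1) ^ j * pf_weight q j"] by simp
  have "infsum f UNIV = f 0 + ((\<Sum>n. f (int (Suc n))) + (\<Sum>n. f (- int (Suc n))))"
    unfolding sp(3) using suminf_split_head[OF sp(1)] by simp
  also have "(\<Sum>n. f (int (Suc n))) + (\<Sum>n. f (- int (Suc n))) =
      (\<Sum>n. 1 / 2 * ((- 1) ^ Suc n * pf_weight q (Suc n)))"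
    unfolding suminf_add[OF s1 sp(2)] f3 ..
  also have "\<dots> = 1 / 2 * (\<Sum>n. (- 1) ^ Suc n * pf_weight q (Suc n))"
    by (rule suminf_mult[OF sw])
  also have "(\<Sum>n. (- 1) ^ Suc n * pf_weight q (Suc n)) = (\<Sum>j. (- 1) ^ j * pf_weight q j) - 1"
    using suminf_split_head[OF sw'] by (simp add: pf_weight_def)
  also have "f 0 = 1 / 2"
    using f1[of 0] by simp
  finally show "(\<Sum>\<^sub>\<infinity>n::int. 2 * q powi (n * (n + 1) div 2) / (1 + q powi n)\<^sup>2) =
      1 / 2 * (\<Sum>j. (- 1) ^ j * pf_weight q j)"
    unfolding f_def[symmetric] by (simp add: algebra_simps)
qed

lemma Jbar_0_1:
  assumes q: "norm q < 1"
  shows "Jbar 0 1 q = 2 * (qpoch_inf (- q) q)\<^sup>2 * qpoch_inf q q"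
  using qpoch_inf_rec[OF q, of "- 1"] by (simp add: Jbar_def theta_def power2_eq_square)

text \<open>Insert the partial fractions, exchange the sums and apply \<open>pf_term_sums\<close>:
  every j contributes the same constant up to the sign (-1)^j, so the weights reassemble to the
  series of S_4. Without the differences the inner series over n would diverge.\<close>

lemma S4_alternating:
  assumes q: "norm q < 1" "q \<noteq> 0"
  shows "(\<lambda>n. (- 1) ^ n * bdiff (\<lambda>n. qpoch q (q\<^sup>2) n / (qpoch (- q) q n)\<^sup>2) n) sums (4 * S4_one q)"
proof -
  define b where "b n = qpoch q (q\<^sup>2) n / (qpoch (- q) q n)\<^sup>2" for n
  define c where "c = 1 / (qpoch_inf q q * (qpoch_inf (- q) q)\<^sup>2)"
  define f where "f n j = (- 1) ^ n * (pf_weight q j * bdiff (pf_term q j) n)" for n j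
  define r where "r = norm q"
  \<comment> \<open>Passing to the square root leaves room to bound r^(tri j + n - j) by the product
    s^n s^j, as the absolute double sum requires.\<close>
  define s where "s = sqrt r"
  have r: "0 \<le> r" "r < 1"
    using q by (simp_all add: r_def)
  have s: "0 \<le> s" "s < 1" "s\<^sup>2 = r"
    using r by (auto simp: s_def)
  have z: "bdiff (pf_term q j) n = 0" if "n < j" for n j
    using that by (cases n) (simp_all add: pf_term_def inv_qfact_def)
  have bn: "b n = (\<Sum>j\<le>n. pf_weight q j * pf_term q j n)" for n
  proof -
    have "b n = qpoch q (q\<^sup>2) n * (\<Sum>j\<le>n. pf_weight q j * inv_qfact q n j / qpoch q q (n + j))"
      unfolding partial_fraction[OF q(1)] by (simp add: b_def)
    then show ?thesis
      by (simp add: sum_distrib_left pf_term_def mult_ac)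
  qed
  have bd: "bdiff b n = (\<Sum>j\<le>n. pf_weight q j * bdiff (pf_term q j) n)" for n
  proof (cases n)
    case (Suc m)
    have "b m = (\<Sum>j\<le>Suc m. pf_weight q j * pf_term q j m)"
      unfolding bn by (simp add: pf_term_def inv_qfact_def)
    then show ?thesis
      unfolding Suc bdiff_simps bn[of "Suc m"] by (simp only: sum_subtractf[symmetric] right_diff_distrib)
  qed (simp add: bn)
  have "(\<lambda>j. f n j) sums (\<Sum>j\<le>n. f n j)" for n
    by (rule sums_finite) (auto simp: f_def z)
  then have inner1: "(\<Sum>j. f n j) = (- 1) ^ n * bdiff b n" for n
    by (simp add: sums_iff bd f_def sum_distrib_left)
  have "(\<lambda>n. f n j) sums (pf_weight q j * ((- 1) ^ j * c))" for j
    using sums_mult[OF pf_term_sums[OF q, of j], of "pf_weight q j"] by (simp add: f_def c_def mult_ac)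
  then have inner2: "(\<Sum>n. f n j) = c * ((- 1) ^ j * pf_weight q j)" for j
    by (simp add: sums_iff mult_ac)
  obtain K where K: "K > 0" "\<And>n j. j \<le> n \<Longrightarrow> norm (bdiff (pf_term q j) n) \<le> K * r ^ (n - j)"
    using pf_term_diff_bound[OF q(1)] unfolding r_def by metis
  define C where "C = 4 / (1 - r) * K"
  have C: "C > 0"
    using K r by (simp add: C_def)
  have sg: "(\<lambda>n. s ^ n) summable_on UNIV"
    using s by (intro summable_nonneg_imp_summable_on summable_geometric) auto
  have fb: "norm (f n j) \<le> (C * s ^ n) * s ^ j" for n j
  proof (cases "n < j")
    case False
    have "norm (f n j) = norm (pf_weight q j) * norm (bdiff (pf_term q j) n)"
      by (simp add: f_def norm_mult norm_power)
    also have "\<dots> \<le> (4 / (1 - r) * r ^ tri j) * (K * r ^ (n - j))"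
      using pf_weight_bound[OF q(1), of j] K False r by (intro mult_mono) (auto simp: r_def)
    also have "\<dots> = C * r ^ (tri j + (n - j))"
      by (simp add: C_def power_add)
    also have "r ^ (tri j + (n - j)) = s ^ (2 * (tri j + (n - j)))"
      by (simp only: power_mult s(3))
    also have "\<dots> \<le> s ^ (n + j)"
    proof (rule power_decreasing)
      have "j \<le> j * j" by simp
      then show "n + j \<le> 2 * (tri j + (n - j))"
        using False unfolding distrib_left two_tri by linarith
    qed (use s in auto)
    finally show ?thesis
      using C by (simp add: power_add mult_left_mono)
  qed (use C s in \<open>simp add: f_def z\<close>)
  have "(\<lambda>(n, j). f n j) summable_on UNIV \<times> UNIV"
    by (rule summable_on_product_bound[of "\<lambda>n. C * s ^ n" UNIV "\<lambda>j. s ^ j"])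
       (use sg C s fb in \<open>auto intro: summable_on_cmult_right\<close>)
  from suminf_swap[OF this]
  have "(\<lambda>n. (- 1) ^ n * bdiff b n) sums (\<Sum>j. c * ((- 1) ^ j * pf_weight q j))"
    unfolding inner1 inner2 .
  also have "(\<Sum>j. c * ((- 1) ^ j * pf_weight q j)) = c * (\<Sum>j. (- 1) ^ j * pf_weight q j)"
    by (rule suminf_mult[OF S4_coeff_sum(2)[OF q]])
  also have "\<dots> = 4 * S4_one q"
    unfolding S4_one_def S4_coeff_sum(1)[OF q] Jbar_0_1[OF q(1)] c_def by simp
  finally show ?thesis
    unfolding b_def .
qed

subsection \<open>The bilateral series of \<open>(q;q\<^sup>2)\<^sub>n\<close>\<close>

lemma power_int_eq_1_iff_norm_lt_1:
  fixes q :: complex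
  assumes "norm q < 1" "q \<noteq> 0"
  shows "q powi m = 1 \<longleftrightarrow> m = 0"
proof
  assume *: "q powi m = 1"
  show "m = 0"
  proof (rule ccontr)
    assume "m \<noteq> 0"
    have 1: "q ^ nat \<bar>m\<bar> = 1"
      using * by (cases "m \<ge> 0") (auto simp: power_int_def power_inverse inverse_eq_1_iff)
    have "norm q ^ nat \<bar>m\<bar> = 1"
      by (metis 1 norm_one norm_power)
    moreover have "norm q ^ nat \<bar>m\<bar> < 1"
      using assms \<open>m \<noteq> 0\<close> power_less_one_iff[of "norm q" "nat \<bar>m\<bar>"] by simp
    ultimately show False
      by simp
  qed
qed simp

text \<open>\<open>odd_qpoch q n\<close> is \<open>(q;q\<^sup>2)\<^sub>n\<close>, extended to all integers \<open>n\<close>.\<close>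

definition odd_qpoch :: "complex \<Rightarrow> int \<Rightarrow> complex" where
  "odd_qpoch q n = qpoch_inf q (q\<^sup>2) / qpoch_inf (q powi (2 * n + 1)) (q\<^sup>2)"

text \<open>All exponents 2n + 1 + 2i are odd, so no factor vanishes even for negative n.\<close>

lemma odd_qpoch_denom_nonzero:
  assumes q: "norm q < 1" "q \<noteq> 0"
  shows "qpoch_inf (q powi (2 * n + 1)) (q\<^sup>2) \<noteq> 0"
proof (rule qpoch_inf_nonzero[OF norm_square_lt_1[OF q(1)]])
  fix i
  have "(q\<^sup>2) ^ i = q powi (2 * int i)"
    using power_int_of_nat[of q "2 * i"] by (simp add: power_mult)
  then have "q powi (2 * n + 1) * (q\<^sup>2) ^ i = q powi (2 * n + 1 + 2 * int i)"
    using q(2) power_int_add[of q "2 * n + 1" "2 * int i"] by simp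
  then show "q powi (2 * n + 1) * (q\<^sup>2) ^ i \<noteq> 1"
    using power_int_eq_1_iff_norm_lt_1[OF q, of "2 * n + 1 + 2 * int i"] by presburger
qed

lemma odd_qpoch_rec:
  assumes q: "norm q < 1" "q \<noteq> 0"
  shows "odd_qpoch q (n + 1) = odd_qpoch q n * (1 - q powi (2 * n + 1))"
proof -
  have "q powi (2 * (n + 1) + 1) = q powi (2 * n + 1) * q\<^sup>2"
    using q(2) power_int_add[of q "2 * n + 1" 2] by (simp add: algebra_simps)
  then have "qpoch_inf (q powi (2 * n + 1)) (q\<^sup>2) =
      (1 - q powi (2 * n + 1)) * qpoch_inf (q powi (2 * (n + 1) + 1)) (q\<^sup>2)"
    by (subst qpoch_inf_rec[OF norm_square_lt_1[OF q(1)]]) simp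
  then show ?thesis
    unfolding odd_qpoch_def
    using odd_qpoch_denom_nonzero[OF q, of n] odd_qpoch_denom_nonzero[OF q, of "n + 1"]
    by (simp add: divide_simps)
qed

lemma odd_qpoch_0 [simp]:
  assumes q: "norm q < 1" "q \<noteq> 0"
  shows "odd_qpoch q 0 = 1"
  using odd_qpoch_denom_nonzero[OF q, of 0] by (simp add: odd_qpoch_def)

lemma odd_qpoch_of_nat:
  assumes q: "norm q < 1" "q \<noteq> 0"
  shows "odd_qpoch q (int n) = qpoch q (q\<^sup>2) n"
proof (induction n)
  case (Suc n)
  have "odd_qpoch q (int (Suc n)) = odd_qpoch q (int n) * (1 - q powi (2 * int n + 1))"
    using odd_qpoch_rec[OF q, of "int n"] by (simp add: add.commute)
  also have "q powi (2 * int n + 1) = q * (q\<^sup>2) ^ n"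
    using power_int_of_nat[of q "2 * n + 1"] by (simp add: power_mult add.commute)
  finally show ?case
    by (simp add: Suc.IH qpoch_Suc)
qed (use q in simp)

text \<open>The origin of the dual series: at negative indices the numerator symbol turns into a
  denominator, and the factor q^(m^2) offsets the growth of the squared infinite product in
  \<open>bilat\<close>.\<close>

lemma odd_qpoch_neg:
  assumes q: "norm q < 1" "q \<noteq> 0"
  shows "odd_qpoch q (- int m) = (- 1) ^ m * q ^ (m * m) / qpoch q (q\<^sup>2) m"
proof (induction m)
  case (Suc m)
  define D where "D = 1 - q * (q\<^sup>2) ^ m"
  have D: "D \<noteq> 0"
    using mult_power_neq_1[OF norm_square_lt_1[OF q(1)] q(1), of m] by (simp add: D_def)
  have Q: "q powi (2 * (- int (Suc m)) + 1) = 1 / q ^ (2 * m + 1)"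
  proof -
    have "2 * (- int (Suc m)) + 1 = - int (2 * m + 1)"
      by simp
    then show ?thesis
      by (simp only: power_int_minus power_int_of_nat inverse_eq_divide)
  qed
  have "odd_qpoch q (- int m) = odd_qpoch q (- int (Suc m)) * (1 - 1 / q ^ (2 * m + 1))"
    using odd_qpoch_rec[OF q, of "- int (Suc m)"] unfolding Q by simp
  also have "1 - 1 / q ^ (2 * m + 1) = - D / q ^ (2 * m + 1)"
  proof -
    have "D = 1 - q ^ (2 * m + 1)"
      by (simp add: D_def power_mult)
    then show ?thesis
      using q(2) by (simp add: diff_divide_distrib)
  qed
  finally have "odd_qpoch q (- int (Suc m)) = - odd_qpoch q (- int m) * q ^ (2 * m + 1) / D"
    using D q(2) by (simp add: field_simps)
  also have "\<dots> = (- 1) ^ Suc m * (q ^ (m * m) * q ^ (2 * m + 1)) / (qpoch q (q\<^sup>2) m * D)"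
    unfolding Suc.IH by simp
  also have "q ^ (m * m) * q ^ (2 * m + 1) = q ^ (Suc m * Suc m)"
    unfolding power_add[symmetric] by (rule arg_cong[where f = "\<lambda>n. q ^ n"]) simp
  also have "qpoch q (q\<^sup>2) m * D = qpoch q (q\<^sup>2) (Suc m)"
    by (simp add: D_def qpoch_Suc)
  finally show ?case .
qed (use q in simp)

definition odd_psi :: "complex \<Rightarrow> nat \<Rightarrow> int \<Rightarrow> complex" where
  "odd_psi q s n = (- 1) powi n * odd_qpoch q n * q powi (int s * n)"

text \<open>The product side of \<open>bilateral_q_binomial\<close> in base q^2 with \<alpha> = -q^s
  and \<beta> = -q^(s+1); its last denominator factor is (\<alpha> q^2 / \<beta>;q^2)_inf =
  (q;q^2)_inf.\<close>

definition odd_psi_sum :: "complex \<Rightarrow> nat \<Rightarrow> complex" where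
  "odd_psi_sum q s = qpoch_inf (q\<^sup>2) (q\<^sup>2) * qpoch_inf (- (q ^ Suc s)) (q\<^sup>2) * qpoch_inf (- (q / q ^ s)) (q\<^sup>2) /
      (qpoch_inf (- (q ^ s)) (q\<^sup>2) * qpoch_inf q (q\<^sup>2))"

lemma odd_psi_has_sum:
  assumes q: "norm q < 1" "q \<noteq> 0" and s: "s > 0"
  shows "(odd_psi q s has_sum odd_psi_sum q s) UNIV"
proof -
  define z where "z = - (q ^ s)"
  have z: "norm z < 1" "z \<noteq> 0"
    using q s power_less_one_iff[of "norm q" s] by (simp_all add: z_def norm_power)
  have q2: "q\<^sup>2 \<noteq> 0"
    using q by simp
  define u where "u n = odd_qpoch q n * z powi n" for n
  have u: "u = odd_psi q s"
  proof
    fix n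
    have "z powi n = (- 1) powi n * (q ^ s) powi n"
      unfolding z_def by (simp flip: power_int_mult_distrib)
    also have "(q ^ s) powi n = q powi (int s * n)"
      by (simp add: power_int_mult)
    finally show "u n = odd_psi q s n"
      by (simp add: u_def odd_psi_def)
  qed
  have "u (n + 1) = u n * (z - z * q * (q\<^sup>2) powi n)" for n
  proof -
    have "q powi (2 * n + 1) = q * (q\<^sup>2) powi n"
      using q(2) by (simp add: power_int_add power_int_mult)
    moreover have "z powi (n + 1) = z powi n * z"
      using z(2) by (simp add: power_int_add)
    ultimately show ?thesis
      unfolding u_def odd_qpoch_rec[OF q] by (simp add: algebra_simps)
  qed
  note * = bilateral_q_binomial(2)[OF norm_square_lt_1[OF q(1)] q2 z(1) _ _ this]
  have "(u has_sum (qpoch_inf (q\<^sup>2) (q\<^sup>2) * qpoch_inf (z * q) (q\<^sup>2) * qpoch_inf (q\<^sup>2 / (z * q)) (q\<^sup>2) /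
           (qpoch_inf z (q\<^sup>2) * qpoch_inf (z * q\<^sup>2 / (z * q)) (q\<^sup>2)))) UNIV"
    by (rule *) (use q z in \<open>auto simp: u_def\<close>)
  moreover have "q\<^sup>2 / (z * q) = - (q / q ^ s)" "z * q\<^sup>2 / (z * q) = q" "z * q = - (q ^ Suc s)"
    using q z by (simp_all add: z_def power2_eq_square)
  ultimately show ?thesis
    unfolding u odd_psi_sum_def z_def by (simp add: mult.commute)
qed

text \<open>At s = 0 the bilateral series has only a Cesaro value, half the sum over neighbouring
  pairs. By \<open>odd_psi_0_pair\<close> that sum is q times the sum for s = 2.\<close>

definition odd_psi_mean :: "complex \<Rightarrow> nat \<Rightarrow> complex" where
  "odd_psi_mean q s = (if s = 0 then q * odd_psi_sum q 2 / 2 else odd_psi_sum q s)"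

lemma odd_psi_0_pair:
  assumes q: "norm q < 1" "q \<noteq> 0"
  shows "odd_psi q 0 n + odd_psi q 0 (n - 1) = q * odd_psi q 2 (n - 1)"
proof -
  have 1: "odd_qpoch q n = odd_qpoch q (n - 1) * (1 - q powi (2 * (n - 1) + 1))"
    using odd_qpoch_rec[OF q, of "n - 1"] by simp
  have 2: "(- 1 :: complex) powi n = - ((- 1) powi (n - 1))"
    using power_int_add[of "- 1 :: complex" "n - 1" 1] by simp
  have 3: "q powi (2 * (n - 1) + 1) = q * q powi (2 * (n - 1))"
    using q(2) power_int_add[of q "2 * (n - 1)" 1] by simp
  show ?thesis
    unfolding odd_psi_def 1 2 3 by (simp add: algebra_simps)
qed

text \<open>The averaged series converges for \<open>s = 0\<close> too, where the terms \<open>odd_psi q 0 n\<close> do not tend to \<open>0\<close>.\<close>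

lemma odd_psi_mean_has_sum:
  assumes q: "norm q < 1" "q \<noteq> 0"
  shows "((\<lambda>n. odd_psi q s n + odd_psi q s (n - 1)) has_sum (2 * odd_psi_mean q s)) UNIV"
proof -
  have shift: "((\<lambda>n. odd_psi q s (n - 1)) has_sum odd_psi_sum q s) UNIV" if "s > 0" for s
  proof -
    have "bij_betw (\<lambda>n::int. n - 1) UNIV UNIV"
      by (rule bij_betwI[of _ _ _ "\<lambda>n. n + 1"]) auto
    from has_sum_reindex_bij_betw[OF this, of "odd_psi q s"] odd_psi_has_sum[OF q that] show ?thesis
      by simp
  qed
  show ?thesis
  proof (cases "s = 0")
    case True
    have "odd_psi q 0 n + odd_psi q 0 (n - 1) = q * odd_psi q 2 (n - 1)" for n
      by (rule odd_psi_0_pair[OF q])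
    moreover have "((\<lambda>n. q * odd_psi q 2 (n - 1)) has_sum (q * odd_psi_sum q 2)) UNIV"
      by (intro has_sum_cmult_right shift) simp
    ultimately show ?thesis
      using True by (simp add: odd_psi_mean_def)
  next
    case False
    then show ?thesis
      using has_sum_add[OF odd_psi_has_sum[OF q] shift, of s s] by (simp add: odd_psi_mean_def flip: mult_2)
  qed
qed

lemma qpoch_inf_neg_nonzero:
  assumes q: "norm q < 1" "q \<noteq> 0"
  shows "qpoch_inf (- (q ^ s)) (q\<^sup>2) \<noteq> 0"
proof (rule qpoch_inf_nonzero[OF norm_square_lt_1[OF q(1)]])
  fix i
  have "1 + q ^ (s + 2 * i) \<noteq> 0"
    by (rule one_plus_power_nonzero[OF q(1)])
  define X where "X = - (q ^ s) * (q\<^sup>2) ^ i"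
  have "1 + q ^ (s + 2 * i) = 1 - X"
    by (simp add: X_def power_add power_mult)
  with \<open>1 + q ^ (s + 2 * i) \<noteq> 0\<close> have "X \<noteq> 1"
    by auto
  then show "- (q ^ s) * (q\<^sup>2) ^ i \<noteq> 1"
    by (simp add: X_def)
qed

text \<open>Raising s by 2 shifts the infinite products in base q^2 by one factor each. The Cesaro
  value chosen at s = 0 is the one that fits the same recurrence.\<close>

lemma odd_psi_mean_rec:
  assumes q: "norm q < 1" "q \<noteq> 0"
  shows "odd_psi_mean q (Suc (Suc s)) = odd_psi_mean q s * (1 + q ^ s) / q ^ Suc s"
proof (cases "s = 0")
  case True
  then show ?thesis
    using q by (simp add: odd_psi_mean_def numeral_2_eq_2)
next
  case False
  note rec = qpoch_inf_rec[OF norm_square_lt_1[OF q(1)]]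
  define X where "X = q ^ s"
  have X: "X \<noteq> 0"
    using q by (simp add: X_def)
  have 1: "qpoch_inf (- (q * X)) (q\<^sup>2) = (1 + q * X) * qpoch_inf (- (q * (q * (q * X)))) (q\<^sup>2)"
    by (subst rec) (simp add: power2_eq_square mult_ac)
  have 2: "qpoch_inf (- (q / (q * (q * X)))) (q\<^sup>2) = (1 + q * X) / (q * X) * qpoch_inf (- (q / X)) (q\<^sup>2)"
    using q X by (subst rec) (simp add: power2_eq_square field_simps)
  have 3: "qpoch_inf (- X) (q\<^sup>2) = (1 + X) * qpoch_inf (- (q * (q * X))) (q\<^sup>2)"
    by (subst rec) (simp add: power2_eq_square mult_ac)
  have nz: "qpoch_inf (- X) (q\<^sup>2) \<noteq> 0" "qpoch_inf (- (q * (q * X))) (q\<^sup>2) \<noteq> 0" "1 + X \<noteq> 0" "1 + q * X \<noteq> 0"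
    using qpoch_inf_neg_nonzero[OF q, of s] qpoch_inf_neg_nonzero[OF q, of "Suc (Suc s)"]
      one_plus_power_nonzero[OF q(1), of s] one_plus_power_nonzero[OF q(1), of "Suc s"]
    by (simp_all add: X_def)
  have "odd_psi_sum q (Suc (Suc s)) = qpoch_inf (q\<^sup>2) (q\<^sup>2) * qpoch_inf (- (q * (q * (q * X)))) (q\<^sup>2) *
      ((1 + q * X) / (q * X) * qpoch_inf (- (q / X)) (q\<^sup>2)) / (qpoch_inf (- (q * (q * X))) (q\<^sup>2) * qpoch_inf q (q\<^sup>2))"
    unfolding odd_psi_sum_def power_Suc X_def[symmetric] 2 ..
  moreover have "odd_psi_sum q s = qpoch_inf (q\<^sup>2) (q\<^sup>2) * ((1 + q * X) * qpoch_inf (- (q * (q * (q * X)))) (q\<^sup>2)) *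
      qpoch_inf (- (q / X)) (q\<^sup>2) / ((1 + X) * qpoch_inf (- (q * (q * X))) (q\<^sup>2) * qpoch_inf q (q\<^sup>2))"
    unfolding odd_psi_sum_def power_Suc X_def[symmetric] 1 3 ..
  moreover have "A * B * ((1 + q * X) / (q * X) * C) / (D * E) =
      A * ((1 + q * X) * B) * C / ((1 + X) * D * E) * (1 + X) / (q * X)" for A B C D E
    using nz(3) by (simp add: mult_ac)
  ultimately have "odd_psi_sum q (Suc (Suc s)) = odd_psi_sum q s * (1 + X) / (q * X)"
    by simp
  then show ?thesis
    using False by (simp add: odd_psi_mean_def X_def)
qed

lemma odd_psi_mean_0:
  assumes q: "norm q < 1" "q \<noteq> 0"
  shows "odd_psi_mean q 0 = (qpoch_inf (- q) (q\<^sup>2))\<^sup>2 * qpoch_inf (q\<^sup>2) (q\<^sup>2) /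
      (2 * qpoch_inf (- (q\<^sup>2)) (q\<^sup>2) * qpoch_inf q (q\<^sup>2))"
proof -
  note rec = qpoch_inf_rec[OF norm_square_lt_1[OF q(1)]]
  have 1: "qpoch_inf (- q) (q\<^sup>2) = (1 + q) * qpoch_inf (- (q ^ Suc 2)) (q\<^sup>2)"
    by (subst rec) (simp add: power2_eq_square power3_eq_cube mult_ac)
  have 2: "qpoch_inf (- (q / q\<^sup>2)) (q\<^sup>2) = (1 + q) / q * qpoch_inf (- q) (q\<^sup>2)"
    using q by (subst rec) (simp add: power2_eq_square field_simps)
  have 3: "1 + q \<noteq> 0"
    using one_plus_power_nonzero[OF q(1), of 1] by simp
  have key: "q * (A * B * ((1 + q) / q * C) / (D * E)) / 2 = ((1 + q) * B) * C * A / (2 * D * E)" for A B C D E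
    using q 3 by (simp add: mult_ac)
  show ?thesis
    unfolding odd_psi_mean_def odd_psi_sum_def 2
    by (simp only: key 1[symmetric] power2_eq_square[of "qpoch_inf (- q) (q\<^sup>2)"] if_True refl)
qed

lemma odd_psi_mean_1:
  assumes q: "norm q < 1" "q \<noteq> 0"
  shows "odd_psi_mean q 1 = 2 * (qpoch_inf (- (q\<^sup>2)) (q\<^sup>2))\<^sup>2 * qpoch_inf (q\<^sup>2) (q\<^sup>2) /
      (qpoch_inf (- q) (q\<^sup>2) * qpoch_inf q (q\<^sup>2))"
proof -
  have "qpoch_inf (- 1) (q\<^sup>2) = 2 * qpoch_inf (- (q\<^sup>2)) (q\<^sup>2)"
    by (subst qpoch_inf_rec[OF norm_square_lt_1[OF q(1)]]) simp
  then show ?thesis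
    using q by (simp add: odd_psi_mean_def odd_psi_sum_def power2_eq_square)
qed

text \<open>Reduces all s to the residues a = 0 and a = 1, where the products are known
  explicitly.\<close>

lemma odd_psi_mean_shift:
  assumes q: "norm q < 1" "q \<noteq> 0"
  shows "odd_psi_mean q (2 * t + a) = qpoch (- (q ^ a)) (q\<^sup>2) t * odd_psi_mean q a / q ^ (t * t + a * t)"
proof (induction t)
  case (Suc t)
  have "odd_psi_mean q (2 * Suc t + a) = odd_psi_mean q (2 * t + a) * (1 + q ^ (2 * t + a)) / q ^ Suc (2 * t + a)"
    using odd_psi_mean_rec[OF q, of "2 * t + a"] by simp
  also have "\<dots> = qpoch (- (q ^ a)) (q\<^sup>2) t * (1 + q ^ (2 * t + a)) * odd_psi_mean q a /
      (q ^ (t * t + a * t) * q ^ Suc (2 * t + a))"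
    unfolding Suc.IH by simp
  also have "q ^ (t * t + a * t) * q ^ Suc (2 * t + a) = q ^ (Suc t * Suc t + a * Suc t)"
    unfolding power_add[symmetric] by (rule arg_cong[where f = "\<lambda>n. q ^ n"]) simp
  also have "1 + q ^ (2 * t + a) = 1 - - (q ^ a) * (q\<^sup>2) ^ t"
    by (simp add: power_add power_mult)
  finally show ?case
    by (simp only: qpoch_Suc)
qed simp

subsection \<open>The two-variable expansion\<close>

definition euler_coeff :: "complex \<Rightarrow> nat \<Rightarrow> complex" where
  "euler_coeff q m = q ^ tri m / qpoch q q m"

lemma euler_expansion:
  assumes q: "norm q < 1"
  shows "summable (\<lambda>m. norm (euler_coeff q m * x ^ m))"
    and "(\<lambda>m. euler_coeff q m * x ^ m) sums qpoch_inf (- (q * x)) q"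
proof -
  have "(\<Prod>i<m. 0 - - (q * x) * q ^ i) = q ^ tri m * x ^ m" for m
    by (induction m) (simp_all add: tri_Suc power_add mult_ac)
  then have *: "(\<Prod>i<m. 0 - - (q * x) * q ^ i) / qpoch q q m = euler_coeff q m * x ^ m" for m
    by (simp add: euler_coeff_def)
  show "summable (\<lambda>m. norm (euler_coeff q m * x ^ m))"
    using homogeneous_q_binomial(1)[OF q, of 0 "- (q * x)"] unfolding * by simp
  show "(\<lambda>m. euler_coeff q m * x ^ m) sums qpoch_inf (- (q * x)) q"
    using homogeneous_q_binomial(2)[OF q, of 0 "- (q * x)"] unfolding * by simp
qed

lemma has_sum_square:
  fixes f :: "'a \<Rightarrow> complex"
  assumes n: "(\<lambda>m. norm (f m)) summable_on UNIV" and hs: "(f has_sum S) UNIV"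
  shows "((\<lambda>(m, m'). f m * f m') has_sum S\<^sup>2) (UNIV \<times> UNIV)"
proof -
  have s: "(\<lambda>(m, m'). f m * f m') summable_on UNIV \<times> UNIV"
    by (rule summable_on_product_bound[OF n _ n]) (auto simp: norm_mult)
  have "infsum (\<lambda>(m, m'). f m * f m') (UNIV \<times> UNIV) = (\<Sum>\<^sub>\<infinity>m. \<Sum>\<^sub>\<infinity>m'. f m * f m')"
    using infsum_Sigma'_banach[OF s] by simp
  also have "\<dots> = S\<^sup>2"
    using infsumI[OF hs] by (simp add: infsum_cmult_right' infsum_cmult_left' power2_eq_square)
  finally show ?thesis
    using s by (simp add: has_sum_iff)
qed

text \<open>For n = -l the growth |q|^(-(m+m') l) is balanced by the quadratic exponents: tri m +
  tri m' + l^2 - (m+m') l equals ((m-l)^2 + (m'-l)^2)/2 + (m+m')/2. The quadratic part degenerates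
  along m = m' = l, where only the linear part yields decay.\<close>

lemma euler_odd_psi_bound:
  assumes q: "norm q < 1" "q \<noteq> 0"
  obtains C \<sigma> :: real where "C \<ge> 0" "0 \<le> \<sigma>" "\<sigma> < 1"
    "\<And>n m m'. norm (euler_coeff q m * euler_coeff q m' * (odd_psi q (m + m') n + odd_psi q (m + m') (n - 1)))
       \<le> C * \<sigma> ^ nat \<bar>n\<bar> * (\<sigma> ^ m * \<sigma> ^ m')"
proof -
  define r where "r = norm q"
  have r: "0 < r" "r < 1"
    using q by (simp_all add: r_def)
  \<comment> \<open>The fourth root allows half of the linear decay to be given up: part of it is
    moved from m, m' to l at the cost of the quadratic terms.\<close>
  define \<sigma> where "\<sigma> = sqrt (sqrt r)"
  have "\<sigma> ^ 4 = (\<sigma>\<^sup>2)\<^sup>2"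
    by (simp flip: power_mult)
  then have \<sigma>: "0 < \<sigma>" "\<sigma> < 1" "\<sigma> ^ 4 = r"
    using r by (simp_all add: \<sigma>_def)
  have r\<sigma>: "r ^ n = \<sigma> ^ (4 * n)" for n
    unfolding power_mult \<sigma>(3) ..
  obtain K1 where K1: "K1 > 0" "\<And>n. norm (qpoch q (q\<^sup>2) n) \<le> K1"
    using qpoch_bounded[OF norm_square_lt_1[OF q(1)]] by metis
  obtain K2 where K2: "K2 > 0" "\<And>n. norm (inverse (qpoch q q n)) \<le> K2"
    using inverse_qpoch_bounded[OF q(1), of q] mult_power_neq_1[OF q(1) q(1)] by metis
  obtain K3 where K3: "K3 > 0" "\<And>n. norm (inverse (qpoch q (q\<^sup>2) n)) \<le> K3"
    using inverse_qpoch_bounded[OF norm_square_lt_1[OF q(1)], of q]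
      mult_power_neq_1[OF norm_square_lt_1[OF q(1)] q(1)] by metis
  have e: "norm (euler_coeff q m) \<le> K2 * r ^ tri m" for m
  proof -
    have "norm (euler_coeff q m) = norm (inverse (qpoch q q m)) * r ^ tri m"
      by (simp add: euler_coeff_def r_def norm_divide norm_power norm_inverse divide_inverse norm_mult)
    then show ?thesis
      using K2(2)[of m] r by (simp add: mult_right_mono)
  qed
  define L where "L = K2 * K2 * K3 / \<sigma> ^ 8"
  have L: "L > 0"
    using K2 K3 \<sigma> by (simp add: L_def)
  have neg: "norm (euler_coeff q m * euler_coeff q m' * odd_psi q (m + m') (- int l)) \<le> L * \<sigma> ^ (2 * l + m + m')"
    for m m' l
  proof -
    define N where "N = tri m + tri m' + l * l"
    define s where "s = m + m'"
    have "norm (q powi (int s * - int l)) = 1 / r ^ (s * l)"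
    proof -
      have "int s * - int l = - int (s * l)"
        by simp
      then show ?thesis
        unfolding r_def by (simp only: power_int_minus power_int_of_nat norm_inverse norm_power inverse_eq_divide norm_divide norm_one)
    qed
    then have "norm (odd_psi q s (- int l)) = norm (inverse (qpoch q (q\<^sup>2) l)) * r ^ (l * l) / r ^ (s * l)"
      by (simp add: odd_psi_def odd_qpoch_neg[OF q] norm_mult norm_divide norm_power norm_inverse r_def
          norm_power_int divide_inverse)
    also have "\<dots> \<le> K3 * r ^ (l * l) / r ^ (s * l)"
      using K3(2)[of l] r by (intro divide_right_mono mult_right_mono) auto
    finally have o: "norm (odd_psi q s (- int l)) \<le> K3 * r ^ (l * l) / r ^ (s * l)" .
    have "norm (euler_coeff q m * euler_coeff q m' * odd_psi q s (- int l)) \<le>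
        (K2 * r ^ tri m) * (K2 * r ^ tri m') * (K3 * r ^ (l * l) / r ^ (s * l))"
      unfolding norm_mult using K2(1) K3(1) r by (intro mult_mono e o) auto
    also have "\<dots> = K2 * K2 * K3 * (r ^ N / r ^ (s * l))"
      by (simp add: N_def power_add)
    also have "r ^ N / r ^ (s * l) \<le> \<sigma> ^ (2 * l + m + m') / \<sigma> ^ 8"
    proof -
      \<comment> \<open>With u = m - l and v = m' - l the right side minus the left side is 2u^2 + u
        + 2v^2 + v + 8, whose nonconstant part is bounded below.\<close>
      have "4 * (s * l) + (2 * l + m + m') \<le> 4 * N + 8"
      proof -
        define u where "u = real m - real l"
        define v where "v = real m' - real l"
        have t: "2 * real (tri k) = real k * real k + real k" for k
          using arg_cong[OF two_tri[of k], of real] by simp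
        have "0 \<le> (u + 1)\<^sup>2 + 3 * u\<^sup>2 + (v + 1)\<^sup>2 + 3 * v\<^sup>2"
          by simp
        then have "real (4 * (s * l) + (2 * l + m + m')) \<le> 2 * (2 * real (tri m)) + 2 * (2 * real (tri m')) + 4 * real l * real l + 8"
          unfolding t u_def v_def s_def by (simp add: power2_eq_square algebra_simps)
        also have "\<dots> = real (4 * N + 8)"
          by (simp add: N_def)
        finally show ?thesis
          unfolding of_nat_le_iff .
      qed
      then have "\<sigma> ^ (4 * N + 8) \<le> \<sigma> ^ (4 * (s * l) + (2 * l + m + m'))"
        using \<sigma> by (intro power_decreasing) auto
      then have "r ^ N * \<sigma> ^ 8 \<le> r ^ (s * l) * \<sigma> ^ (2 * l + m + m')"
        unfolding r\<sigma> power_add[symmetric] .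
      then show ?thesis
        using r \<sigma> by (simp add: field_simps)
    qed
    then have "K2 * K2 * K3 * (r ^ N / r ^ (s * l)) \<le> K2 * K2 * K3 * (\<sigma> ^ (2 * l + m + m') / \<sigma> ^ 8)"
      using K2(1) K3(1) by (intro mult_left_mono) auto
    finally show ?thesis
      by (simp add: L_def s_def)
  qed
  define M where "M = 2 * K1 * K2 * K2 / \<sigma>"
  have M: "M > 0"
    using K1 K2 \<sigma> by (simp add: M_def)
  have pos: "norm (euler_coeff q m * euler_coeff q m' * (odd_psi q (m + m') (int (Suc k)) + odd_psi q (m + m') (int k)))
      \<le> M * \<sigma> ^ (Suc k + m + m')" for m m' k
  proof -
    define s where "s = m + m'"
    have op: "norm (odd_psi q s (int j)) \<le> K1 * r ^ (s * j)" for s j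
    proof -
      have "norm (q powi (int s * int j)) = r ^ (s * j)"
        unfolding of_nat_mult[symmetric] power_int_of_nat by (simp add: norm_power r_def)
      then show ?thesis
        using K1(2)[of j] r by (simp add: odd_psi_def odd_qpoch_of_nat[OF q] norm_mult norm_power_int norm_power mult_right_mono)
    qed
    \<comment> \<open>For s = 0 neither term decays in k, so the pair is combined exactly before
      taking norms; for s > 0 each term is small by itself.\<close>
    have "norm (odd_psi q s (int (Suc k)) + odd_psi q s (int k)) \<le> 2 * K1 * r ^ k"
    proof (cases "s = 0")
      case True
      have "odd_psi q s (int (Suc k)) + odd_psi q s (int k) = q * odd_psi q 2 (int k)"
        using odd_psi_0_pair[OF q, of "int (Suc k)"] True by simp
      then have "norm (odd_psi q s (int (Suc k)) + odd_psi q s (int k)) = r * norm (odd_psi q 2 (int k))"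
        by (simp add: norm_mult r_def)
      also have "\<dots> \<le> 1 * (K1 * r ^ (2 * k))"
        using r op[of 2 k] by (intro mult_mono) auto
      also have "\<dots> \<le> 1 * (K1 * r ^ k)"
        using r K1(1) by (intro mult_left_mono power_decreasing) auto
      also have "\<dots> \<le> 2 * K1 * r ^ k"
        using r K1(1) by simp
      finally show ?thesis .
    next
      case False
      then have s: "k \<le> s * k" "k \<le> s * Suc k"
        by (cases s; simp)+
      have "norm (odd_psi q s (int (Suc k)) + odd_psi q s (int k)) \<le> K1 * r ^ (s * Suc k) + K1 * r ^ (s * k)"
        by (rule norm_triangle_le[OF add_mono[OF op op]])
      also have "\<dots> \<le> K1 * r ^ k + K1 * r ^ k"
        using r K1(1) s by (intro add_mono mult_left_mono power_decreasing) auto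
      finally show ?thesis
        by simp
    qed
    then have "norm (euler_coeff q m * euler_coeff q m' * (odd_psi q s (int (Suc k)) + odd_psi q s (int k)))
      \<le> (K2 * r ^ tri m) * (K2 * r ^ tri m') * (2 * K1 * r ^ k)"
      unfolding norm_mult using K2(1) r by (intro mult_mono e) auto
    also have "\<dots> = 2 * K1 * K2 * K2 * (r ^ (tri m + tri m' + k))"
      by (simp add: power_add)
    also have "r ^ (tri m + tri m' + k) \<le> \<sigma> ^ (Suc k + m + m') / \<sigma>"
    proof -
      have "k + m + m' \<le> 4 * (tri m + tri m' + k)"
        using tri_ge[of m] tri_ge[of m'] by simp
      then have "r ^ (tri m + tri m' + k) \<le> \<sigma> ^ (k + m + m')"
        unfolding r\<sigma> using \<sigma> by (intro power_decreasing) auto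
      then show ?thesis
        using \<sigma> by simp
    qed
    then have "2 * K1 * K2 * K2 * (r ^ (tri m + tri m' + k)) \<le> 2 * K1 * K2 * K2 * (\<sigma> ^ (Suc k + m + m') / \<sigma>)"
      using K2(1) K1(1) by (intro mult_left_mono) auto
    finally show ?thesis
      using \<sigma>(1) by (simp add: M_def s_def mult_ac)
  qed
  have "norm (euler_coeff q m * euler_coeff q m' * (odd_psi q (m + m') n + odd_psi q (m + m') (n - 1)))
       \<le> (2 * L + M) * \<sigma> ^ nat \<bar>n\<bar> * (\<sigma> ^ m * \<sigma> ^ m')" for n m m'
  proof (cases "n > 0")
    case True
    then obtain k where k: "n = int (Suc k)"
      by (metis gr0_implies_Suc zero_less_imp_eq_int)
    then have nk: "nat \<bar>n\<bar> = Suc k" "n - 1 = int k"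
      by auto
    have "norm (euler_coeff q m * euler_coeff q m' * (odd_psi q (m + m') n + odd_psi q (m + m') (n - 1)))
        \<le> M * \<sigma> ^ (Suc k + m + m')"
      using pos[of m m' k] unfolding nk(2) by (simp only: k)
    also have "\<dots> \<le> (2 * L + M) * \<sigma> ^ (Suc k + m + m')"
      using L \<sigma> by (intro mult_right_mono) auto
    finally show ?thesis
      unfolding nk(1) power_add by (simp only: mult.assoc)
  next
    case False
    then obtain l where l: "n = - int l"
      by (metis int_cases2 of_nat_0_less_iff gr0I neg_0_equal_iff_equal of_nat_0)
    have "norm (euler_coeff q m * euler_coeff q m' * (odd_psi q (m + m') n + odd_psi q (m + m') (n - 1)))
      \<le> L * \<sigma> ^ (2 * l + m + m') + L * \<sigma> ^ (2 * Suc l + m + m')"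
    proof -
      have "n - 1 = - int (Suc l)"
        by (simp add: l)
      then show ?thesis
        unfolding distrib_left using neg[of m m' l] neg[of m m' "Suc l"]
        by (intro norm_triangle_le add_mono) (simp_all only: l)
    qed
    also have "\<dots> \<le> L * \<sigma> ^ (l + m + m') + L * \<sigma> ^ (l + m + m')"
      using L \<sigma> by (intro add_mono mult_left_mono power_decreasing) auto
    also have "\<dots> = (2 * L) * \<sigma> ^ (l + m + m')"
      by simp
    also have "\<dots> \<le> (2 * L + M) * \<sigma> ^ (l + m + m')"
      using M \<sigma> by (intro mult_right_mono) auto
    finally show ?thesis
      using l by (simp add: power_add mult.assoc)
  qed
  then show ?thesis
    using that[of "2 * L + M" \<sigma>] L M \<sigma> by simp
qed

definition theta_sum :: "complex \<Rightarrow> complex \<Rightarrow> complex" where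
  "theta_sum q e = (\<Sum>\<^sub>\<infinity>(m, m')\<in>UNIV \<times> UNIV. e ^ (m + m') * (euler_coeff q m * euler_coeff q m' * odd_psi_mean q (m + m')))"

definition bilat :: "complex \<Rightarrow> complex \<Rightarrow> int \<Rightarrow> complex" where
  "bilat q e n = (- 1) powi n * odd_qpoch q n * (qpoch_inf (- (q * (e * q powi n))) q)\<^sup>2"

text \<open>Fubini for the triple sum over n, m, m'. For fixed m, m' the sum over n is given by
  \<open>odd_psi_mean\<close>; for fixed n the sum over m, m' is the square of Euler's expansion.
  Pairing n with n - 1 is what makes the case m = m' = 0 absolutely summable.\<close>

lemma bilat_has_sum:
  assumes q: "norm q < 1" "q \<noteq> 0" and e: "norm e = 1"
  shows "(\<lambda>(m, m'). e ^ (m + m') * (euler_coeff q m * euler_coeff q m' * odd_psi_mean q (m + m'))) summable_on UNIV \<times> UNIV"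
    and "((\<lambda>n. bilat q e n + bilat q e (n - 1)) has_sum (2 * theta_sum q e)) UNIV"
proof -
  obtain C \<sigma> :: real where C: "C \<ge> 0" "0 \<le> \<sigma>" "\<sigma> < 1" and
    bd: "\<And>n m m'. norm (euler_coeff q m * euler_coeff q m' * (odd_psi q (m + m') n + odd_psi q (m + m') (n - 1)))
       \<le> C * \<sigma> ^ nat \<bar>n\<bar> * (\<sigma> ^ m * \<sigma> ^ m')"
    using euler_odd_psi_bound[OF q] by metis
  define T where "T n p = (case p of (m, m') \<Rightarrow> e ^ (m + m') *
      (euler_coeff q m * euler_coeff q m' * (odd_psi q (m + m') n + odd_psi q (m + m') (n - 1))))"
    for n :: int and p :: "nat \<times> nat"
  have sg: "(\<lambda>m. \<sigma> ^ m) summable_on UNIV"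
    using C by (intro summable_nonneg_imp_summable_on summable_geometric) auto
  have sb: "(\<lambda>(m, m'). \<sigma> ^ m * \<sigma> ^ m') summable_on UNIV \<times> UNIV"
    by (rule summable_on_product[OF sg _ sg]) (use C in auto)
  have sa: "(\<lambda>n::int. C * \<sigma> ^ nat \<bar>n\<bar>) summable_on UNIV"
    by (rule summable_on_int_halves) (use C in \<open>auto intro: summable_geometric\<close>)
  have sT: "(\<lambda>(n, p). T n p) summable_on UNIV \<times> (UNIV \<times> UNIV)"
  proof (rule summable_on_product_bound[OF sa _ sb])
    show "norm (T n p) \<le> C * \<sigma> ^ nat \<bar>n\<bar> * (case p of (m, m') \<Rightarrow> \<sigma> ^ m * \<sigma> ^ m')" for n p
    proof (cases p)
      case (Pair m m')
      then show ?thesis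
        using bd[of m m' n] e unfolding T_def by (simp add: norm_mult norm_power)
    qed
  qed (use C in auto)
  have sT': "(\<lambda>(p, n). T n p) summable_on (UNIV \<times> UNIV) \<times> UNIV"
    using summable_on_swap[of "\<lambda>(n, p). T n p" UNIV "UNIV \<times> UNIV"] sT by simp
  have in1: "infsum (T n) (UNIV \<times> UNIV) = bilat q e n + bilat q e (n - 1)" for n
  proof -
    have *: "((\<lambda>(m, m'). e ^ (m + m') * (euler_coeff q m * euler_coeff q m' * odd_psi q (m + m') n)) has_sum bilat q e n) (UNIV \<times> UNIV)" for n
    proof -
      have "((\<lambda>(m, m'). (euler_coeff q m * (e * q powi n) ^ m) * (euler_coeff q m' * (e * q powi n) ^ m')) has_sum
          (qpoch_inf (- (q * (e * q powi n))) q)\<^sup>2) (UNIV \<times> UNIV)"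
        by (intro has_sum_square norm_summable_imp_has_sum norm_summable_imp_summable_on)
           (use euler_expansion[OF q(1)] in simp_all)
      then have "((\<lambda>x. (- 1) powi n * odd_qpoch q n * (case x of (m, m') \<Rightarrow>
          (euler_coeff q m * (e * q powi n) ^ m) * (euler_coeff q m' * (e * q powi n) ^ m'))) has_sum bilat q e n) (UNIV \<times> UNIV)"
        unfolding bilat_def by (rule has_sum_cmult_right)
      moreover have "(- 1) powi n * odd_qpoch q n * ((euler_coeff q m * (e * q powi n) ^ m) * (euler_coeff q m' * (e * q powi n) ^ m'))
         = e ^ (m + m') * (euler_coeff q m * euler_coeff q m' * odd_psi q (m + m') n)" for m m'
      proof -
        have "q powi (int (m + m') * n) = (q powi n) ^ (m + m')"
          by (metis mult.commute power_int_mult power_int_of_nat)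
        then show ?thesis
          unfolding odd_psi_def by (simp add: power_mult_distrib power_add mult_ac)
      qed
      ultimately show ?thesis
        by (simp add: case_prod_unfold)
    qed
    have "T n = (\<lambda>x. (case x of (m, m') \<Rightarrow> e ^ (m + m') * (euler_coeff q m * euler_coeff q m' * odd_psi q (m + m') n)) +
        (case x of (m, m') \<Rightarrow> e ^ (m + m') * (euler_coeff q m * euler_coeff q m' * odd_psi q (m + m') (n - 1))))"
      by (auto simp: T_def distrib_left)
    then show ?thesis
      using has_sum_add[OF *[of n] *[of "n - 1"]] by (simp add: infsumI)
  qed
  have in2: "infsum (\<lambda>n. T n p) UNIV = 2 * (case p of (m, m') \<Rightarrow> e ^ (m + m') * (euler_coeff q m * euler_coeff q m' * odd_psi_mean q (m + m')))" for p
  proof (cases p)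
    case (Pair m m')
    have "((\<lambda>n. T n p) has_sum (e ^ (m + m') * (euler_coeff q m * euler_coeff q m' * (2 * odd_psi_mean q (m + m'))))) UNIV"
      unfolding T_def Pair prod.case by (intro has_sum_cmult_right odd_psi_mean_has_sum q)
    then show ?thesis
      by (simp add: infsumI Pair)
  qed
  have s1: "(\<lambda>n. bilat q e n + bilat q e (n - 1)) summable_on UNIV"
    using summable_on_Sigma_banach[OF sT] unfolding in1 .
  have "(\<lambda>p. 2 * (case p of (m, m') \<Rightarrow> e ^ (m + m') * (euler_coeff q m * euler_coeff q m' * odd_psi_mean q (m + m')))) summable_on UNIV \<times> UNIV"
    using summable_on_Sigma_banach[OF sT'] unfolding in2 .
  then show s2: "(\<lambda>(m, m'). e ^ (m + m') * (euler_coeff q m * euler_coeff q m' * odd_psi_mean q (m + m'))) summable_on UNIV \<times> UNIV"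
    by (subst (asm) summable_on_cmult_right') auto
  have "(\<Sum>\<^sub>\<infinity>n. bilat q e n + bilat q e (n - 1)) = 2 * theta_sum q e"
    using infsum_swap_banach[OF sT] unfolding in1 in2 theta_sum_def by (simp add: infsum_cmult_right')
  with s1 show "((\<lambda>n. bilat q e n + bilat q e (n - 1)) has_sum (2 * theta_sum q e)) UNIV"
    by (simp add: has_sum_iff)
qed

text \<open>Pairing turns the terms with n >= 0 into differences of the unsigned sequence b, while
  each negative term occurs in two pairs.\<close>

lemma bilat_split:
  assumes q: "norm q < 1" "q \<noteq> 0" and e: "norm e = 1"
    and B: "summable (\<lambda>k. bilat q e (- int (Suc k)))"
    and b: "\<And>n. b n = (- 1) ^ n * bilat q e (int n)"
  shows "(\<Sum>n. (- 1) ^ n * bdiff b n) + 2 * (\<Sum>k. bilat q e (- int (Suc k))) = 2 * theta_sum q e"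
proof -
  define B where "B k = bilat q e (- int (Suc k))" for k
  define a where "a n = bilat q e n + bilat q e (n - 1)" for n
  have hs: "(a has_sum (2 * theta_sum q e)) UNIV"
    unfolding a_def by (rule bilat_has_sum(2)[OF q e])
  note sp = has_sum_int_split[OF has_sum_imp_summable[OF hs]]
  have sq: "(- 1) ^ n * (- 1) ^ n = (1 :: complex)" for n :: nat
    by (simp flip: power_mult_distrib)
  \<comment> \<open>The pair at n = 0 straddles the halves: besides \<open>b 0\<close> it contains
    the first negative term \<open>B 0\<close>, which is split off and returned to the negative
    half.\<close>
  have a_nat: "a (int n) = (- 1) ^ n * bdiff b n + (if n = 0 then B 0 else 0)" for n
  proof (cases n)
    case 0
    then show ?thesis
      by (simp add: a_def b B_def)
  next
    case (Suc k)
    have "(- 1) ^ Suc k * b (Suc k) = bilat q e (int (Suc k))"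
      unfolding b mult.assoc[symmetric] sq by simp
    moreover have "(- 1) ^ Suc k * b k = - bilat q e (int k)"
      using sq[of k] unfolding b by (simp add: mult.assoc[symmetric])
    ultimately show ?thesis
      using Suc by (simp add: a_def right_diff_distrib del: power_Suc)
  qed
  have a_neg: "a (- int (Suc k)) = B k + B (Suc k)" for k
    by (simp add: a_def B_def algebra_simps)
  have B: "summable B"
    using B by (simp add: B_def[abs_def])
  then have BS: "summable (\<lambda>k. B (Suc k))"
    by (subst summable_Suc_iff)
  have s0: "(\<lambda>n. if n = 0 then B 0 else 0) sums B 0"
    using sums_If_finite_set[of "{0}" "\<lambda>_. B 0"] by simp
  have "(\<lambda>n. a (int n) - (if n = 0 then B 0 else 0)) sums ((\<Sum>n. a (int n)) - B 0)"
    by (intro sums_diff summable_sums sp(1) s0)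
  then have "(\<Sum>n. (- 1) ^ n * bdiff b n) = (\<Sum>n. a (int n)) - B 0"
    unfolding a_nat by (simp add: sums_iff)
  moreover have "(\<Sum>k. a (- int (Suc k))) = (\<Sum>k. B k) + (\<Sum>k. B (Suc k))"
    unfolding a_neg by (rule suminf_add[OF B BS, symmetric])
  moreover have "(\<Sum>k. B (Suc k)) = (\<Sum>k. B k) - B 0"
    using suminf_split_head[OF B] .
  moreover have "2 * theta_sum q e = (\<Sum>n. a (int n)) + (\<Sum>k. a (- int (Suc k)))"
    using infsumI[OF hs] sp(3) by simp
  ultimately show ?thesis
    unfolding B_def[symmetric] by simp
qed

subsection \<open>Evaluation of the theta sums\<close>

definition dual_term :: "complex \<Rightarrow> nat \<Rightarrow> complex" where
  "dual_term q n = q ^ (n + 1) * (qpoch (- q) q n)\<^sup>2 / qpoch q (q\<^sup>2) (n + 1)"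

lemma dual_term_summable:
  assumes q: "norm q < 1"
  shows "summable (\<lambda>n. norm (dual_term q n))"
proof -
  define r where "r n = q * (1 + q ^ Suc n)\<^sup>2 / (1 - q * (q\<^sup>2) ^ Suc n)" for n
  have "(\<lambda>n. q ^ Suc n) \<longlonglongrightarrow> 0" "(\<lambda>n. (q\<^sup>2) ^ Suc n) \<longlonglongrightarrow> 0"
    by (rule LIMSEQ_Suc[OF LIMSEQ_power_zero], use q norm_square_lt_1[OF q] in simp)+
  then have "r \<longlonglongrightarrow> q * (1 + 0)\<^sup>2 / (1 - q * 0)"
    unfolding r_def by (intro tendsto_intros) auto
  then have "r \<longlonglongrightarrow> q"
    by simp
  moreover have "dual_term q (Suc n) = r n * dual_term q n" for n
    by (simp add: dual_term_def r_def qpoch_Suc power_mult_distrib mult_ac)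
  ultimately show ?thesis
    using summable_ratio_limit[of r q "dual_term q"] q by blast
qed

text \<open>Unrolling (-q^(-k);q)_inf down to (-q;q)_inf passes the factor 1 + 1, whose square is
  the 4. Since (k+1)^2 = 2 tri k + k + 1, the powers of q cancel down to q^(k+1).\<close>

lemma bilat_neg_1:
  assumes q: "norm q < 1" "q \<noteq> 0"
  shows "bilat q 1 (- int (Suc k)) = 4 * (qpoch_inf (- q) q)\<^sup>2 * dual_term q k"
proof -
  define Y where "Y k = qpoch_inf (- (1 / q ^ k)) q" for k
  have Y: "Y k = 2 * qpoch_inf (- q) q * qpoch (- q) q k / q ^ tri k" for k
  proof (induction k)
    case 0
    show ?case
      unfolding Y_def by (subst qpoch_inf_rec[OF q(1)]) simp
  next
    case (Suc k)
    have "Y (Suc k) = (1 + q ^ Suc k) / q ^ Suc k * Y k"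
      unfolding Y_def using q by (subst qpoch_inf_rec[OF q(1)]) (simp add: field_simps)
    also have "\<dots> = 2 * qpoch_inf (- q) q * (qpoch (- q) q k * (1 + q ^ Suc k)) / (q ^ tri k * q ^ Suc k)"
      unfolding Suc.IH by (simp add: mult_ac)
    finally show ?case
      by (simp add: qpoch_Suc tri_Suc power_add)
  qed
  have "q * (1 * q powi (- int (Suc k))) = 1 / q ^ k"
    using q unfolding power_int_minus power_int_of_nat by (simp add: field_simps)
  moreover have sg: "(- 1 :: complex) powi (- int (Suc k)) = (- 1) ^ Suc k"
    unfolding power_int_minus power_int_of_nat by (simp add: power_inverse[symmetric] del: power_Suc)
  ultimately have "bilat q 1 (- int (Suc k)) = (- 1) ^ Suc k * odd_qpoch q (- int (Suc k)) * (Y k)\<^sup>2"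
    unfolding bilat_def Y_def by simp
  also have "\<dots> = ((- 1) ^ Suc k * (- 1) ^ Suc k) * (q ^ (Suc k * Suc k) / qpoch q (q\<^sup>2) (Suc k)) * (Y k)\<^sup>2"
    unfolding odd_qpoch_neg[OF q] by (simp only: times_divide_eq_left times_divide_eq_right mult.assoc)
  also have "(- 1) ^ Suc k * (- 1) ^ Suc k = (1 :: complex)"
    by (simp flip: power_mult_distrib)
  also have "Suc k * Suc k = 2 * tri k + (k + 1)"
    unfolding two_tri by simp
  also have "q ^ (2 * tri k + (k + 1)) = (q ^ tri k)\<^sup>2 * q ^ (k + 1)"
    unfolding power_add by (simp only: mult.commute[of 2] power_mult)
  finally show ?thesis
    unfolding Y using q by (simp add: dual_term_def power_divide power_mult_distrib)
qed

lemma theta_sum_1: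
  assumes q: "norm q < 1" "q \<noteq> 0"
  shows "theta_sum q 1 = (qpoch_inf (- q) q)\<^sup>2 * (2 * S4_one q + 4 * (\<Sum>n. dual_term q n))"
proof -
  define P where "P = qpoch_inf (- q) q"
  have sd: "summable (dual_term q)"
    by (rule summable_norm_cancel[OF dual_term_summable[OF q(1)]])
  define b where "b n = P\<^sup>2 * (qpoch q (q\<^sup>2) n / (qpoch (- q) q n)\<^sup>2)" for n
  have b: "b n = (- 1) ^ n * bilat q 1 (int n)" for n
  proof -
    have "P = qpoch (- q) q n * qpoch_inf (- (q * q ^ n)) q"
      unfolding P_def using qpoch_inf_split[OF q(1), of "- q" n] by simp
    moreover have "qpoch (- q) q n \<noteq> 0"
      using qpoch_nonzero'[OF q(1), of "- q"] q by simp
    moreover have "(- 1) ^ n * ((- 1) ^ n * x) = x" for x :: complex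
      by (simp add: mult.assoc[symmetric] flip: power_mult_distrib)
    ultimately show ?thesis
      by (simp add: b_def bilat_def odd_qpoch_of_nat[OF q] power_mult_distrib mult.assoc)
  qed
  have bn: "bilat q 1 (- int (Suc k)) = 4 * P\<^sup>2 * dual_term q k" for k
    unfolding P_def by (rule bilat_neg_1[OF q])
  have "summable (\<lambda>k. bilat q 1 (- int (Suc k)))"
    unfolding bn by (intro summable_mult sd)
  from bilat_split[OF q _ this b]
  have "(\<Sum>n. (- 1) ^ n * bdiff b n) + 2 * (4 * P\<^sup>2 * (\<Sum>k. dual_term q k)) = 2 * theta_sum q 1"
    unfolding bn suminf_mult[OF sd] by simp
  moreover have "(\<lambda>n. P\<^sup>2 * ((- 1) ^ n * bdiff (\<lambda>n. qpoch q (q\<^sup>2) n / (qpoch (- q) q n)\<^sup>2) n)) sums (P\<^sup>2 * (4 * S4_one q))"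
    by (intro sums_mult S4_alternating q)
  moreover have "P\<^sup>2 * ((- 1) ^ n * bdiff (\<lambda>n. qpoch q (q\<^sup>2) n / (qpoch (- q) q n)\<^sup>2) n) = (- 1) ^ n * bdiff b n" for n
    by (cases n) (simp_all add: b_def right_diff_distrib mult_ac)
  ultimately have "2 * theta_sum q 1 = 2 * (P\<^sup>2 * (2 * S4_one q + 4 * (\<Sum>n. dual_term q n)))"
    by (simp add: sums_iff algebra_simps)
  then show ?thesis
    by (simp add: P_def)
qed

text \<open>For the sign -1 the negative terms contain (q^(-k);q)_inf, which has a vanishing factor.
  The others are (q;q)_inf^2 times \<open>pf_term\<close> with j = 0, so the single-j evaluation
  already suffices.\<close>

lemma theta_sum_neg_1:
  assumes q: "norm q < 1" "q \<noteq> 0"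
  shows "theta_sum q (- 1) = qpoch_inf q q / (2 * (qpoch_inf (- q) q)\<^sup>2)"
proof -
  define R where "R = qpoch_inf q q"
  have R: "R \<noteq> 0"
    unfolding R_def by (rule qpoch_inf_nonzero'[OF q(1) q(1)])
  define b where "b n = R\<^sup>2 * pf_term q 0 n" for n
  have b: "b n = (- 1) ^ n * bilat q (- 1) (int n)" for n
  proof -
    have "R = qpoch q q n * qpoch_inf (q * q ^ n) q"
      unfolding R_def by (rule qpoch_inf_split[OF q(1)])
    moreover have "qpoch q q n \<noteq> 0"
      by (rule qpoch_nonzero'[OF q(1) q(1)])
    moreover have "(- 1) ^ n * ((- 1) ^ n * x) = x" for x :: complex
      by (simp add: mult.assoc[symmetric] flip: power_mult_distrib)
    moreover have "pf_term q 0 n = qpoch q (q\<^sup>2) n / (qpoch q q n)\<^sup>2"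
      by (simp add: pf_term_def inv_qfact_def divide_inverse power2_eq_square)
    ultimately show ?thesis
      by (simp add: b_def bilat_def odd_qpoch_of_nat[OF q] power_mult_distrib mult.assoc)
  qed
  have bn: "bilat q (- 1) (- int (Suc k)) = 0" for k
  proof -
    have "- (q * (- 1 * q powi (- int (Suc k)))) = 1 / q ^ k"
      using q unfolding power_int_minus power_int_of_nat by (simp add: field_simps)
    moreover have "qpoch_inf (1 / q ^ k) q = 0"
      using qpoch_inf_split[OF q(1), of "1 / q ^ k" k] q by simp
    ultimately show ?thesis
      by (simp add: bilat_def)
  qed
  have "(\<Sum>n. (- 1) ^ n * bdiff b n) = 2 * theta_sum q (- 1)"
    using bilat_split[OF q _ _ b] unfolding bn by simp
  moreover have "(\<Sum>n. (- 1) ^ n * bdiff b n) = R\<^sup>2 * (1 / (R * (qpoch_inf (- q) q)\<^sup>2))"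
  proof -
    have eq: "R\<^sup>2 * ((- 1) ^ n * bdiff (pf_term q 0) n) = (- 1) ^ n * bdiff b n" for n
      by (cases n) (simp_all add: b_def right_diff_distrib mult_ac)
    have "(\<lambda>n. R\<^sup>2 * ((- 1) ^ n * bdiff (pf_term q 0) n)) sums
        (R\<^sup>2 * ((- 1) ^ 0 / (R * (qpoch_inf (- q) q)\<^sup>2)))"
      unfolding R_def by (intro sums_mult pf_term_sums q)
    then show ?thesis
      unfolding eq by (simp add: sums_iff)
  qed
  ultimately have "2 * theta_sum q (- 1) = R / (qpoch_inf (- q) q)\<^sup>2"
    using R by (simp add: power2_eq_square)
  then have "2 * theta_sum q (- 1) / 2 = R / (qpoch_inf (- q) q)\<^sup>2 / 2"
    by (rule arg_cong)
  then show ?thesis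
    by (simp add: R_def mult.commute)
qed

definition theta_coeff :: "complex \<Rightarrow> nat \<Rightarrow> complex" where
  "theta_coeff q r = (\<Sum>m. euler_coeff q m * euler_coeff q (m + r) * odd_psi_mean q (2 * m + r))"

text \<open>The double sum is regrouped by r = |m - m'|: \<open>h1\<close> covers m <= m', and
  \<open>h2\<close> covers the rest, which repeats the values with r > 0. As the square of e is 1,
  the sign depends on r only.\<close>

lemma theta_sum_series:
  assumes q: "norm q < 1" "q \<noteq> 0" and e: "e\<^sup>2 = 1"
  shows "(\<lambda>r. (if r = 0 then 1 else 2) * (e ^ r * theta_coeff q r)) sums theta_sum q e"
proof -
  have ne: "norm e = 1"
    using e by (metis norm_one norm_power power2_eq_1_iff norm_minus_cancel)
  define f where "f p = (case p of (m, m') \<Rightarrow> e ^ (m + m') * (euler_coeff q m * euler_coeff q m' * odd_psi_mean q (m + m')))"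
    for p :: "nat \<times> nat"
  have sf: "f summable_on UNIV"
    using bilat_has_sum(1)[OF q ne] by (simp add: f_def[abs_def])
  have sym: "f (m, m') = f (m', m)" for m m'
    by (simp add: f_def add.commute mult.commute mult.left_commute)
  define h1 where "h1 p = (case p of (r, m) \<Rightarrow> (m, m + r))" for p :: "nat \<times> nat"
  define h2 where "h2 p = (case p of (r, m) \<Rightarrow> (m + Suc r, m))" for p :: "nat \<times> nat"
  have inj: "inj h1" "inj h2"
    by (auto simp: inj_def h1_def h2_def)
  have "p \<in> range h1 \<union> range h2" for p
  proof (cases p)
    case (Pair m m')
    show ?thesis
    proof (cases "m \<le> m'")
      case True
      then have "p = h1 (m' - m, m)"
        by (simp add: Pair h1_def)
      then show ?thesis by blast
    next
      case False
      then have "p = h2 (m - m' - 1, m')"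
        by (simp add: Pair h2_def)
      then show ?thesis by blast
    qed
  qed
  then have U: "UNIV = range h1 \<union> range h2"
    by blast
  have D: "range h1 \<inter> range h2 = {}"
    by (auto simp: h1_def h2_def)
  have s: "f summable_on range h1" "f summable_on range h2"
    using sf summable_on_subset_banach by blast+
  have "infsum f UNIV = infsum f (range h1 \<union> range h2)"
    by (rule arg_cong[OF U])
  also have "\<dots> = infsum f (range h1) + infsum f (range h2)"
    by (rule infsum_Un_disjoint[OF s D])
  also have "\<dots> = infsum (f \<circ> h1) UNIV + infsum (f \<circ> h2) UNIV"
    unfolding infsum_reindex[OF inj(1)] infsum_reindex[OF inj(2)] ..
  finally have F: "theta_sum q e = infsum (f \<circ> h1) UNIV + infsum (f \<circ> h2) UNIV"
    by (simp add: theta_sum_def f_def[abs_def])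
  define V where "V r = e ^ r * theta_coeff q r" for r
  define g where "g r m = f (m, m + r)" for r m
  have h1g: "f \<circ> h1 = (\<lambda>(r, m). g r m)" and h2g: "f \<circ> h2 = (\<lambda>(r, m). g (Suc r) m)"
    by (auto simp: g_def h1_def h2_def sym)
  have s1: "(\<lambda>(r, m). g r m) summable_on UNIV \<times> UNIV" and s2: "(\<lambda>(r, m). g (Suc r) m) summable_on UNIV \<times> UNIV"
    using s unfolding summable_on_reindex[OF inj(1)] summable_on_reindex[OF inj(2)] h1g h2g by simp_all
  have gr: "infsum (g r) UNIV = V r" for r
  proof -
    have "g r summable_on UNIV"
      using summable_on_SigmaD1[of g UNIV "\<lambda>_. UNIV" r] s1 by simp
    note 1 = has_sum_nat_suminf[OF this]
    have g: "g r m = e ^ r * (euler_coeff q m * euler_coeff q (m + r) * odd_psi_mean q (2 * m + r))" for m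
    proof -
      have "e ^ (m + (m + r)) = (e\<^sup>2) ^ m * e ^ r"
        by (simp add: power_add power_mult[symmetric] mult_2)
      then show ?thesis
        by (simp add: g_def f_def e mult_2 add.assoc)
    qed
    have e0: "e ^ r \<noteq> 0"
      using ne by auto
    have "summable (\<lambda>m. euler_coeff q m * euler_coeff q (m + r) * odd_psi_mean q (2 * m + r))"
      using 1(2) e0 unfolding g summable_cmult_iff by blast
    then show ?thesis
      unfolding 1(1) g V_def theta_coeff_def by (rule suminf_mult)
  qed
  have sV: "V summable_on UNIV" "(\<lambda>r. V (Suc r)) summable_on UNIV"
    using summable_on_Sigma_banach[of g UNIV "\<lambda>_. UNIV"] summable_on_Sigma_banach[of "\<lambda>r. g (Suc r)" UNIV "\<lambda>_. UNIV"] s1 s2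
    by (simp_all add: gr)
  have "infsum (f \<circ> h1) UNIV = infsum V UNIV" "infsum (f \<circ> h2) UNIV = infsum (\<lambda>r. V (Suc r)) UNIV"
    unfolding h1g h2g
    using infsum_Sigma'_banach[of g UNIV "\<lambda>_. UNIV"] infsum_Sigma'_banach[of "\<lambda>r. g (Suc r)" UNIV "\<lambda>_. UNIV"] s1 s2
    by (simp_all add: gr)
  then have F': "theta_sum q e = infsum V UNIV + infsum (\<lambda>r. V (Suc r)) UNIV"
    using F by simp
  have V1: "V sums infsum V UNIV" and V2: "(\<lambda>r. V (Suc r)) sums infsum (\<lambda>r. V (Suc r)) UNIV"
    using sV by (auto intro!: has_sum_imp_sums)
  have "(\<lambda>r. if r = 0 then 0 else V r) sums infsum (\<lambda>r. V (Suc r)) UNIV"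
    using V2 sums_Suc_iff[of "\<lambda>r. if r = 0 then 0 else V r"] by simp
  from sums_add[OF V1 this] show ?thesis
    unfolding F'[symmetric] by (rule back_subst[of "\<lambda>f. f sums _"]) (auto simp: V_def)
qed

text \<open>For fixed r the powers of q from both Euler coefficients and from
  \<open>odd_psi_mean_shift\<close> combine to q^m up to a constant. The sum over m is thus an even
  q-Gauss sum with A = -q^r, c = q^(r+1) and argument -c/A = q.\<close>

lemma theta_coeff_gauss:
  assumes q: "norm q < 1" "q \<noteq> 0"
  shows "theta_coeff q r = odd_psi_mean q r * q ^ tri r * qpoch_inf (- (q ^ r * q\<^sup>2)) (q\<^sup>2) / (qpoch_inf q q)\<^sup>2"
proof -
  define A where "A = - (q ^ r)"
  define c where "c = q ^ (r + 1)"
  define C where "C = odd_psi_mean q r * q ^ tri r / qpoch q q r"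
  have c: "norm c < 1"
    unfolding c_def norm_power using power_less_one_iff[of "norm q" "r + 1"] q(1) by simp
  have A: "A \<noteq> 0" "- c / A = q" "c\<^sup>2 / A = - (q ^ r * q\<^sup>2)"
    using q(2) by (simp_all add: A_def c_def power2_eq_square)
  have cA: "norm (c / A) < 1"
    using A(2) q(1) by (metis minus_divide_left norm_minus_cancel)
  have tm: "euler_coeff q m * euler_coeff q (m + r) * odd_psi_mean q (2 * m + r) =
      C * ((- c / A) ^ m * gauss_coeff q A c m)" for m
  proof -
    define E where "E = m * m + r * m"
    have "2 * (tri m + tri (m + r)) = 2 * (E + tri r + m)"
      unfolding distrib_left two_tri E_def by (simp add: algebra_simps)
    then have "tri m + tri (m + r) = E + tri r + m"
      by simp
    then have 1: "q ^ tri m * q ^ tri (m + r) = q ^ E * q ^ tri r * q ^ m"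
      by (simp only: power_add[symmetric])
    have 2: "qpoch q q (m + r) = qpoch q q r * qpoch c q m"
      using qpoch_add[of q q r m] by (simp add: c_def add.commute)
    have "euler_coeff q m * euler_coeff q (m + r) * odd_psi_mean q (2 * m + r) =
       (q ^ tri m * q ^ tri (m + r)) / q ^ E * odd_psi_mean q r * qpoch A (q\<^sup>2) m /
         (qpoch q q m * qpoch q q (m + r))"
      unfolding odd_psi_mean_shift[OF q] euler_coeff_def A_def E_def by (simp add: mult_ac)
    also have "(q ^ tri m * q ^ tri (m + r)) / q ^ E = q ^ tri r * q ^ m"
      unfolding 1 using q(2) by simp
    finally show ?thesis
      unfolding 2 A(2) C_def gauss_coeff_def by (simp add: mult_ac)
  qed
  have "(\<lambda>m. C * ((- c / A) ^ m * gauss_coeff q A c m)) sums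
      (C * (qpoch_inf (c\<^sup>2 / A) (q\<^sup>2) / (qpoch_inf c q * qpoch_inf (- c / A) q)))"
    by (intro sums_mult even_q_gauss q c A cA)
  then have "theta_coeff q r = C * (qpoch_inf (c\<^sup>2 / A) (q\<^sup>2) / (qpoch_inf c q * qpoch_inf (- c / A) q))"
    unfolding theta_coeff_def tm by (simp add: sums_iff)
  also have "\<dots> = odd_psi_mean q r * q ^ tri r * qpoch_inf (- (q ^ r * q\<^sup>2)) (q\<^sup>2) /
      ((qpoch q q r * qpoch_inf c q) * qpoch_inf q q)"
    unfolding A C_def by (simp add: mult.assoc)
  also have "qpoch q q r * qpoch_inf c q = qpoch_inf q q"
    using qpoch_inf_split[OF q(1), of q r] by (simp add: c_def)
  finally show ?thesis
    by (simp only: power2_eq_square)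
qed

text \<open>The finite product from \<open>odd_psi_mean_shift\<close> and the infinite one from the
  q-Gauss sum complement each other except for one missing factor 1 + q^(2j+a). This is where the
  denominators come from.\<close>

lemma theta_coeff_eq:
  assumes q: "norm q < 1" "q \<noteq> 0"
  shows "theta_coeff q (2 * j + a) = odd_psi_mean q a * qpoch_inf (- (q ^ a)) (q\<^sup>2) / (qpoch_inf q q)\<^sup>2 *
      (q ^ (j * j + a * j + j + tri a) / (1 + q ^ (2 * j + a)))"
proof -
  define X where "X = qpoch (- (q ^ a)) (q\<^sup>2) j"
  define Y where "Y = qpoch_inf (- (q ^ (2 * j + a) * q\<^sup>2)) (q\<^sup>2)"
  have "2 * tri (2 * j + a) = 2 * ((j * j + a * j) + (j * j + a * j + j + tri a))"
    unfolding distrib_left two_tri by (simp add: algebra_simps)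
  then have t: "tri (2 * j + a) = (j * j + a * j) + (j * j + a * j + j + tri a)"
    by simp
  have "qpoch_inf (- (q ^ a)) (q\<^sup>2) = X * qpoch_inf (- (q ^ (2 * j + a))) (q\<^sup>2)"
    unfolding X_def using qpoch_inf_split[OF norm_square_lt_1[OF q(1)], of "- (q ^ a)" j]
    by (simp add: power_add power_mult mult.commute[of "q ^ a"])
  also have "qpoch_inf (- (q ^ (2 * j + a))) (q\<^sup>2) = (1 + q ^ (2 * j + a)) * Y"
    unfolding Y_def by (subst qpoch_inf_rec[OF norm_square_lt_1[OF q(1)]]) simp
  finally have XY: "X * Y = qpoch_inf (- (q ^ a)) (q\<^sup>2) / (1 + q ^ (2 * j + a))"
    using one_plus_power_nonzero[OF q(1), of "2 * j + a"] by simp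
  have "theta_coeff q (2 * j + a) = odd_psi_mean q a * q ^ (j * j + a * j + j + tri a) * (X * Y) / (qpoch_inf q q)\<^sup>2"
    unfolding theta_coeff_gauss[OF q] odd_psi_mean_shift[OF q] t power_add[of q "j * j + a * j" "j * j + a * j + j + tri a"]
      X_def[symmetric] Y_def[symmetric]
    using q(2) by simp
  then show ?thesis
    unfolding XY by (simp add: mult_ac)
qed

subsection \<open>Bounds for \<open>S\<^sub>4\<close> and Jacobi's quartic identity\<close>

definition theta_quot :: "nat \<Rightarrow> complex \<Rightarrow> complex" where
  "theta_quot a q = (qpoch_inf (- (q ^ a)) (q\<^sup>2))\<^sup>2 / qpoch_inf q q"

lemma qpoch_inf_q_eq:
  assumes q: "norm q < 1"
  shows "qpoch_inf q q = qpoch_inf q (q\<^sup>2) * qpoch_inf (q\<^sup>2) (q\<^sup>2)"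
  using qpoch_inf_base_square[OF q, of q] by (simp add: power2_eq_square)

lemma sums_norm_geometric_bound:
  fixes f :: "nat \<Rightarrow> complex"
  assumes f: "f sums S" and bd: "\<And>n. norm (f n) \<le> M * r ^ n" and r: "0 \<le> r" "r < 1"
  shows "norm S \<le> M / (1 - r)"
proof -
  have g: "(\<lambda>n. M * r ^ n) sums (M * (1 / (1 - r)))"
    using r by (intro sums_mult geometric_sums) auto
  have "norm (suminf f) \<le> (\<Sum>n. M * r ^ n)"
    by (rule norm_suminf_le) (use g bd in \<open>auto simp: sums_iff\<close>)
  then show ?thesis
    using f g by (simp add: sums_iff)
qed

text \<open>The sign (-1)^a keeps exactly the indices of the parity of a, for which c bounds the
  denominators below. The exponent of q in the n-th term is at least n, so a geometric series
  suffices, at the price of a factor 1 / (1 - |q|).\<close>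

lemma theta_sum_bound:
  assumes q: "norm q < 1" "q \<noteq> 0" and c: "c > 0" "\<And>j. c \<le> norm (1 + q ^ (2 * j + a))" and a: "a \<le> 1"
  shows "norm (theta_sum q 1 + (- 1) ^ a * theta_sum q (- 1)) \<le>
      4 * norm (odd_psi_mean q a * qpoch_inf (- (q ^ a)) (q\<^sup>2) / (qpoch_inf q q)\<^sup>2) / c / (1 - norm q)"
proof -
  define K where "K = odd_psi_mean q a * qpoch_inf (- (q ^ a)) (q\<^sup>2) / (qpoch_inf q q)\<^sup>2"
  define r where "r = norm q"
  have r: "0 \<le> r" "r < 1"
    using q by (simp_all add: r_def)
  define f where "f n = (if n = 0 then 1 else 2) * (1 ^ n * theta_coeff q n) +
      (- 1) ^ a * ((if n = 0 then 1 else 2) * ((- 1) ^ n * theta_coeff q n))" for n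
  have fs: "f sums (theta_sum q 1 + (- 1) ^ a * theta_sum q (- 1))"
    unfolding f_def by (intro sums_add sums_mult theta_sum_series q) auto
  have fn: "f n = (if n = 0 then 1 else 2) * ((1 + (- 1) ^ a * (- 1) ^ n) * theta_coeff q n)" for n
    by (simp add: f_def algebra_simps)
  have "norm (f n) \<le> 4 * norm K / c * r ^ n" for n
  proof (cases "even (n + a)")
    case True
    define j where "j = n div 2"
    have j: "n = 2 * j + a"
      using True a unfolding j_def by presburger
    have "(- 1) ^ a * (- 1) ^ n = (1 :: complex)"
      using True by (simp flip: power_add add: add.commute)
    then have "f n = (if n = 0 then 1 else 2) * (2 * theta_coeff q n)"
      unfolding fn by simp
    then have "norm (f n) \<le> 4 * norm (theta_coeff q n)"
      by (simp add: norm_mult)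
    also have "norm (theta_coeff q n) = norm K * (r ^ (j * j + a * j + j + tri a) / norm (1 + q ^ (2 * j + a)))"
      unfolding j theta_coeff_eq[OF q] K_def by (simp add: norm_mult norm_divide norm_power r_def)
    also have "\<dots> \<le> norm K * (r ^ n / c)"
    proof (intro mult_left_mono frac_le)
      have "j \<le> j * j"
        by simp
      then have "2 * j + a \<le> j * j + a * j + j + tri a"
        using tri_ge[of a] by linarith
      then show "r ^ (j * j + a * j + j + tri a) \<le> r ^ n"
        unfolding j using r by (intro power_decreasing) auto
    qed (use r c in auto)
    finally show ?thesis
      by simp
  next
    case False
    then have "(- 1) ^ a * (- 1) ^ n = (- 1 :: complex)"
      by (simp flip: power_add add: add.commute)
    then have "f n = 0"
      unfolding fn by simp
    then show ?thesis
      using c r by simp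
  qed
  then show ?thesis
    unfolding K_def[symmetric] r_def[symmetric] by (rule sums_norm_geometric_bound[OF fs _ r])
qed

text \<open>The identities \<open>d * P = 1\<close> and \<open>R = d * Q\<close> turn the prefactor
  of the theta series into P^2 times \<open>theta_quot\<close>, up to a constant. The factor P^2,
  whose size near the root of unity is not controlled, then cancels on both sides.\<close>

lemma S4_bound:
  assumes q: "norm q < 1" "q \<noteq> 0" and c: "c > 0" "\<And>j. c \<le> norm (1 + q ^ (2 * j + a))" and a: "a \<le> 1"
  shows "norm (S4_one q + (- 1) ^ a * (J 1 q ^ 3 / Jbar 0 1 q ^ 2) + 2 * (\<Sum>n. dual_term q n))
      \<le> 4 * norm (theta_quot (Suc a) q) / (c * (1 - norm q))"
proof -
  define P R d Q where "P = qpoch_inf (- q) q" and "R = qpoch_inf q q"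
    and "d = qpoch_inf q (q\<^sup>2)" and "Q = qpoch_inf (q\<^sup>2) (q\<^sup>2)"
  have nz: "P \<noteq> 0" "R \<noteq> 0" "qpoch_inf (- (q\<^sup>2)) (q\<^sup>2) \<noteq> 0" "d \<noteq> 0" "qpoch_inf (- q) (q\<^sup>2) \<noteq> 0"
    unfolding P_def R_def d_def using q norm_square_lt_1[OF q(1)]
    by (simp_all add: qpoch_inf_nonzero')
  have dP: "d * P = 1"
    unfolding d_def P_def by (rule qpoch_odd_even_eq_1[OF q(1)])
  have R: "R = d * Q"
    unfolding R_def d_def Q_def by (rule qpoch_inf_q_eq[OF q(1)])
  have QdR: "Q / (d * R\<^sup>2) = P\<^sup>2 / R"
  proof -
    have "Q / (d * R\<^sup>2) = (d * P)\<^sup>2 * Q / (d * R\<^sup>2)"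
      by (simp add: dP)
    also have "\<dots> = P\<^sup>2 / R"
      using nz(2,4) unfolding R by (simp add: power2_eq_square)
    finally show ?thesis .
  qed
  have K: "norm (odd_psi_mean q a * qpoch_inf (- (q ^ a)) (q\<^sup>2) / R\<^sup>2) \<le> 2 * norm (P\<^sup>2 * theta_quot (Suc a) q)"
  proof (cases "a = 0")
    case True
    have "qpoch_inf (- 1) (q\<^sup>2) = 2 * qpoch_inf (- (q\<^sup>2)) (q\<^sup>2)"
      by (subst qpoch_inf_rec[OF norm_square_lt_1[OF q(1)]]) simp
    then have "odd_psi_mean q a * qpoch_inf (- (q ^ a)) (q\<^sup>2) / R\<^sup>2 = (qpoch_inf (- q) (q\<^sup>2))\<^sup>2 * (Q / (d * R\<^sup>2))"
      using nz(3) True unfolding True odd_psi_mean_0[OF q] by (simp add: d_def Q_def)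
    then have "odd_psi_mean q a * qpoch_inf (- (q ^ a)) (q\<^sup>2) / R\<^sup>2 = P\<^sup>2 * theta_quot (Suc a) q"
      unfolding QdR by (simp add: theta_quot_def R_def True)
    then show ?thesis
      using norm_ge_zero[of "P\<^sup>2 * theta_quot (Suc a) q"] by simp
  next
    case False
    then have a1: "a = 1"
      using a by simp
    have "odd_psi_mean q a * qpoch_inf (- (q ^ a)) (q\<^sup>2) / R\<^sup>2 = 2 * ((qpoch_inf (- (q\<^sup>2)) (q\<^sup>2))\<^sup>2 * (Q / (d * R\<^sup>2)))"
      using nz(5) unfolding a1 odd_psi_mean_1[OF q] by (simp add: d_def Q_def)
    then show ?thesis
      unfolding QdR by (simp add: theta_quot_def R_def a1 norm_mult norm_divide numeral_2_eq_2 mult_ac)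
  qed
  have t: "J 1 q ^ 3 / Jbar 0 1 q ^ 2 = R / (4 * P ^ 4)"
    unfolding Jbar_0_1[OF q(1)] J_def power_one_right using nz
    by (simp add: R_def[symmetric] P_def[symmetric] power2_eq_square power3_eq_cube power4_eq_xxxx)
  have "theta_sum q (- 1) = 2 * P\<^sup>2 * (R / (4 * P ^ 4))"
    unfolding theta_sum_neg_1[OF q] using nz(1)
    by (simp add: R_def[symmetric] P_def[symmetric] power2_eq_square power4_eq_xxxx)
  moreover have "theta_sum q 1 = 2 * P\<^sup>2 * (S4_one q + 2 * (\<Sum>n. dual_term q n))"
    unfolding theta_sum_1[OF q] by (simp add: P_def algebra_simps)
  ultimately have "theta_sum q 1 + (- 1) ^ a * theta_sum q (- 1) =
      2 * P\<^sup>2 * (S4_one q + (- 1) ^ a * (J 1 q ^ 3 / Jbar 0 1 q ^ 2) + 2 * (\<Sum>n. dual_term q n))"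
    unfolding t by (simp add: algebra_simps)
  then have "norm (2 * P\<^sup>2) * norm (S4_one q + (- 1) ^ a * (J 1 q ^ 3 / Jbar 0 1 q ^ 2) + 2 * (\<Sum>n. dual_term q n))
      = norm (theta_sum q 1 + (- 1) ^ a * theta_sum q (- 1))"
    by (simp only: norm_mult)
  also have "\<dots> \<le> 4 * norm (odd_psi_mean q a * qpoch_inf (- (q ^ a)) (q\<^sup>2) / R\<^sup>2) / c / (1 - norm q)"
    unfolding R_def by (rule theta_sum_bound[OF q c a])
  also have "\<dots> \<le> 4 * (2 * norm (P\<^sup>2 * theta_quot (Suc a) q)) / c / (1 - norm q)"
    using K c(1) q(1) by (intro divide_right_mono mult_left_mono) auto
  also have "\<dots> = norm (2 * P\<^sup>2) * (4 * norm (theta_quot (Suc a) q) / (c * (1 - norm q)))"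
    by (simp add: norm_mult)
  finally show ?thesis
    using nz(1) by (subst (asm) mult_le_cancel_left_pos) auto
qed

text \<open>Jacobi's triple product, as the case \<alpha> = 0 and \<beta> = -z of
  \<open>bilateral_q_binomial\<close>.\<close>

lemma theta_series:
  fixes p z :: complex and u :: "int \<Rightarrow> complex"
  assumes p: "norm p < 1" "p \<noteq> 0" and z: "z \<noteq> 0"
    and u: "u 0 = 1" "\<And>n. u (n + 1) = u n * (z * p powi n)"
  shows "(\<lambda>n. norm (u n)) summable_on UNIV"
    and "(u has_sum (qpoch_inf p p * qpoch_inf (- z) p * qpoch_inf (- (p / z)) p)) UNIV"
proof -
  have "u (n + 1) = u n * (0 - (- z) * p powi n)" for n
    using u(2) by simp
  note * = bilateral_q_binomial[OF p _ _ u(1) this]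
  show "(\<lambda>n. norm (u n)) summable_on UNIV"
    by (rule *(1)) (use z in auto)
  have "(u has_sum (qpoch_inf p p * qpoch_inf (- z) p * qpoch_inf (p / - z) p /
           (qpoch_inf 0 p * qpoch_inf (0 * p / - z) p))) UNIV"
    by (rule *(2)) (use z in auto)
  then show "(u has_sum (qpoch_inf p p * qpoch_inf (- z) p * qpoch_inf (- (p / z)) p)) UNIV"
    by simp
qed

lemma quadratic_theta_series:
  fixes q s :: complex and m l :: nat
  assumes q: "norm q < 1" "q \<noteq> 0" and s: "s\<^sup>2 = 1" and m: "m > 0" "l \<le> m"
  defines "u \<equiv> \<lambda>n::int. s powi n * q powi (int m * (n * n) + int l * n)"
  shows "(\<lambda>n. norm (u n)) summable_on UNIV"
    and "(u has_sum (qpoch_inf (q ^ (2 * m)) (q ^ (2 * m)) * qpoch_inf (- (s * q ^ (m + l))) (q ^ (2 * m)) *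
      qpoch_inf (- (s * q ^ (m - l))) (q ^ (2 * m)))) UNIV"
proof -
  define p z where "p = q ^ (2 * m)" and "z = s * q ^ (m + l)"
  have s0: "s \<noteq> 0" "1 / s = s"
    using s by (auto simp: power2_eq_square divide_simps)
  have p: "norm p < 1" "p \<noteq> 0" and z: "z \<noteq> 0"
    using q s0(1) m power_less_one_iff[of "norm q" "2 * m"] by (auto simp: p_def z_def norm_power)
  have rec: "u (n + 1) = u n * (z * p powi n)" for n
  proof -
    have "int m * ((n + 1) * (n + 1)) + int l * (n + 1) = (int m * (n * n) + int l * n) + (int (m + l) + int (2 * m) * n)"
      by (simp add: algebra_simps)
    then have "q powi (int m * ((n + 1) * (n + 1)) + int l * (n + 1)) =
        q powi (int m * (n * n) + int l * n) * (q powi int (m + l) * q powi (int (2 * m) * n))"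
      using q(2) by (simp only: power_int_add) (simp add: power_int_add)
    moreover have "q powi (int (2 * m) * n) = p powi n"
      unfolding p_def power_int_mult power_int_of_nat ..
    moreover have "s powi (n + 1) = s powi n * s"
      using s0(1) by (simp add: power_int_add)
    ultimately show ?thesis
      unfolding u_def z_def power_int_of_nat by (simp add: mult_ac)
  qed
  have u0: "u 0 = 1"
    by (simp add: u_def)
  show "(\<lambda>n. norm (u n)) summable_on UNIV"
    by (rule theta_series(1)[OF p z u0 rec])
  have "q ^ (2 * m) = q ^ (m - l) * q ^ (m + l)"
    using m(2) by (simp add: mult_2 flip: power_add)
  then have "p / z = s * q ^ (m - l)"
    using q(2) s0 by (simp add: p_def z_def field_simps)
  then show "(u has_sum (qpoch_inf (q ^ (2 * m)) (q ^ (2 * m)) * qpoch_inf (- (s * q ^ (m + l))) (q ^ (2 * m)) *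
      qpoch_inf (- (s * q ^ (m - l))) (q ^ (2 * m)))) UNIV"
    using theta_series(2)[OF p z u0 rec] by (simp add: p_def z_def)
qed

text \<open>Here f and g are the terms of theta_3(q) and theta_4(q), h those of theta_3(q^2), and k
  those of theta_2(q^2) without the factor q^(1/2). Writing pairs of even coordinate sum as (x+y,
  x-y) and the others as (x+y+1, x-y) evaluates the sum and the difference of the squares of theta_3
  and theta_4; multiplying the two gives the fourth powers.\<close>

lemma jacobi_quartic:
  assumes q: "norm q < 1" "q \<noteq> 0"
  shows "qpoch_inf (- q) (q\<^sup>2) ^ 8 - qpoch_inf q (q\<^sup>2) ^ 8 = 16 * q * qpoch_inf (- (q\<^sup>2)) (q\<^sup>2) ^ 8"
proof -
  define a b d Q where "a = qpoch_inf (- q) (q\<^sup>2)" and "b = qpoch_inf (- (q\<^sup>2)) (q\<^sup>2)"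
    and "d = qpoch_inf q (q\<^sup>2)" and "Q = qpoch_inf (q\<^sup>2) (q\<^sup>2)"
  have q2: "norm (q\<^sup>2) < 1" "q\<^sup>2 \<noteq> 0" and q4: "norm (q ^ 4) < 1"
    using norm_square_lt_1[OF q(1)] norm_square_lt_1[OF norm_square_lt_1[OF q(1)]] q(2)
    by (simp_all flip: power_mult)
  have add: "q powi m * q powi n = q powi (m + n)" for m n
    using q(2) by (simp add: power_int_add)
  define f where "f n = q powi (n * n)" for n :: int
  define g where "g n = (- 1) powi n * f n" for n :: int
  define h where "h n = q powi (2 * (n * n))" for n :: int
  define k where "k n = q powi (2 * (n * n) + 2 * n)" for n :: int
  define A where "A = (qpoch_inf (- (q\<^sup>2)) (q ^ 4))\<^sup>2 * qpoch_inf (q ^ 4) (q ^ 4)"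
  define B where "B = 2 * (qpoch_inf (- (q ^ 4)) (q ^ 4))\<^sup>2 * qpoch_inf (q ^ 4) (q ^ 4)"
  have f: "(\<lambda>n. norm (f n)) summable_on UNIV" "(f has_sum (a\<^sup>2 * Q)) UNIV"
    using quadratic_theta_series[OF q, of 1 1 0]
    by (simp_all add: f_def[abs_def] a_def Q_def power2_eq_square mult_ac)
  have g: "(\<lambda>n. norm (g n)) summable_on UNIV" "(g has_sum (d\<^sup>2 * Q)) UNIV"
    using quadratic_theta_series[OF q, of "- 1" 1 0]
    by (simp_all add: g_def[abs_def] f_def d_def Q_def power2_eq_square mult_ac)
  have h: "(\<lambda>n. norm (h n)) summable_on UNIV" "(h has_sum A) UNIV"
    using quadratic_theta_series[OF q, of 1 2 0]
    by (simp_all add: h_def[abs_def] A_def power2_eq_square[of "qpoch_inf x p" for x p] mult_ac)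
  have "qpoch_inf (- 1) (q ^ 4) = 2 * qpoch_inf (- (q ^ 4)) (q ^ 4)"
    by (subst qpoch_inf_rec[OF q4]) simp
  then have k: "(\<lambda>n. norm (k n)) summable_on UNIV" "(k has_sum B) UNIV"
    using quadratic_theta_series[OF q, of 1 2 2]
    by (simp_all add: k_def[abs_def] B_def power2_eq_square[of "qpoch_inf x p" for x p] mult_ac)
  have f2: "((\<lambda>(m, n). f m * f n) has_sum (a\<^sup>2 * Q)\<^sup>2) UNIV"
    and g2: "((\<lambda>(m, n). g m * g n) has_sum (d\<^sup>2 * Q)\<^sup>2) UNIV"
    and h2: "((\<lambda>(m, n). h m * h n) has_sum A\<^sup>2) UNIV"
    and k2: "((\<lambda>(m, n). k m * k n) has_sum B\<^sup>2) UNIV"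
    using has_sum_square[OF f] has_sum_square[OF g] has_sum_square[OF h] has_sum_square[OF k] by simp_all
  have gg: "g m * g n = (if even (m + n) then 1 else - 1) * (f m * f n)" for m n
    by (auto simp: g_def power_int_minus_left)
  have even: "(a\<^sup>2 * Q)\<^sup>2 + (d\<^sup>2 * Q)\<^sup>2 = 2 * A\<^sup>2"
  proof -
    define s where "s p = (case p of (x, y) \<Rightarrow> (x + y, x - y))" for p :: "int \<times> int"
    have inj: "inj s"
      by (auto simp: inj_def s_def)
    have hs: "((\<lambda>p. (case p of (m, n) \<Rightarrow> f m * f n) + (case p of (m, n) \<Rightarrow> g m * g n)) has_sum
        ((a\<^sup>2 * Q)\<^sup>2 + (d\<^sup>2 * Q)\<^sup>2)) UNIV" (is "(?w has_sum _) _")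
      by (rule has_sum_add[OF f2 g2])
    have zero: "?w p = 0" if "p \<notin> range s" for p
    proof (cases p)
      case (Pair m n)
      have "odd (m + n)"
      proof
        assume "even (m + n)"
        then obtain x where x: "m + n = 2 * x"
          by (elim evenE)
        then have "p = s (x, m - x)"
          by (simp add: Pair s_def)
        with that show False
          by blast
      qed
      then show ?thesis
        by (simp add: Pair gg)
    qed
    have "(?w has_sum ((a\<^sup>2 * Q)\<^sup>2 + (d\<^sup>2 * Q)\<^sup>2)) (range s)"
      by (subst has_sum_cong_neutral[where T = UNIV and g = ?w]) (use zero hs in auto)
    then have ws: "((?w \<circ> s) has_sum ((a\<^sup>2 * Q)\<^sup>2 + (d\<^sup>2 * Q)\<^sup>2)) UNIV"
      by (subst (asm) has_sum_reindex[OF inj])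
    have eq: "?w \<circ> s = (\<lambda>p. 2 * (case p of (x, y) \<Rightarrow> h x * h y))"
    proof
      fix p :: "int \<times> int"
      obtain x y where p: "p = (x, y)"
        by fastforce
      have "(x + y) * (x + y) + (x - y) * (x - y) = 2 * (x * x) + 2 * (y * y)"
        by (simp add: algebra_simps)
      then have "f (x + y) * f (x - y) = h x * h y"
        by (simp only: f_def h_def add)
      then show "(?w \<circ> s) p = 2 * (case p of (x, y) \<Rightarrow> h x * h y)"
        by (simp add: p s_def gg)
    qed
    show ?thesis
      by (rule has_sum_unique[OF ws[unfolded eq] has_sum_cmult_right[OF h2]])
  qed
  have odd: "(a\<^sup>2 * Q)\<^sup>2 - (d\<^sup>2 * Q)\<^sup>2 = 2 * q * B\<^sup>2"
  proof -
    define s where "s p = (case p of (x, y) \<Rightarrow> (x + y + 1, x - y))" for p :: "int \<times> int"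
    have inj: "inj s"
      by (auto simp: inj_def s_def)
    have "((\<lambda>p. - (case p of (m, n) \<Rightarrow> g m * g n)) has_sum - (d\<^sup>2 * Q)\<^sup>2) UNIV"
      using g2 by (rule has_sum_uminusI)
    from has_sum_add[OF f2 this]
    have hs: "((\<lambda>p. (case p of (m, n) \<Rightarrow> f m * f n) + - (case p of (m, n) \<Rightarrow> g m * g n)) has_sum
        ((a\<^sup>2 * Q)\<^sup>2 + - (d\<^sup>2 * Q)\<^sup>2)) UNIV" (is "(?w has_sum _) _") .
    have zero: "?w p = 0" if "p \<notin> range s" for p
    proof (cases p)
      case (Pair m n)
      have "even (m + n)"
      proof (rule ccontr)
        assume "odd (m + n)"
        then obtain x where x: "m + n = 2 * x + 1"
          by (elim oddE)
        then have "p = s (x, m - x - 1)"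
          by (simp add: Pair s_def)
        with that show False
          by blast
      qed
      then show ?thesis
        by (simp add: Pair gg)
    qed
    have "(?w has_sum ((a\<^sup>2 * Q)\<^sup>2 + - (d\<^sup>2 * Q)\<^sup>2)) (range s)"
      by (subst has_sum_cong_neutral[where T = UNIV and g = ?w]) (use zero hs in auto)
    then have ws: "((?w \<circ> s) has_sum ((a\<^sup>2 * Q)\<^sup>2 + - (d\<^sup>2 * Q)\<^sup>2)) UNIV"
      by (subst (asm) has_sum_reindex[OF inj])
    have eq: "?w \<circ> s = (\<lambda>p. 2 * q * (case p of (x, y) \<Rightarrow> k x * k y))"
    proof
      fix p :: "int \<times> int"
      obtain x y where p: "p = (x, y)"
        by fastforce
      have "(x + y + 1) * (x + y + 1) + (x - y) * (x - y) = 1 + ((2 * (x * x) + 2 * x) + (2 * (y * y) + 2 * y))"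
        by (simp add: algebra_simps)
      then have "f (x + y + 1) * f (x - y) = q powi 1 * (k x * k y)"
        by (simp only: f_def k_def add)
      moreover have "odd (x + y + 1 + (x - y))"
        by simp
      then have "g (x + y + 1) * g (x - y) = - (f (x + y + 1) * f (x - y))"
        unfolding gg by (subst if_not_P) simp_all
      ultimately show "(?w \<circ> s) p = 2 * q * (case p of (x, y) \<Rightarrow> k x * k y)"
        by (simp add: p s_def)
    qed
    show ?thesis
      using has_sum_unique[OF ws[unfolded eq] has_sum_cmult_right[OF k2]] by simp
  qed
  have b: "b = qpoch_inf (- (q\<^sup>2)) (q ^ 4) * qpoch_inf (- (q ^ 4)) (q ^ 4)"
    using qpoch_inf_base_square[OF q2(1), of "- (q\<^sup>2)"]
    by (simp add: b_def power_mult[symmetric] power2_eq_square[of q] power4_eq_xxxx mult.assoc)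
       (simp add: power2_eq_square power4_eq_xxxx mult.assoc)
  have Q4: "qpoch_inf (q ^ 4) (q ^ 4) = Q * b"
    using qpoch_inf_mult_neg[OF q2(1), of "q\<^sup>2"] by (simp add: Q_def b_def flip: power_mult)
  \<comment> \<open>The duplication formula 2 theta_2(q^2) theta_3(q^2) = theta_2(q)^2 in product
    form, which brings the result back to products in base q^2.\<close>
  have AB: "A * B = 2 * Q\<^sup>2 * b ^ 4"
  proof -
    have "A * B = 2 * (qpoch_inf (- (q\<^sup>2)) (q ^ 4) * qpoch_inf (- (q ^ 4)) (q ^ 4))\<^sup>2 * (Q * b)\<^sup>2"
      by (simp add: A_def B_def Q4 power2_eq_square mult_ac)
    also have "\<dots> = 2 * Q\<^sup>2 * b ^ 4"
      unfolding b[symmetric] by (simp add: power2_eq_square power4_eq_xxxx mult_ac)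
    finally show ?thesis .
  qed
  have Q: "Q \<noteq> 0"
    unfolding Q_def by (rule qpoch_inf_nonzero'[OF q2(1) q2(1)])
  have "(a ^ 8 - d ^ 8) * Q ^ 4 = ((a\<^sup>2 * Q)\<^sup>2 + (d\<^sup>2 * Q)\<^sup>2) * ((a\<^sup>2 * Q)\<^sup>2 - (d\<^sup>2 * Q)\<^sup>2)"
    by (simp add: algebra_simps power_mult_distrib power_add[symmetric] flip: power_mult)
  also have "\<dots> = 4 * q * (A * B)\<^sup>2"
    unfolding even odd by (simp add: power2_eq_square mult_ac)
  also have "\<dots> = (16 * q * b ^ 8) * Q ^ 4"
    unfolding AB by (simp add: power_mult_distrib flip: power_mult)
  finally show ?thesis
    using Q by (simp add: a_def b_def d_def)
qed

lemma theta_quartic_even: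
  assumes q: "norm q < 1" "q \<noteq> 0"
  shows "Jbar 1 2 q ^ 4 / (2 * J 1 q ^ 3) = theta_quot 1 q ^ 4 * qpoch_inf q q * qpoch_inf (q\<^sup>2) (q\<^sup>2) ^ 4 / 2"
proof -
  define R where "R = qpoch_inf q q"
  have R: "R \<noteq> 0"
    unfolding R_def by (rule qpoch_inf_nonzero'[OF q(1) q(1)])
  have "q\<^sup>2 / (- q) = - q"
    using q by (simp add: power2_eq_square)
  then have "Jbar 1 2 q = (qpoch_inf (- q) (q\<^sup>2))\<^sup>2 * qpoch_inf (q\<^sup>2) (q\<^sup>2)"
    by (simp add: Jbar_def theta_def power2_eq_square[of "qpoch_inf (- q) (q\<^sup>2)"])
  then show ?thesis
    using R by (simp add: theta_quot_def J_def R_def[symmetric] power_mult_distrib power_divide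
        power4_eq_xxxx power3_eq_cube power2_eq_square mult_ac)
qed

text \<open>Both quotients are written over R^3: by \<open>d * P = 1\<close> and
  \<open>R = d * Q\<close> the first is d^8 Q^4 / (4 R^3), and the second is a^8 Q^4 / (2 R^3).
  Doubling the first matches the denominators and leaves the two eighth powers of Jacobi's
  identity.\<close>

lemma theta_quartic_odd:
  assumes q: "norm q < 1" "q \<noteq> 0"
  shows "2 * (J 1 q ^ 3 / Jbar 0 1 q ^ 2) - Jbar 1 2 q ^ 4 / (2 * J 1 q ^ 3) =
      - 8 * q * (theta_quot 2 q ^ 4 * qpoch_inf q q * qpoch_inf (q\<^sup>2) (q\<^sup>2) ^ 4)"
proof -
  define P R a b d Q where "P = qpoch_inf (- q) q" and "R = qpoch_inf q q"
    and "a = qpoch_inf (- q) (q\<^sup>2)" and "b = qpoch_inf (- (q\<^sup>2)) (q\<^sup>2)"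
    and "d = qpoch_inf q (q\<^sup>2)" and "Q = qpoch_inf (q\<^sup>2) (q\<^sup>2)"
  have nz: "P \<noteq> 0" "R \<noteq> 0"
    unfolding P_def R_def using q by (simp_all add: qpoch_inf_nonzero')
  have dP: "d * P = 1"
    unfolding d_def P_def by (rule qpoch_odd_even_eq_1[OF q(1)])
  have R: "R = d * Q"
    unfolding R_def d_def Q_def by (rule qpoch_inf_q_eq[OF q(1)])
  have "J 1 q ^ 3 / Jbar 0 1 q ^ 2 = R / (4 * P ^ 4)"
    unfolding Jbar_0_1[OF q(1)] J_def power_one_right using nz
    by (simp add: R_def[symmetric] P_def[symmetric] power2_eq_square power3_eq_cube power4_eq_xxxx)
  also have "\<dots> = R * (d * P) ^ 4 / (4 * P ^ 4)"
    by (simp add: dP)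
  also have "\<dots> = d ^ 8 * Q ^ 4 / (4 * R ^ 3)"
  proof -
    have "R * (d * P) ^ 4 / (4 * P ^ 4) = R * d ^ 4 / 4"
      using nz by (simp add: power_mult_distrib)
    also have "\<dots> = R ^ 4 * d ^ 4 / (4 * R ^ 3)"
      using nz by (simp add: power4_eq_xxxx power3_eq_cube)
    also have "R ^ 4 * d ^ 4 = d ^ 8 * Q ^ 4"
      unfolding R by (simp add: power_mult_distrib power_add[symmetric] mult_ac)
    finally show ?thesis .
  qed
  finally have "2 * (J 1 q ^ 3 / Jbar 0 1 q ^ 2) = d ^ 8 * Q ^ 4 / (2 * R ^ 3)"
    by simp
  moreover have "Jbar 1 2 q ^ 4 / (2 * J 1 q ^ 3) = a ^ 8 * Q ^ 4 / (2 * R ^ 3)"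
  proof -
    have "(a\<^sup>2 / R) ^ 4 * R = a ^ 8 / R ^ 3"
      using nz by (simp add: power_divide power4_eq_xxxx[of R] power3_eq_cube flip: power_mult)
    then show ?thesis
      unfolding theta_quartic_even[OF q] theta_quot_def power_one_right
      by (simp add: R_def[symmetric] a_def[symmetric] Q_def[symmetric])
  qed
  ultimately have "2 * (J 1 q ^ 3 / Jbar 0 1 q ^ 2) - Jbar 1 2 q ^ 4 / (2 * J 1 q ^ 3) = - ((a ^ 8 - d ^ 8) * Q ^ 4 / (2 * R ^ 3))"
    by (simp add: diff_divide_distrib left_diff_distrib)
  also have "a ^ 8 - d ^ 8 = 16 * q * b ^ 8"
    unfolding a_def b_def d_def by (rule jacobi_quartic[OF q])
  also have "- (16 * q * b ^ 8 * Q ^ 4 / (2 * R ^ 3)) = - 8 * q * ((b\<^sup>2 / R) ^ 4 * R * Q ^ 4)"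
  proof -
    have "(b\<^sup>2 / R) ^ 4 * R = b ^ 8 / R ^ 3"
      using nz by (simp add: power_divide power4_eq_xxxx[of R] power3_eq_cube flip: power_mult)
    then show ?thesis
      by simp
  qed
  finally show ?thesis
    by (simp add: theta_quot_def b_def R_def Q_def)
qed

subsection \<open>Growth near a root of unity of even order\<close>

lemma ln_norm_one_minus_sums:
  fixes w :: complex
  assumes "norm w < 1"
  shows "(\<lambda>l. - Re (w ^ Suc l) / real (Suc l)) sums ln (norm (1 - w))"
proof -
  have "(\<lambda>n. - ((- (- w)) ^ n) / of_nat n) sums ln (1 + (- w))"
    by (rule Ln_series') (use assms in simp)
  then have "(\<lambda>l. - (w ^ Suc l) / of_nat (Suc l)) sums ln (1 - w)"
    by (subst sums_Suc_iff) simp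
  then have "(\<lambda>l. Re (- (w ^ Suc l) / of_nat (Suc l))) sums Re (ln (1 - w))"
    by (rule sums_Re)
  moreover have "Re (- (w ^ Suc l) / of_nat (Suc l)) = - Re (w ^ Suc l) / real (Suc l)" for l
    by (metis Re_divide_of_nat uminus_complex.sel(1))
  moreover have "Re (ln (1 - w)) = ln (norm (1 - w))"
    using assms by (intro Re_Ln) auto
  ultimately show ?thesis
    by (simp only:)
qed

text \<open>Each factor is expanded by the logarithmic series, and the l-th powers of the n factors
  add up to a geometric sum. Keeping the products finite avoids exchanging two infinite sums; the
  later estimates are uniform in n.\<close>

lemma ln_norm_qpoch_sums:
  fixes x p :: complex
  assumes x: "norm x < 1" and p: "norm p < 1"
  shows "(\<lambda>l. - Re (x ^ Suc l * ((1 - (p ^ Suc l) ^ n) / (1 - p ^ Suc l))) / real (Suc l))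
      sums ln (norm (qpoch x p n))"
proof (induction n)
  case (Suc n)
  have xp: "norm (x * p ^ n) < 1"
    using x p by (intro norm_mult_lt_1) (auto simp: norm_power power_le_one)
  have nz: "qpoch x p n \<noteq> 0" "1 - x * p ^ n \<noteq> 0"
    using qpoch_nonzero'[OF p x] mult_power_neq_1[OF p x, of n] by auto
  have e: "- Re (x ^ Suc l * ((1 - (p ^ Suc l) ^ n) / (1 - p ^ Suc l))) / real (Suc l) +
      - Re ((x * p ^ n) ^ Suc l) / real (Suc l) =
      - Re (x ^ Suc l * ((1 - (p ^ Suc l) ^ Suc n) / (1 - p ^ Suc l))) / real (Suc l)" for l
  proof -
    define E where "E = p ^ Suc l"
    have E: "1 - E \<noteq> 0"
      using mult_power_neq_1[OF p p, of l] by (simp add: E_def)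
    have "(x * p ^ n) ^ Suc l = x ^ Suc l * E ^ n"
      unfolding power_mult_distrib E_def by (simp only: power_mult[symmetric] mult.commute[of n])
    moreover have "(1 - E ^ Suc n) / (1 - E) = (1 - E ^ n) / (1 - E) + E ^ n"
      using E by (simp add: field_simps)
    ultimately have "Re (x ^ Suc l * ((1 - E ^ Suc n) / (1 - E))) =
        Re (x ^ Suc l * ((1 - E ^ n) / (1 - E))) + Re ((x * p ^ n) ^ Suc l)"
      by (simp only: distrib_left plus_complex.sel)
    then show ?thesis
      unfolding E_def[symmetric] by (simp only: minus_add_distrib add_divide_distrib)
  qed
  have "ln (norm (qpoch x p (Suc n))) = ln (norm (qpoch x p n)) + ln (norm (1 - x * p ^ n))"
    using nz by (simp add: qpoch_Suc norm_mult ln_mult)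
  then show ?case
    using sums_add[OF Suc.IH ln_norm_one_minus_sums[OF xp]] unfolding e by simp
qed simp

text \<open>The majorant C r^l / l sums to -C ln (1 - r), which becomes a power of 1 - r. The
  distinguished index \<open>l0\<close> allows an additional gain D.\<close>

lemma exp_sums_bound:
  fixes h :: "nat \<Rightarrow> real"
  assumes h: "h sums H" and r: "0 \<le> r" "r < 1"
    and bd: "\<And>l. h l \<le> C * (r ^ Suc l / real (Suc l)) - (if l = l0 then D else 0)"
  shows "exp H \<le> (1 - r) powr (- C) * exp (- D)"
proof -
  have "(\<lambda>l. - Re (complex_of_real r ^ Suc l) / real (Suc l)) sums ln (norm (1 - complex_of_real r))"
    by (rule ln_norm_one_minus_sums) (use r in simp)
  moreover have "norm (1 - complex_of_real r) = 1 - r"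
    using r by (metis abs_of_pos diff_gt_0_iff_gt norm_of_real of_real_1 of_real_diff)
  moreover have "Re (complex_of_real r ^ Suc l) = r ^ Suc l" for l
    by (metis Re_complex_of_real of_real_power)
  ultimately have "(\<lambda>l. - (r ^ Suc l) / real (Suc l)) sums ln (1 - r)"
    by simp
  from sums_mult[OF this, of "- C"]
  have "(\<lambda>l. C * (r ^ Suc l / real (Suc l))) sums (- C * ln (1 - r))"
    by simp
  moreover have "(\<lambda>l. if l = l0 then D else 0) sums D"
    using sums_single[of l0 "\<lambda>_. D"] by simp
  ultimately have "(\<lambda>l. C * (r ^ Suc l / real (Suc l)) - (if l = l0 then D else 0)) sums (- C * ln (1 - r) - D)"
    by (rule sums_diff)
  then have "H \<le> - C * ln (1 - r) - D"
    using sums_le[OF bd h] by blast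
  then have "exp H \<le> exp (- C * ln (1 - r) + - D)"
    by simp
  also have "\<dots> = (1 - r) powr (- C) * exp (- D)"
    unfolding exp_add using r by (simp add: powr_def)
  finally show ?thesis .
qed

text \<open>The powers of \<zeta> form a finite set, so 1 is separated from the other powers by some
  2c. The factor 2 is spent in \<open>gap_radial\<close>, where half of the gap survives at radial
  points.\<close>

locale even_root =
  fixes k :: nat and \<zeta> :: complex and c :: real
  assumes k: "k \<ge> 1" and half: "\<zeta> ^ k = - 1" and eq_1_iff: "\<zeta> ^ L = 1 \<longleftrightarrow> 2 * k dvd L"
    and c: "0 < c" "c \<le> 1" and gap: "\<zeta> ^ L \<noteq> 1 \<Longrightarrow> 2 * c \<le> norm (1 - \<zeta> ^ L)"
begin

lemma norm_root: "norm \<zeta> = 1"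
proof -
  have "norm \<zeta> ^ k = 1 ^ k"
    unfolding norm_power[symmetric] half by simp
  then show ?thesis
    by (rule power_eq_imp_eq_base) (use k in auto)
qed

text \<open>The radial displacement 1 - t is itself at most |1 - t \<zeta>^L|, so the triangle
  inequality loses only a factor 2.\<close>

lemma gap_radial:
  assumes "0 \<le> t" "t \<le> 1" "\<zeta> ^ L \<noteq> 1"
  shows "c \<le> norm (1 - of_real t * \<zeta> ^ L)"
proof -
  have n: "norm (\<zeta> ^ L) = 1"
    by (simp add: norm_power norm_root)
  have "norm (1 - \<zeta> ^ L) \<le> norm (1 - of_real t * \<zeta> ^ L) + norm (of_real t * \<zeta> ^ L - \<zeta> ^ L)"
    by (metis diff_add_cancel add_diff_eq norm_triangle_ineq)
  also have "of_real t * \<zeta> ^ L - \<zeta> ^ L = - of_real (1 - t) * \<zeta> ^ L"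
    by (simp add: algebra_simps)
  also have "norm (- of_real (1 - t) * \<zeta> ^ L) = 1 - t"
    using assms n by (simp add: norm_mult del: of_real_diff)
  also have "1 - t \<le> norm (1 - of_real t * \<zeta> ^ L)"
    using norm_triangle_ineq2[of 1 "of_real t * \<zeta> ^ L"] assms n by (simp add: norm_mult)
  finally show ?thesis
    using gap[OF assms(3)] by simp
qed

lemma square_eq_1_iff: "\<zeta> ^ (2 * L) = 1 \<longleftrightarrow> k dvd L"
  unfolding eq_1_iff by simp

lemma root_power_cases:
  assumes "k dvd L"
  shows "\<zeta> ^ L = 1 \<or> \<zeta> ^ L = - 1"
  using assms unfolding square_eq_1_iff[symmetric] by (simp add: power_mult power2_eq_1_iff mult.commute)

definition pt :: "real \<Rightarrow> complex" where
  "pt r = of_real r * \<zeta>"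

lemma pt_power: "pt r ^ L = of_real (r ^ L) * \<zeta> ^ L"
  by (simp add: pt_def power_mult_distrib)

lemma norm_pt:
  assumes "0 < r"
  shows "norm (pt r) = r"
  using assms by (simp add: pt_def norm_mult norm_root)

lemma pt_nonzero: "0 < r \<Longrightarrow> pt r \<noteq> 0"
  using norm_pt by fastforce

lemma geometric_quotient_bound:
  assumes "0 < r" "r < 1" "\<zeta> ^ L \<noteq> 1"
  shows "norm ((1 - (pt r ^ L) ^ n) / (1 - pt r ^ L)) \<le> 2 / c"
proof -
  have "norm (pt r ^ L) \<le> 1"
    using assms by (simp add: norm_power norm_pt power_le_one)
  then have "norm ((pt r ^ L) ^ n) \<le> 1"
    by (simp add: norm_power power_le_one)
  then have "norm (1 - (pt r ^ L) ^ n) \<le> 2"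
    using norm_triangle_ineq4[of 1 "(pt r ^ L) ^ n"] by simp
  moreover have "c \<le> norm (1 - pt r ^ L)"
    unfolding pt_power using assms by (intro gap_radial) (auto simp: power_le_one)
  ultimately show ?thesis
    using c unfolding norm_divide by (intro frac_le) auto
qed

text \<open>Indices with \<zeta>^L = 1, where the denominator 1 - x^l degenerates, contribute a
  nonpositive amount to the logarithm of the norm and may be dropped. The remaining ones are
  controlled by the gap. No gain is claimed here, so D = 0.\<close>

lemma qpoch_polynomial_bound:
  assumes r: "0 < r" "r < 1" and a: "a > 0"
  shows "norm (qpoch (pt r ^ a) (pt r ^ a) n) \<le> (1 - r) powr (- (8 / c))"
proof -
  define x where "x = pt r ^ a"
  have x: "norm x < 1"
    using r a by (simp add: x_def norm_power norm_pt power_less_one_iff)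
  define h where "h l = - Re (x ^ Suc l * ((1 - (x ^ Suc l) ^ n) / (1 - x ^ Suc l))) / real (Suc l)" for l
  have h: "h sums ln (norm (qpoch x x n))"
    unfolding h_def by (rule ln_norm_qpoch_sums[OF x x])
  have bd: "h l \<le> 8 / c * (r ^ Suc l / real (Suc l)) - (if l = 0 then 0 else 0)" for l
  proof -
    define L where "L = a * Suc l"
    define t where "t = r ^ L"
    have "1 * Suc l \<le> a * Suc l"
      using a by (intro mult_le_mono) auto
    then have t: "0 \<le> t" "t < 1" "t \<le> r ^ Suc l"
      using r a power_decreasing[of "Suc l" L r] by (auto simp: t_def L_def power_less_one_iff simp del: power_Suc)
    have xL: "x ^ Suc l = pt r ^ L"
      by (simp only: x_def L_def power_mult)
    have "- Re (x ^ Suc l * ((1 - (x ^ Suc l) ^ n) / (1 - x ^ Suc l))) \<le> 8 / c * r ^ Suc l"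
    proof (cases "\<zeta> ^ L = 1")
      case True
      then have "x ^ Suc l = of_real t"
        by (simp add: xL pt_power t_def del: power_Suc)
      then have "x ^ Suc l * ((1 - (x ^ Suc l) ^ n) / (1 - x ^ Suc l)) = of_real (t * ((1 - t ^ n) / (1 - t)))"
        by simp
      then have "Re (x ^ Suc l * ((1 - (x ^ Suc l) ^ n) / (1 - x ^ Suc l))) = t * ((1 - t ^ n) / (1 - t))"
        by (metis Re_complex_of_real)
      moreover have "0 \<le> t * ((1 - t ^ n) / (1 - t))"
        using t by (simp add: power_le_one)
      moreover have "0 \<le> 8 / c * r ^ Suc l"
        using c r by (intro mult_nonneg_nonneg) auto
      ultimately show ?thesis
        by linarith
    next
      case False
      have "norm (x ^ Suc l * ((1 - (x ^ Suc l) ^ n) / (1 - x ^ Suc l))) \<le> t * (2 / c)"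
        unfolding norm_mult xL using geometric_quotient_bound[OF r False, of n] t
        by (intro mult_mono) (auto simp: norm_power norm_pt r t_def)
      also have "\<dots> \<le> r ^ Suc l * (8 / c)"
        using t c by (intro mult_mono divide_right_mono) auto
      finally show ?thesis
        using abs_Re_le_cmod[of "x ^ Suc l * ((1 - (x ^ Suc l) ^ n) / (1 - x ^ Suc l))"] by (simp add: mult.commute)
    qed
    from divide_right_mono[OF this, of "real (Suc l)"] show ?thesis
      by (simp add: h_def del: power_Suc)
  qed
  have "exp (ln (norm (qpoch x x n))) \<le> (1 - r) powr (- (8 / c)) * exp (- 0)"
    by (rule exp_sums_bound[OF h _ r(2) bd]) (use r in auto)
  then show ?thesis
    using qpoch_nonzero'[OF x x] by (simp add: x_def)
qed

lemma qpoch_inf_polynomial_bound: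
  assumes r: "0 < r" "r < 1" and a: "a > 0"
  shows "norm (qpoch_inf (pt r ^ a) (pt r ^ a)) \<le> (1 - r) powr (- (8 / c))"
proof (rule LIMSEQ_le_const2)
  have "norm (pt r ^ a) < 1"
    using r a by (simp add: norm_power norm_pt power_less_one_iff)
  then show "(\<lambda>n. norm (qpoch (pt r ^ a) (pt r ^ a) n)) \<longlonglongrightarrow> norm (qpoch_inf (pt r ^ a) (pt r ^ a))"
    by (intro tendsto_norm qpoch_tendsto)
qed (use qpoch_polynomial_bound[OF r a] in blast)

text \<open>Only indices L divisible by k are dangerous, as there e^2 = q^(2L) tends to 1 radially.
  With y = |e|, the combined numerator is at most y - y^2 if \<zeta>^L = 1, which cancels the pole,
  and it is negative if \<zeta>^L = -1. The index L = k is of the second kind and is kept as the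
  gain.\<close>

lemma theta_quot_finite_bound:
  assumes r: "0 < r" "r < 1" and a: "a = 1 \<or> a = 2" and par: "even (k + a)"
  shows "norm ((qpoch (- (pt r ^ a)) ((pt r)\<^sup>2) n)\<^sup>2 / qpoch (pt r) (pt r) (2 * n)) \<le>
      (1 - r) powr (- (8 / c)) * exp (- (r ^ k * ((1 - (r ^ k) ^ (2 * n)) / (1 - r ^ k)) / real k))"
proof -
  define q where "q = pt r"
  have q: "norm q < 1" "q \<noteq> 0"
    using r by (simp_all add: q_def norm_pt pt_nonzero)
  define x where "x = - (q ^ a)"
  have x: "norm x < 1"
    using q a by (auto simp: x_def norm_square_lt_1)
  define D where "D = r ^ k * ((1 - (r ^ k) ^ (2 * n)) / (1 - r ^ k)) / real k"
  define h1 where "h1 l = - Re (x ^ Suc l * ((1 - ((q\<^sup>2) ^ Suc l) ^ n) / (1 - (q\<^sup>2) ^ Suc l))) / real (Suc l)" for l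
  define h2 where "h2 l = - Re (q ^ Suc l * ((1 - (q ^ Suc l) ^ (2 * n)) / (1 - q ^ Suc l))) / real (Suc l)" for l
  have h1: "h1 sums ln (norm (qpoch x (q\<^sup>2) n))"
    unfolding h1_def by (rule ln_norm_qpoch_sums[OF x norm_square_lt_1[OF q(1)]])
  have h2: "h2 sums ln (norm (qpoch q q (2 * n)))"
    unfolding h2_def by (rule ln_norm_qpoch_sums[OF q(1) q(1)])
  have h: "(\<lambda>l. 2 * h1 l - h2 l) sums (2 * ln (norm (qpoch x (q\<^sup>2) n)) - ln (norm (qpoch q q (2 * n))))"
    by (intro sums_diff sums_mult h1 h2)
  have bd: "2 * h1 l - h2 l \<le> 8 / c * (r ^ Suc l / real (Suc l)) - (if l = k - 1 then D else 0)" for l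
  proof -
    define L where "L = Suc l"
    define y where "y = r ^ L"
    define e where "e = q ^ L"
    have y: "0 < y" "y < 1"
      using r by (auto simp: y_def L_def power_less_one_iff simp del: power_Suc)
    have y2: "y ^ 2 \<le> y ^ a" "y ^ a \<le> y" "y ^ 2 \<le> y"
      using a y by (auto simp: power2_eq_square mult_left_le)
    have ne: "norm e = y"
      using r by (simp add: e_def y_def norm_power q_def norm_pt)
    have e1: "1 - e \<noteq> 0" "1 - e\<^sup>2 \<noteq> 0" "1 + e \<noteq> 0"
    proof -
      have "norm (e\<^sup>2) < 1"
        using ne y by (simp add: norm_power power_less_one_iff)
      then show "1 - e \<noteq> 0" "1 - e\<^sup>2 \<noteq> 0" "1 + e \<noteq> 0"
        using ne y by (auto simp: add_eq_0_iff)
    qed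
    define G where "G = (1 - (e\<^sup>2) ^ n) / (1 - e\<^sup>2)"
    \<comment> \<open>Both logarithms are brought to the denominator 1 - e^2 of \<open>G\<close>. In
      the nonresonant case the bracket is at most 4 y and \<open>G\<close> at most 2/c; this is the
      source of 8/c.\<close>
    define Z where "Z = G * (e + e\<^sup>2 - 2 * ((- 1) ^ L * e ^ a))"
    have comb: "2 * h1 l - h2 l = Re Z / real L"
    proof -
      have "x ^ L = (- 1) ^ L * e ^ a"
      proof -
        have "x ^ L = (- 1) ^ L * (q ^ a) ^ L"
          unfolding x_def by (rule power_minus)
        then show ?thesis
          by (simp add: e_def power_mult[symmetric] mult.commute)
      qed
      moreover have "(q\<^sup>2) ^ L = e\<^sup>2"
        by (simp add: e_def power_mult[symmetric] mult.commute)
      ultimately have "h1 l = - Re ((- 1) ^ L * e ^ a * G) / real L"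
        unfolding h1_def L_def[symmetric] G_def by simp
      moreover have "h2 l = - Re ((e + e\<^sup>2) * G) / real L"
      proof -
        have "1 - e\<^sup>2 = (1 + e) * (1 - e)"
          by (simp add: algebra_simps power2_eq_square)
        then have "(e + e\<^sup>2) * G = e * (((1 + e) * (1 - (e\<^sup>2) ^ n)) / ((1 + e) * (1 - e)))"
          unfolding G_def by (simp add: distrib_left power2_eq_square algebra_simps)
        also have "\<dots> = e * ((1 - e ^ (2 * n)) / (1 - e))"
          using e1 by (simp add: power_mult)
        finally show ?thesis
          unfolding h2_def L_def[symmetric] e_def[symmetric] by simp
      qed
      moreover have "Re Z = Re ((e + e\<^sup>2) * G) - 2 * Re ((- 1) ^ L * e ^ a * G)"
        unfolding Z_def by (simp add: algebra_simps)
      ultimately show ?thesis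
        by (simp add: diff_divide_distrib)
    qed
    have "Re Z \<le> 8 / c * y - (if L = k then real k * D else 0)"
    proof (cases "k dvd L")
      case False
      then have "\<zeta> ^ (2 * L) \<noteq> 1"
        unfolding square_eq_1_iff .
      moreover have "pt r ^ (2 * L) = e\<^sup>2"
        by (simp add: e_def q_def power_mult[symmetric] mult.commute)
      ultimately have "norm G \<le> 2 / c"
        unfolding G_def using geometric_quotient_bound[OF r, of "2 * L" n] by simp
      moreover have "norm (e + e\<^sup>2 - 2 * ((- 1) ^ L * e ^ a)) \<le> 4 * y"
      proof -
        have "norm (e + e\<^sup>2 - 2 * ((- 1) ^ L * e ^ a)) \<le> norm e + norm (e\<^sup>2) + norm (2 * ((- 1) ^ L * e ^ a))"
          by norm
        also have "\<dots> = y + y ^ 2 + 2 * y ^ a"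
          by (simp add: norm_mult norm_power ne)
        finally show ?thesis
          using y2 by linarith
      qed
      ultimately have "norm Z \<le> 2 / c * (4 * y)"
        unfolding Z_def norm_mult[of G] using c by (intro mult_mono) auto
      moreover have "L \<noteq> k"
        using False by auto
      ultimately show ?thesis
        using complex_Re_le_cmod[of Z] by simp
    next
      case True
      then obtain m where m: "L = k * m"
        by (elim dvdE)
      define s :: real where "s = (if \<zeta> ^ L = 1 then 1 else - 1)"
      have s: "\<zeta> ^ L = of_real s" "s = 1 \<or> s = - 1"
        using root_power_cases[OF True] by (auto simp: s_def)
      have es: "e = of_real (s * y)"
        by (simp add: e_def q_def pt_power s(1) y_def)
      have e2: "e\<^sup>2 = of_real (y\<^sup>2)"
        using s(2) by (auto simp: es)
      \<comment> \<open>Here the parity condition enters: with L = k m the total sign is (-1)^((k+a)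
        m), which is 1 since k + a is even.\<close>
      have ea: "(- 1) ^ L * e ^ a = of_real (y ^ a)"
      proof -
        have "e = (- 1) ^ m * of_real y"
          by (simp add: e_def q_def pt_power y_def) (simp add: m power_mult half)
        then have "(- 1) ^ L * e ^ a = ((- 1) ^ (k * m) * (- 1) ^ (m * a)) * of_real (y ^ a)"
          by (simp add: m power_mult_distrib power_mult)
        also have "(- 1) ^ (k * m) * (- 1) ^ (m * a) = (((- 1) ^ (k + a)) ^ m :: complex)"
          by (simp add: power_mult[symmetric] power_add[symmetric] algebra_simps)
        also have "\<dots> = 1"
          using par by simp
        finally show ?thesis
          by simp
      qed
      define g where "g = (1 - y ^ (2 * n)) / (1 - y\<^sup>2)"
      have yy: "y\<^sup>2 < 1"
        using y by (simp add: power_less_one_iff)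
      have g: "0 \<le> g"
        unfolding g_def using y yy by (intro divide_nonneg_pos) (auto simp: power_le_one)
      have "G = of_real g"
        by (simp add: G_def e2 g_def power_mult)
      then have "Z = of_real (g * (s * y + y\<^sup>2 - 2 * y ^ a))"
        unfolding Z_def ea e2 by (simp add: es)
      then have Z: "Re Z = g * (s * y + y\<^sup>2 - 2 * y ^ a)"
        by (metis Re_complex_of_real)
      show ?thesis
      proof (cases "L = k")
        case True
        then have "s = - 1"
          using half by (simp add: s_def)
        then have "Re Z \<le> g * (- y - y\<^sup>2)"
          unfolding Z using g y2 by (intro mult_left_mono) auto
        also have "\<dots> = - (real k * D)"
        proof -
          have "1 - y\<^sup>2 = (1 + y) * (1 - y)"
            by (simp add: algebra_simps power2_eq_square)
          then have "g * (y + y\<^sup>2) = y * (((1 + y) * (1 - y ^ (2 * n))) / ((1 + y) * (1 - y)))"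
            unfolding g_def by (simp add: algebra_simps power2_eq_square)
          also have "\<dots> = y * ((1 - y ^ (2 * n)) / (1 - y))"
            using y by simp
          also have "\<dots> = real k * D"
            using k by (simp add: D_def y_def True)
          finally show ?thesis
            by (simp add: algebra_simps)
        qed
        also have "\<dots> \<le> 8 / c * y - real k * D"
          using c y by simp
        finally show ?thesis
          using True by simp
      next
        case False
        have "s * y \<le> y"
          using s(2) y by auto
        then have "s * y + y\<^sup>2 - 2 * y ^ a \<le> y - y\<^sup>2"
          using y2 by linarith
        then have "Re Z \<le> g * (y - y\<^sup>2)"
          unfolding Z using g by (rule mult_left_mono)
        also have "\<dots> = y * (g * (1 - y))"
          by (simp add: algebra_simps power2_eq_square)
        also have "\<dots> \<le> y * (8 / c)"
        proof (rule mult_left_mono)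
          have "g * (1 - y) \<le> g * (1 - y\<^sup>2)"
            using g y2 by (intro mult_left_mono) auto
          also have "\<dots> = 1 - y ^ (2 * n)"
            using yy by (simp add: g_def)
          also have "\<dots> \<le> 1"
            using y by simp
          also have "1 \<le> 8 / c"
            using c by simp
          finally show "g * (1 - y) \<le> 8 / c" .
        qed (use y in simp)
        finally show ?thesis
          using False by (simp add: mult.commute)
      qed
    qed
    then have "Re Z / real L \<le> (8 / c * y - (if L = k then real k * D else 0)) / real L"
      by (intro divide_right_mono) auto
    also have "\<dots> = 8 / c * (y / real L) - (if L = k then D else 0)"
      using k by (simp add: diff_divide_distrib)
    finally have *: "Re Z / real L \<le> 8 / c * (y / real L) - (if L = k then D else 0)" .
    have iff: "(L = k) = (l = k - 1)"
      using k by (auto simp: L_def)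
    show ?thesis
      using * unfolding comb iff by (simp only: y_def L_def)
  qed
  have nz: "qpoch x (q\<^sup>2) n \<noteq> 0" "qpoch q q (2 * n) \<noteq> 0"
    using qpoch_nonzero'[OF norm_square_lt_1[OF q(1)] x] qpoch_nonzero'[OF q(1) q(1)] by auto
  have "exp (2 * ln (norm (qpoch x (q\<^sup>2) n)) - ln (norm (qpoch q q (2 * n)))) \<le> (1 - r) powr (- (8 / c)) * exp (- D)"
    by (rule exp_sums_bound[OF h _ r(2) bd]) (use r in auto)
  also have "exp (2 * ln (norm (qpoch x (q\<^sup>2) n)) - ln (norm (qpoch q q (2 * n)))) =
      norm ((qpoch x (q\<^sup>2) n)\<^sup>2 / qpoch q q (2 * n))"
    using nz by (simp add: exp_diff norm_divide norm_power exp_double)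
  finally show ?thesis
    unfolding x_def q_def D_def .
qed

lemma theta_quot_bound:
  assumes r: "0 < r" "r < 1" and a: "a = 1 \<or> a = 2" and par: "even (k + a)"
  shows "norm (theta_quot a (pt r)) \<le> (1 - r) powr (- (8 / c)) * exp (- (r ^ k / (1 - r ^ k) / real k))"
proof (rule LIMSEQ_le)
  have q: "norm (pt r) < 1"
    using r by (simp add: norm_pt)
  have rk: "r ^ k < 1"
    using r k by (simp add: power_less_one_iff)
  have "(\<lambda>n. qpoch (pt r) (pt r) (2 * n)) \<longlonglongrightarrow> qpoch_inf (pt r) (pt r)"
    using LIMSEQ_subseq_LIMSEQ[OF qpoch_tendsto[OF q, of "pt r"], of "\<lambda>n. 2 * n"]
    by (simp add: strict_mono_def o_def)
  then show "(\<lambda>n. norm ((qpoch (- (pt r ^ a)) ((pt r)\<^sup>2) n)\<^sup>2 / qpoch (pt r) (pt r) (2 * n)))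
      \<longlonglongrightarrow> norm (theta_quot a (pt r))"
    unfolding theta_quot_def
    by (intro tendsto_intros qpoch_tendsto norm_square_lt_1 q qpoch_inf_nonzero' )
  have "(\<lambda>n. (r ^ k) ^ (2 * n)) \<longlonglongrightarrow> 0"
    unfolding power_mult[of "r ^ k"] using r rk by (intro LIMSEQ_power_zero) (auto simp: power_less_one_iff)
  then have "(\<lambda>n. (1 - r) powr (- (8 / c)) * exp (- (r ^ k * ((1 - (r ^ k) ^ (2 * n)) / (1 - r ^ k)) / real k))) \<longlonglongrightarrow>
      (1 - r) powr (- (8 / c)) * exp (- (r ^ k * ((1 - 0) / (1 - r ^ k)) / real k))"
    using rk k by (intro tendsto_intros) auto
  then show "(\<lambda>n. (1 - r) powr (- (8 / c)) * exp (- (r ^ k * ((1 - (r ^ k) ^ (2 * n)) / (1 - r ^ k)) / real k))) \<longlonglongrightarrow>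
      (1 - r) powr (- (8 / c)) * exp (- (r ^ k / (1 - r ^ k) / real k))"
    by simp
qed (use theta_quot_finite_bound[OF r a par] in blast)

text \<open>The parameter R stands for q^N when 2k divides N; uniformity in R and n is what the tail
  estimate needs. If \<zeta>^L = 1, the squared numerator outweighs the denominator symbol up to a
  bounded error. If \<zeta>^L = -1, the denominator symbol contributes with a favourable sign, and
  |1 - e| >= 1 controls the numerator.\<close>

lemma dual_ratio_bound:
  assumes r: "0 < r" "r < 1" and R: "0 \<le> R" "R \<le> 1"
  shows "norm ((qpoch (- (of_real R * pt r)) (pt r) n)\<^sup>2 / qpoch (of_real (R\<^sup>2) * pt r) ((pt r)\<^sup>2) (Suc n))
      \<le> (1 - r) powr (- (8 / c))"
proof -
  define q where "q = pt r"
  have q: "norm q < 1" "q \<noteq> 0"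
    using r by (simp_all add: q_def norm_pt pt_nonzero)
  define x where "x = - (of_real R * q)"
  define x' where "x' = of_real (R\<^sup>2) * q"
  have R2: "0 \<le> R\<^sup>2" "R\<^sup>2 \<le> 1"
    using R by (auto simp: power_le_one)
  have x: "norm x < 1" "norm x' < 1"
    unfolding x_def x'_def norm_minus_cancel using R R2 q
    by (subst mult.commute, intro norm_mult_lt_1; simp add: norm_power power_le_one)+
  define h1 where "h1 l = - Re (x ^ Suc l * ((1 - (q ^ Suc l) ^ n) / (1 - q ^ Suc l))) / real (Suc l)" for l
  define h2 where "h2 l = - Re (x' ^ Suc l * ((1 - ((q\<^sup>2) ^ Suc l) ^ Suc n) / (1 - (q\<^sup>2) ^ Suc l))) / real (Suc l)" for l
  have h1: "h1 sums ln (norm (qpoch x q n))"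
    unfolding h1_def by (rule ln_norm_qpoch_sums[OF x(1) q(1)])
  have h2: "h2 sums ln (norm (qpoch x' (q\<^sup>2) (Suc n)))"
    unfolding h2_def by (rule ln_norm_qpoch_sums[OF x(2) norm_square_lt_1[OF q(1)]])
  have h: "(\<lambda>l. 2 * h1 l - h2 l) sums (2 * ln (norm (qpoch x q n)) - ln (norm (qpoch x' (q\<^sup>2) (Suc n))))"
    by (intro sums_diff sums_mult h1 h2)
  have bd: "2 * h1 l - h2 l \<le> 8 / c * (r ^ Suc l / real (Suc l)) - (if l = 0 then 0 else 0)" for l
  proof -
    define L where "L = Suc l"
    define y where "y = r ^ L"
    define e where "e = q ^ L"
    define T where "T = R ^ L"
    have y: "0 < y" "y < 1"
      using r by (auto simp: y_def L_def power_less_one_iff simp del: power_Suc)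
    have T: "0 \<le> T" "T \<le> 1" "T\<^sup>2 \<le> T" "0 \<le> T\<^sup>2"
      using R by (auto simp: T_def power_le_one power2_eq_square mult_left_le)
    have ne: "norm e = y"
      using r by (simp add: e_def y_def norm_power q_def norm_pt)
    have xL: "x ^ L = (- 1) ^ L * of_real T * e"
      unfolding x_def power_minus[of "of_real R * q"] by (simp add: T_def e_def power_mult_distrib)
    have xL': "x' ^ L = of_real (T\<^sup>2) * e"
      unfolding x'_def by (simp add: T_def e_def power_mult_distrib power_mult[symmetric] mult.commute)
    have qL: "(q\<^sup>2) ^ L = e\<^sup>2"
      by (simp add: e_def power_mult[symmetric] mult.commute)
    define Z1 where "Z1 = (- 1) ^ L * of_real T * e * ((1 - e ^ n) / (1 - e))"
    define Z2 where "Z2 = of_real (T\<^sup>2) * e * ((1 - (e\<^sup>2) ^ Suc n) / (1 - e\<^sup>2))"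
    have comb: "2 * h1 l - h2 l = (- 2 * Re Z1 + Re Z2) / real L"
      unfolding h1_def h2_def L_def[symmetric] xL xL' qL e_def[symmetric] Z1_def Z2_def
      by (simp add: add_divide_distrib diff_divide_distrib)
    have c8: "4 \<le> 8 / c" "1 \<le> 8 / c"
      using c by (simp_all add: le_divide_eq)
    have "- 2 * Re Z1 + Re Z2 \<le> 8 / c * y"
    proof (cases "k dvd L")
      case False
      have e2: "pt r ^ (2 * L) = e\<^sup>2" "pt r ^ L = e"
        by (simp_all add: e_def q_def power_mult[symmetric] mult.commute)
      have "\<zeta> ^ (2 * L) \<noteq> 1"
        using False unfolding square_eq_1_iff .
      then have 2: "norm ((1 - (e\<^sup>2) ^ Suc n) / (1 - e\<^sup>2)) \<le> 2 / c"
        using geometric_quotient_bound[OF r, of "2 * L" "Suc n"] unfolding e2 by blast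
      have "\<zeta> ^ L \<noteq> 1"
        using False unfolding eq_1_iff by (meson dvd_mult_right)
      then have 1: "norm ((1 - e ^ n) / (1 - e)) \<le> 2 / c"
        using geometric_quotient_bound[OF r, of L n] unfolding e2 by blast
      have "norm Z1 = T * y * norm ((1 - e ^ n) / (1 - e))"
        using T(1) unfolding Z1_def norm_mult by (simp add: norm_power ne)
      also have "\<dots> \<le> 1 * y * (2 / c)"
        using T y 1 by (intro mult_mono) auto
      finally have Z1: "norm Z1 \<le> y * (2 / c)"
        by simp
      have "norm Z2 = T\<^sup>2 * y * norm ((1 - (e\<^sup>2) ^ Suc n) / (1 - e\<^sup>2))"
        using T(1) unfolding Z2_def norm_mult by (simp add: norm_power ne)
      also have "\<dots> \<le> 1 * y * (2 / c)"
        using T y 2 by (intro mult_mono) auto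
      finally have Z2: "norm Z2 \<le> y * (2 / c)"
        by simp
      have "- 2 * Re Z1 + Re Z2 \<le> 2 * norm Z1 + norm Z2"
        using abs_Re_le_cmod[of Z1] abs_Re_le_cmod[of Z2] by linarith
      also have "\<dots> \<le> 3 * (y * (2 / c))"
        using Z1 Z2 by linarith
      also have "\<dots> \<le> 8 / c * y"
        using y c by (simp add: field_simps)
      finally show ?thesis .
    next
      case True
      consider (pos) "\<zeta> ^ L = 1" | (neg) "\<zeta> ^ L = - 1"
        using root_power_cases[OF True] by blast
      then show ?thesis
      proof cases
        case pos
        then have ey: "e = of_real y"
          by (simp add: e_def q_def pt_power y_def)
        have "even L"
          using pos unfolding eq_1_iff by (meson dvd_mult_left)
        define S where "S = (\<Sum>i<n. y ^ i)"
        define S' where "S' = (\<Sum>i<Suc n. (y\<^sup>2) ^ i)"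
        have "(1 - e ^ n) / (1 - e) = of_real S"
        proof -
          have "(1 - y ^ n) / (1 - y) = S"
            using y one_diff_power_eq[of y n] by (simp add: S_def)
          then show ?thesis
            unfolding ey by (metis of_real_1 of_real_diff of_real_divide of_real_power)
        qed
        then have "Z1 = of_real (T * y * S)"
          using \<open>even L\<close> by (simp add: Z1_def ey)
        then have Z1: "Re Z1 = T * y * S"
          by (metis Re_complex_of_real)
        have yy: "y\<^sup>2 < 1"
          using y by (simp add: power_less_one_iff)
        have "(1 - (e\<^sup>2) ^ Suc n) / (1 - e\<^sup>2) = of_real S'"
        proof -
          have "(1 - (y\<^sup>2) ^ Suc n) / (1 - y\<^sup>2) = S'"
            using yy one_diff_power_eq[of "y\<^sup>2" "Suc n"] by (simp add: S'_def del: power_Suc sum.lessThan_Suc)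
          then show ?thesis
            unfolding ey by (metis of_real_1 of_real_diff of_real_divide of_real_power)
        qed
        then have "Z2 = of_real (T\<^sup>2 * y * S')"
          by (simp add: Z2_def ey)
        then have Z2: "Re Z2 = T\<^sup>2 * y * S'"
          by (metis Re_complex_of_real)
        have S: "0 \<le> S"
          using y by (auto simp: S_def intro: sum_nonneg)
        have S'0: "0 \<le> S'"
          using y unfolding S'_def by (intro sum_nonneg) auto
        have "S' = 1 + (\<Sum>i<n. (y\<^sup>2) ^ Suc i)"
          unfolding S'_def by (subst sum.lessThan_Suc_shift) simp
        also have "(\<Sum>i<n. (y\<^sup>2) ^ Suc i) \<le> S"
          unfolding S_def
        proof (rule sum_mono)
          show "(y\<^sup>2) ^ Suc i \<le> y ^ i" for i
            unfolding power_mult[symmetric] using y by (intro power_decreasing) auto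
        qed
        finally have S': "S' \<le> 1 + S"
          by simp
        \<comment> \<open>Since S' <= 1 + S and T^2 <= T, the possibly large sum S occurs with total
          coefficient at most T - 2T <= 0.\<close>
        have "- 2 * Re Z1 + Re Z2 = y * (T\<^sup>2 * S' - 2 * T * S)"
          unfolding Z1 Z2 by (simp add: algebra_simps)
        also have "\<dots> \<le> y * 1"
        proof (rule mult_left_mono)
          have "T\<^sup>2 * S' \<le> T * (1 + S)"
            by (rule mult_mono[OF T(3) S' T(1) S'0])
          moreover have "0 \<le> T * S"
            by (rule mult_nonneg_nonneg[OF T(1) S])
          ultimately show "T\<^sup>2 * S' - 2 * T * S \<le> 1"
            using T by (simp add: algebra_simps)
        qed (use y in simp)
        also have "\<dots> \<le> y * (8 / c)"
          using y c8 by (intro mult_left_mono) auto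
        finally show ?thesis
          by (simp add: mult.commute)
      next
        case neg
        then have ey: "e = of_real (- y)"
          by (simp add: e_def q_def pt_power y_def)
        have "norm Z1 = T * y * (norm (1 - e ^ n) / norm (1 - e))"
          using T(1) unfolding Z1_def norm_mult norm_divide by (simp add: norm_power ne)
        also have "\<dots> \<le> 1 * y * (2 / 1)"
        proof (intro mult_mono frac_le)
          have "norm (e ^ n) \<le> 1"
            using ne y by (simp add: norm_power power_le_one)
          then show "norm (1 - e ^ n) \<le> 2"
            using norm_triangle_ineq4[of 1 "e ^ n"] by simp
          have "1 - e = of_real (1 + y)"
            by (simp add: ey)
          then have "norm (1 - e) = 1 + y"
            using y by (metis abs_of_pos add_pos_pos norm_of_real zero_less_one)
          then show "1 \<le> norm (1 - e)"
            using y by simp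
        qed (use T y in auto)
        finally have Z1: "norm Z1 \<le> 2 * y"
          by simp
        define g where "g = (1 - (y\<^sup>2) ^ Suc n) / (1 - y\<^sup>2)"
        have yy: "y\<^sup>2 < 1"
          using y by (simp add: power_less_one_iff)
        have g: "0 \<le> g"
          unfolding g_def using yy by (intro divide_nonneg_pos) (auto simp: power_le_one simp del: power_Suc)
        have "e\<^sup>2 = of_real (y\<^sup>2)"
          by (simp add: ey)
        then have "(1 - (e\<^sup>2) ^ Suc n) / (1 - e\<^sup>2) = of_real g"
          unfolding g_def by (metis of_real_1 of_real_diff of_real_divide of_real_power)
        then have "Z2 = of_real (- (T\<^sup>2 * y * g))"
          by (simp add: Z2_def ey)
        then have "Re Z2 = - (T\<^sup>2 * y * g)"
          by (metis Re_complex_of_real)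
        then have "Re Z2 \<le> 0"
          using T y g by simp
        then have "- 2 * Re Z1 + Re Z2 \<le> 4 * y"
          using abs_Re_le_cmod[of Z1] Z1 by linarith
        also have "\<dots> \<le> 8 / c * y"
          using y c8 by (intro mult_right_mono) auto
        finally show ?thesis .
      qed
    qed
    from divide_right_mono[OF this, of "real L"] show ?thesis
      unfolding comb by (simp add: L_def y_def del: power_Suc)
  qed
  have nz: "qpoch x q n \<noteq> 0" "qpoch x' (q\<^sup>2) (Suc n) \<noteq> 0"
    using qpoch_nonzero'[OF q(1) x(1)] qpoch_nonzero'[OF norm_square_lt_1[OF q(1)] x(2)] by auto
  have "exp (2 * ln (norm (qpoch x q n)) - ln (norm (qpoch x' (q\<^sup>2) (Suc n)))) \<le> (1 - r) powr (- (8 / c)) * exp (- 0)"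
    by (rule exp_sums_bound[OF h _ r(2) bd]) (use r in auto)
  also have "exp (2 * ln (norm (qpoch x q n)) - ln (norm (qpoch x' (q\<^sup>2) (Suc n)))) =
      norm ((qpoch x q n)\<^sup>2 / qpoch x' (q\<^sup>2) (Suc n))"
    using nz by (simp add: exp_diff norm_divide norm_power exp_double)
  finally show ?thesis
    unfolding x_def x'_def q_def by simp
qed

end

subsection \<open>The radial limit\<close>

lemma even_root_exists:
  assumes k: "k \<ge> 1" and prim: "primitive_root_of_unity (2 * k) \<zeta>"
  obtains c where "even_root k \<zeta> c"
proof -
  have one: "\<zeta> ^ (2 * k) = 1" and least: "\<And>m. 0 < m \<Longrightarrow> m < 2 * k \<Longrightarrow> \<zeta> ^ m \<noteq> 1"
    using prim by (auto simp: primitive_root_of_unity_def)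
  have md: "\<zeta> ^ L = \<zeta> ^ (L mod (2 * k))" for L
  proof -
    have "\<zeta> ^ L = \<zeta> ^ (2 * k * (L div (2 * k)) + L mod (2 * k))"
      by simp
    also have "\<dots> = \<zeta> ^ (L mod (2 * k))"
      unfolding power_add power_mult[of \<zeta> "2 * k"] one by simp
    finally show ?thesis .
  qed
  have iff: "\<zeta> ^ L = 1 \<longleftrightarrow> 2 * k dvd L" for L
  proof
    assume "\<zeta> ^ L = 1"
    then have "\<zeta> ^ (L mod (2 * k)) = 1"
      using md by metis
    moreover have "L mod (2 * k) < 2 * k"
      using k by simp
    ultimately have "L mod (2 * k) = 0"
      using least by blast
    then show "2 * k dvd L"
      by (rule mod_0_imp_dvd)
  next
    assume "2 * k dvd L"
    then show "\<zeta> ^ L = 1"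
      using one by (auto elim!: dvdE simp: power_mult)
  qed
  have "(\<zeta> ^ k)\<^sup>2 = 1"
    using one by (simp add: power_mult[symmetric] mult.commute)
  moreover have "\<zeta> ^ k \<noteq> 1"
    using least[of k] k by simp
  ultimately have half: "\<zeta> ^ k = - 1"
    by (simp add: power2_eq_1_iff)
  define S where "S = (\<lambda>j. norm (1 - \<zeta> ^ j)) ` {j. j < 2 * k \<and> \<zeta> ^ j \<noteq> 1}"
  have fin: "finite S"
    by (simp add: S_def)
  \<comment> \<open>The index k gives |1 - (-1)| = 2, so the minimum is over a nonempty set and the
    resulting c is at most 1.\<close>
  have kS: "2 \<in> S"
    unfolding S_def using k half by (intro image_eqI[of _ _ k]) auto
  define c where "c = Min S / 2"
  have "Min S \<in> S"
    using fin kS by (intro Min_in) auto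
  then have "0 < Min S"
    by (auto simp: S_def)
  moreover have "Min S \<le> 2"
    using fin kS by simp
  moreover have "2 * c \<le> norm (1 - \<zeta> ^ L)" if "\<zeta> ^ L \<noteq> 1" for L
  proof -
    have "L mod (2 * k) \<in> {j. j < 2 * k \<and> \<zeta> ^ j \<noteq> 1}"
      using that md[of L] k by auto
    then have "norm (1 - \<zeta> ^ L) \<in> S"
      unfolding md[of L] S_def by (rule imageI)
    then show ?thesis
      using fin by (simp add: c_def)
  qed
  ultimately have "even_root k \<zeta> c"
    by unfold_locales (use k half iff in \<open>auto simp: c_def\<close>)
  then show ?thesis
    using that by blast
qed

context even_root
begin

section \<open>Decay of the theta quotients along the radius\<close>

lemma one_minus_power_le:
  assumes "0 \<le> r" "r \<le> 1"
  shows "1 - r ^ n \<le> real n * (1 - r)"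
  using Bernoulli_inequality[of "r - 1" n] assms by (simp add: algebra_simps)

lemma theta_quot_decay:
  obtains \<delta> where "\<delta> > 0"
    "\<And>r a. 1 / 2 \<le> r \<Longrightarrow> r < 1 \<Longrightarrow> a = 1 \<or> a = 2 \<Longrightarrow> even (k + a) \<Longrightarrow>
       norm (theta_quot a (pt r)) \<le> (1 - r) powr (- (8 / c)) * exp (- (\<delta> / (1 - r)))"
proof -
  \<comment> \<open>From r^k >= (1/2)^k and Bernoulli's 1 - r^k <= k (1 - r); the second factor k is
    the 1/k of the logarithmic series at the index k.\<close>
  define \<delta> where "\<delta> = (1 / 2) ^ k / (real k * real k)"
  have "norm (theta_quot a (pt r)) \<le> (1 - r) powr (- (8 / c)) * exp (- (\<delta> / (1 - r)))"
    if r: "1 / 2 \<le> r" "r < 1" and a: "a = 1 \<or> a = 2" "even (k + a)" for r a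
  proof -
    have rk: "0 < 1 - r ^ k"
      using r k by (simp add: power_less_one_iff)
    have "\<delta> / (1 - r) = (1 / 2) ^ k / (real k * (1 - r)) / real k"
      by (simp add: \<delta>_def)
    also have "\<dots> \<le> r ^ k / (1 - r ^ k) / real k"
      using r k rk one_minus_power_le[of r k]
      by (intro divide_right_mono frac_le power_mono) auto
    finally have d: "\<delta> / (1 - r) \<le> r ^ k / (1 - r ^ k) / real k" .
    have "norm (theta_quot a (pt r)) \<le> (1 - r) powr (- (8 / c)) * exp (- (r ^ k / (1 - r ^ k) / real k))"
      by (rule theta_quot_bound) (use r a in auto)
    also have "\<dots> \<le> (1 - r) powr (- (8 / c)) * exp (- (\<delta> / (1 - r)))"
      using d by (intro mult_left_mono) auto
    finally show ?thesis .
  qed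
  moreover have "\<delta> > 0"
    using k by (simp add: \<delta>_def)
  ultimately show ?thesis
    using that by blast
qed

lemma eventually_radial: "eventually (\<lambda>r. 1 / 2 < r \<and> r < 1) (at_left (1 :: real))"
  using eventually_at_left_real[of "1 / 2" 1] by (auto elim: eventually_mono)

lemma decay_tendsto_0:
  fixes B \<delta> :: real
  assumes "\<delta> > 0"
  shows "((\<lambda>r. (1 - r) powr (- B) * exp (- (\<delta> / (1 - r)))) \<longlongrightarrow> 0) (at_left (1 :: real))"
  using assms by real_asymp

lemma theta_quot_over_tendsto_0:
  assumes a: "a = 1 \<or> a = 2" "even (k + a)"
  shows "((\<lambda>r. norm (theta_quot a (pt r)) / (1 - r)) \<longlongrightarrow> 0) (at_left 1)"
proof -
  obtain \<delta> where \<delta>: "\<delta> > 0" and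
    bd: "\<And>r. 1 / 2 \<le> r \<Longrightarrow> r < 1 \<Longrightarrow> norm (theta_quot a (pt r)) \<le> (1 - r) powr (- (8 / c)) * exp (- (\<delta> / (1 - r)))"
    using theta_quot_decay a by metis
  have "eventually (\<lambda>r. norm (norm (theta_quot a (pt r)) / (1 - r)) \<le> (1 - r) powr (- (8 / c + 1)) * exp (- (\<delta> / (1 - r)))) (at_left 1)"
    using eventually_radial
  proof eventually_elim
    case (elim r)
    have "- (8 / c + 1) = - (8 / c) - 1"
      by simp
    then have e: "(1 - r) powr (- (8 / c + 1)) = (1 - r) powr (- (8 / c)) / (1 - r)"
      using elim by (simp only: powr_diff) simp
    have "norm (norm (theta_quot a (pt r)) / (1 - r)) = norm (theta_quot a (pt r)) / (1 - r)"
      using elim by simp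
    also have "\<dots> \<le> (1 - r) powr (- (8 / c)) * exp (- (\<delta> / (1 - r))) / (1 - r)"
      using elim bd[of r] by (intro divide_right_mono) auto
    also have "\<dots> = (1 - r) powr (- (8 / c + 1)) * exp (- (\<delta> / (1 - r)))"
      unfolding e by (simp only: times_divide_eq_left)
    finally show ?case .
  qed
  then show ?thesis
    by (rule Lim_null_comparison[OF _ decay_tendsto_0[OF \<delta>]])
qed

lemma theta_quot_quartic_tendsto_0:
  assumes a: "a = 1 \<or> a = 2" "even (k + a)"
  shows "((\<lambda>r. theta_quot a (pt r) ^ 4 * qpoch_inf (pt r) (pt r) * qpoch_inf ((pt r)\<^sup>2) ((pt r)\<^sup>2) ^ 4) \<longlongrightarrow> 0) (at_left 1)"
proof -
  obtain \<delta> where \<delta>: "\<delta> > 0" and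
    bd: "\<And>r. 1 / 2 \<le> r \<Longrightarrow> r < 1 \<Longrightarrow> norm (theta_quot a (pt r)) \<le> (1 - r) powr (- (8 / c)) * exp (- (\<delta> / (1 - r)))"
    using theta_quot_decay a by metis
  \<comment> \<open>4 + 1 + 4 = 9 polynomial factors of exponent 8/c, and four exponential
    ones.\<close>
  define g where "g r = (1 - r) powr (- (72 / c)) * exp (- (4 * \<delta> / (1 - r)))" for r
  have "eventually (\<lambda>r. norm (theta_quot a (pt r) ^ 4 * qpoch_inf (pt r) (pt r) * qpoch_inf ((pt r)\<^sup>2) ((pt r)\<^sup>2) ^ 4) \<le> g r) (at_left 1)"
    using eventually_radial
  proof eventually_elim
    case (elim r)
    define p where "p = (1 - r) powr (- (8 / c))"
    define x where "x = exp (- (\<delta> / (1 - r)))"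
    have 1: "norm (qpoch_inf (pt r) (pt r)) \<le> p"
      unfolding p_def using qpoch_inf_polynomial_bound[of r 1] elim by simp
    have 2: "norm (qpoch_inf ((pt r)\<^sup>2) ((pt r)\<^sup>2)) \<le> p"
      unfolding p_def using qpoch_inf_polynomial_bound[of r 2] elim by simp
    have "norm (theta_quot a (pt r) ^ 4 * qpoch_inf (pt r) (pt r) * qpoch_inf ((pt r)\<^sup>2) ((pt r)\<^sup>2) ^ 4)
        \<le> (p * x) ^ 4 * p * p ^ 4"
      unfolding norm_mult norm_power using bd[of r] elim 1 2
      by (intro mult_mono power_mono) (auto simp: p_def x_def)
    also have "\<dots> = (p ^ 4 * p ^ 1 * p ^ 4) * x ^ 4"
      by (simp add: power_mult_distrib mult_ac)
    also have "p ^ 4 * p ^ 1 * p ^ 4 = p ^ 9"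
      unfolding power_add[symmetric] by simp
    also have "p ^ 9 = (1 - r) powr (- (72 / c))"
      unfolding p_def using elim by (simp flip: powr_realpow add: powr_powr)
    also have "x ^ 4 = exp (- (4 * \<delta> / (1 - r)))"
      unfolding x_def by (simp flip: exp_of_nat_mult)
    finally show ?case
      unfolding g_def .
  qed
  moreover have "(g \<longlongrightarrow> 0) (at_left 1)"
    unfolding g_def by (rule decay_tendsto_0) (use \<delta> in simp)
  ultimately show ?thesis
    by (rule Lim_null_comparison)
qed

section \<open>Limit of the dual series\<close>

lemma pt_tendsto: "(pt \<longlongrightarrow> \<zeta>) (at_left 1)"
proof -
  have "((\<lambda>r. of_real r * \<zeta>) \<longlongrightarrow> of_real 1 * \<zeta>) (at_left 1)"
    by (intro tendsto_intros)
  then show ?thesis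
    by (simp add: pt_def[abs_def])
qed

lemma odd_root_power_neq_1: "\<zeta> ^ (2 * i + 1) \<noteq> 1"
  unfolding eq_1_iff by (metis dvd_mult_left odd_two_times_div_two_succ even_plus_one_iff dvd_triv_left)

lemma dual_term_tendsto: "((\<lambda>r. dual_term (pt r) n) \<longlongrightarrow> dual_term \<zeta> n) (at_left 1)"
proof -
  have "\<zeta> * (\<zeta>\<^sup>2) ^ i \<noteq> 1" for i
    using odd_root_power_neq_1[of i] by (simp add: power_mult)
  then have "(\<Prod>i<n + 1. 1 - \<zeta> * (\<zeta>\<^sup>2) ^ i) \<noteq> 0"
    by simp
  then show ?thesis
    unfolding dual_term_def qpoch_def by (intro tendsto_intros pt_tendsto)
qed

lemma dual_term_root_eq_0:
  assumes "k \<le> n"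
  shows "dual_term \<zeta> n = 0"
proof -
  have "- \<zeta> * \<zeta> ^ (k - 1) = 1"
    using half k by (cases k) auto
  then have "qpoch (- \<zeta>) \<zeta> n = 0"
    unfolding qpoch_eq_0_iff using assms k by (intro exI[of _ "k - 1"]) auto
  then show ?thesis
    by (simp add: dual_term_def)
qed

text \<open>Each block of 2k consecutive factors contains one of the form 1 + q^L with \<zeta>^L =
  -1, that is 1 - r^L, of order 1 - r. The other factors are at most 2 in norm.\<close>

lemma qpoch_numerator_bound:
  assumes r: "0 < r" "r < 1" and "m \<le> M"
  shows "norm (qpoch (- pt r) (pt r) (2 * k * m)) \<le> (2 ^ (2 * k) * (real (2 * k * M) * (1 - r))) ^ m"
  using \<open>m \<le> M\<close>
proof (induction m)
  case (Suc m)
  define q where "q = pt r"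
  define N where "N = 2 * k * m"
  have le: "norm (1 - - q * q ^ N * q ^ i) \<le> 2" for i
  proof -
    have "norm (q * q ^ N * q ^ i) \<le> 1"
      using r by (simp add: q_def norm_mult norm_power norm_pt mult_le_one power_le_one)
    then show ?thesis
      using norm_triangle_ineq[of 1 "q * q ^ N * q ^ i"] by simp
  qed
  have sp: "norm (1 - - q * q ^ N * q ^ (k - 1)) \<le> real (2 * k * M) * (1 - r)"
  proof -
    have "q * q ^ N * q ^ (k - 1) = q ^ (N + k)"
      using k by (simp add: power_add[symmetric] flip: power_Suc)
    also have "\<dots> = - of_real (r ^ (N + k))"
      unfolding q_def pt_power power_add[of \<zeta>] half using eq_1_iff[of N] by (simp add: N_def)
    finally have "1 - - q * q ^ N * q ^ (k - 1) = of_real (1 - r ^ (N + k))"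
      by simp
    then have "norm (1 - - q * q ^ N * q ^ (k - 1)) = 1 - r ^ (N + k)"
      using r by (simp only: norm_of_real) (simp add: power_le_one)
    also have "\<dots> \<le> real (N + k) * (1 - r)"
      using r by (intro one_minus_power_le) auto
    also have "\<dots> \<le> real (2 * k * M) * (1 - r)"
    proof (intro mult_right_mono)
      have "2 * k * Suc m \<le> 2 * k * M"
        using Suc.prems by (rule mult_le_mono2)
      then have "N + k \<le> 2 * k * M"
        by (simp add: N_def)
      then show "real (N + k) \<le> real (2 * k * M)"
        by (rule of_nat_mono)
    qed (use r in auto)
    finally show ?thesis .
  qed
  have "norm (qpoch (- q * q ^ N) q (2 * k)) = (\<Prod>i<2 * k. norm (1 - - q * q ^ N * q ^ i))"
    by (simp add: qpoch_def prod_norm)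
  also have "\<dots> = norm (1 - - q * q ^ N * q ^ (k - 1)) * (\<Prod>i\<in>{..<2 * k} - {k - 1}. norm (1 - - q * q ^ N * q ^ i))"
    by (rule prod.remove) (use k in auto)
  also have "\<dots> \<le> (real (2 * k * M) * (1 - r)) * 2 ^ (2 * k)"
  proof (rule mult_mono[OF sp])
    have "(\<Prod>i\<in>{..<2 * k} - {k - 1}. norm (1 - - q * q ^ N * q ^ i)) \<le> (\<Prod>i\<in>{..<2 * k} - {k - 1}. 2)"
      by (intro prod_mono) (use le in auto)
    also have "\<dots> = 2 ^ card ({..<2 * k} - {k - 1})"
      by simp
    also have "\<dots> \<le> 2 ^ (2 * k)"
      by (intro power_increasing) (auto intro: order_trans[OF card_Diff1_le])
    finally show "(\<Prod>i\<in>{..<2 * k} - {k - 1}. norm (1 - - q * q ^ N * q ^ i)) \<le> 2 ^ (2 * k)" .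
  qed (use r in \<open>auto intro: prod_nonneg\<close>)
  finally have st: "norm (qpoch (- q * q ^ N) q (2 * k)) \<le> 2 ^ (2 * k) * (real (2 * k * M) * (1 - r))"
    by (simp only: mult.commute)
  have "2 * k * Suc m = N + 2 * k"
    by (simp add: N_def)
  then have "norm (qpoch (- q) q (2 * k * Suc m)) = norm (qpoch (- q) q N) * norm (qpoch (- q * q ^ N) q (2 * k))"
    by (simp only: qpoch_add norm_mult)
  also have "\<dots> \<le> (2 ^ (2 * k) * (real (2 * k * M) * (1 - r))) ^ m * (2 ^ (2 * k) * (real (2 * k * M) * (1 - r)))"
    using Suc r st by (intro mult_mono) (auto simp: q_def N_def)
  finally show ?case
    by (simp only: q_def power_Suc2)
qed simp

text \<open>Since 2k divides N, q^N is the real number r^N, and a term of the tail factors into a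
  fixed head and a ratio covered by \<open>dual_ratio_bound\<close>. The numerator of the head is of
  order (1 - r)^(2M) after squaring; its denominator is at least c^N because odd powers of \<zeta>
  differ from 1.\<close>

lemma dual_tail_bound:
  obtains N K where "k \<le> N" "\<And>r. 0 < r \<Longrightarrow> r < 1 \<Longrightarrow> norm (\<Sum>n. dual_term (pt r) (N + n)) \<le> K * (1 - r)"
proof -
  define C where "C = 8 / c"
  \<comment> \<open>Of the 2M powers of 1 - r, C pay for the ratio and one for the geometric series;
    this choice of M leaves at least one.\<close>
  define M where "M = nat \<lceil>C\<rceil> + 2"
  have M: "C + 2 \<le> real M"
    unfolding M_def by linarith
  define N where "N = 2 * k * M"
  have kN: "k \<le> N"
    using k by (simp add: N_def M_def)
  have \<zeta>N: "\<zeta> ^ N = 1"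
    unfolding eq_1_iff by (simp add: N_def)
  define B where "B = (2 ^ (2 * k) * real N) ^ M"
  define K where "K = B\<^sup>2 / c ^ N"
  have "norm (\<Sum>n. dual_term (pt r) (N + n)) \<le> K * (1 - r)" if r: "0 < r" "r < 1" for r
  proof -
    define q where "q = pt r"
    have q: "norm q < 1" "norm q = r"
      using r by (simp_all add: q_def norm_pt)
    define R where "R = r ^ N"
    have R: "0 \<le> R" "R \<le> 1"
      using r by (auto simp: R_def power_le_one)
    have qN: "q ^ N = of_real R"
      by (simp add: q_def pt_power \<zeta>N R_def)
    have num: "norm (qpoch (- q) q N) \<le> B * (1 - r) ^ M"
    proof -
      have "norm (qpoch (- q) q N) \<le> (2 ^ (2 * k) * (real N * (1 - r))) ^ M"
        unfolding q_def N_def by (rule qpoch_numerator_bound[OF r order_refl])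
      also have "\<dots> = B * (1 - r) ^ M"
        by (simp add: B_def power_mult_distrib mult.assoc[symmetric])
      finally show ?thesis .
    qed
    have den: "c ^ N \<le> norm (qpoch q (q\<^sup>2) N)"
    proof -
      have "c \<le> norm (1 - q * (q\<^sup>2) ^ i)" for i
      proof -
        have "q * (q\<^sup>2) ^ i = of_real (r ^ (2 * i + 1)) * \<zeta> ^ (2 * i + 1)"
          unfolding pt_power[symmetric] q_def by (simp add: power_mult)
        then show ?thesis
          using gap_radial[OF _ _ odd_root_power_neq_1, of "r ^ (2 * i + 1)" i] r by (simp add: power_le_one mult_le_one)
      qed
      then have "(\<Prod>i<N. c) \<le> (\<Prod>i<N. norm (1 - q * (q\<^sup>2) ^ i))"
        using c by (intro prod_mono) auto
      then show ?thesis
        by (simp add: qpoch_def prod_norm)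
    qed
    have tm: "norm (dual_term q (N + n)) \<le> K * (1 - r) ^ (2 * M) * (1 - r) powr (- C) * r ^ n" for n
    proof -
      define \<rho> where "\<rho> = (qpoch (- (of_real R * q)) q n)\<^sup>2 / qpoch (of_real (R\<^sup>2) * q) (q\<^sup>2) (Suc n)"
      have \<rho>: "norm \<rho> \<le> (1 - r) powr (- C)"
        unfolding \<rho>_def q_def C_def by (rule dual_ratio_bound[OF r R])
      have "qpoch (- q) q (N + n) = qpoch (- q) q N * qpoch (- (of_real R * q)) q n"
        unfolding qpoch_add qN by (simp add: mult.commute)
      moreover have "qpoch q (q\<^sup>2) (N + n + 1) = qpoch q (q\<^sup>2) N * qpoch (of_real (R\<^sup>2) * q) (q\<^sup>2) (Suc n)"
      proof -
        have "(q\<^sup>2) ^ N = of_real (R\<^sup>2)"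
          using qN by (simp add: power_mult[symmetric] mult.commute[of 2]) (simp add: power_mult)
        then show ?thesis
          using qpoch_add[of q "q\<^sup>2" N "Suc n"] by (simp add: mult.commute)
      qed
      ultimately have "dual_term q (N + n) = q ^ (N + n + 1) * ((qpoch (- q) q N)\<^sup>2 / qpoch q (q\<^sup>2) N) * \<rho>"
        unfolding dual_term_def \<rho>_def by (simp add: power_mult_distrib)
      then have "norm (dual_term q (N + n)) = r ^ (N + n + 1) * ((norm (qpoch (- q) q N))\<^sup>2 / norm (qpoch q (q\<^sup>2) N)) * norm \<rho>"
        by (simp add: norm_mult norm_divide norm_power q(2))
      also have "\<dots> \<le> r ^ n * ((B * (1 - r) ^ M)\<^sup>2 / c ^ N) * (1 - r) powr (- C)"
      proof (intro mult_mono frac_le power_mono num den \<rho>)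
        show "r ^ (N + n + 1) \<le> r ^ n"
          using r by (intro power_decreasing) auto
      qed (use r c in auto)
      also have "\<dots> = K * (1 - r) ^ (2 * M) * (1 - r) powr (- C) * r ^ n"
      proof -
        have "((1 - r) ^ M)\<^sup>2 = (1 - r) ^ (2 * M)"
          by (simp only: power_mult[symmetric] mult.commute)
        then show ?thesis
          by (simp add: K_def power_mult_distrib mult_ac)
      qed
      finally show ?thesis .
    qed
    have "(\<lambda>n. dual_term q (N + n)) sums (\<Sum>n. dual_term q (N + n))"
      using summable_ignore_initial_segment[OF summable_norm_cancel[OF dual_term_summable[OF q(1)]], of N]
      by (intro summable_sums) (simp add: add.commute)
    then have "norm (\<Sum>n. dual_term q (N + n)) \<le> K * (1 - r) ^ (2 * M) * (1 - r) powr (- C) / (1 - r)"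
      by (rule sums_norm_geometric_bound) (use tm r in auto)
    also have "\<dots> = K * ((1 - r) powr (real (2 * M) + - C + - 1))"
      using r unfolding powr_add by (simp add: powr_realpow powr_minus divide_inverse flip: powr_realpow)
    also have "\<dots> \<le> K * (1 - r)"
    proof (rule mult_left_mono)
      have "(1 - r) powr (real (2 * M) + - C + - 1) \<le> (1 - r) powr 1"
        using r M by (intro powr_mono') auto
      then show "(1 - r) powr (real (2 * M) + - C + - 1) \<le> 1 - r"
        using r by simp
      show "0 \<le> K"
        using c by (simp add: K_def)
    qed
    finally show ?thesis
      by (simp add: q_def)
  qed
  then show ?thesis
    using that[of N K] kN by blast
qed

lemma dual_sum_tendsto: "((\<lambda>r. \<Sum>n. dual_term (pt r) n) \<longlongrightarrow> (\<Sum>n<k. dual_term \<zeta> n)) (at_left 1)"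
proof -
  obtain N K where N: "k \<le> N" and
    tail: "\<And>r. 0 < r \<Longrightarrow> r < 1 \<Longrightarrow> norm (\<Sum>n. dual_term (pt r) (N + n)) \<le> K * (1 - r)"
    using dual_tail_bound by metis
  have "((\<lambda>r. \<Sum>n. dual_term (pt r) (N + n)) \<longlongrightarrow> 0) (at_left 1)"
  proof (rule Lim_null_comparison)
    show "eventually (\<lambda>r. norm (\<Sum>n. dual_term (pt r) (N + n)) \<le> K * (1 - r)) (at_left 1)"
      using eventually_radial by eventually_elim (use tail in auto)
    have "((\<lambda>r. K * (1 - r)) \<longlongrightarrow> K * (1 - 1)) (at_left (1 :: real))"
      by (intro tendsto_intros)
    then show "((\<lambda>r. K * (1 - r)) \<longlongrightarrow> 0) (at_left (1 :: real))"
      by simp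
  qed
  moreover have "((\<lambda>r. \<Sum>n<N. dual_term (pt r) n) \<longlongrightarrow> (\<Sum>n<N. dual_term \<zeta> n)) (at_left 1)"
    by (intro tendsto_sum dual_term_tendsto)
  ultimately have "((\<lambda>r. (\<Sum>n. dual_term (pt r) (N + n)) + (\<Sum>n<N. dual_term (pt r) n)) \<longlongrightarrow>
      0 + (\<Sum>n<N. dual_term \<zeta> n)) (at_left 1)"
    by (rule tendsto_add)
  moreover have "(\<Sum>n<N. dual_term \<zeta> n) = (\<Sum>n<k. dual_term \<zeta> n)"
    using N dual_term_root_eq_0 by (intro sum.mono_neutral_right) auto
  moreover have "eventually (\<lambda>r. (\<Sum>n. dual_term (pt r) (N + n)) + (\<Sum>n<N. dual_term (pt r) n) =
      (\<Sum>n. dual_term (pt r) n)) (at_left 1)"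
    using eventually_radial
  proof eventually_elim
    case (elim r)
    then have "summable (dual_term (pt r))"
      by (intro summable_norm_cancel[OF dual_term_summable]) (simp add: norm_pt)
    from suminf_split_initial_segment[OF this, of N] show ?case
      by (simp add: add.commute)
  qed
  ultimately show ?thesis
    by (auto intro: Lim_transform_eventually)
qed

lemma radial_limit:
  "((\<lambda>r. S4_one (pt r) + J 1 (pt r) ^ 3 / Jbar 0 1 (pt r) ^ 2 - Jbar 1 2 (pt r) ^ 4 / (2 * J 1 (pt r) ^ 3))
      \<longlongrightarrow> - 2 * (\<Sum>n<k. dual_term \<zeta> n)) (at_left 1)"
proof -
  \<comment> \<open>Parity opposite to k, so \<zeta>^(2j+a) is never -1 and the denominators stay
    away from 0. Then \<open>Suc a\<close> has the parity of k, as the decay of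
    \<open>theta_quot\<close> requires.\<close>
  define a :: nat where "a = (if odd k then 0 else 1)"
  have a: "a \<le> 1" "Suc a = 1 \<or> Suc a = 2" "even (k + Suc a)"
    by (auto simp: a_def)
  define t t' where "t r = J 1 (pt r) ^ 3 / Jbar 0 1 (pt r) ^ 2"
    and "t' r = Jbar 1 2 (pt r) ^ 4 / (2 * J 1 (pt r) ^ 3)" for r
  define U where "U r = S4_one (pt r) + (- 1) ^ a * t r + 2 * (\<Sum>n. dual_term (pt r) n)" for r
  define V where "V r = theta_quot (Suc a) (pt r) ^ 4 * qpoch_inf (pt r) (pt r) * qpoch_inf ((pt r)\<^sup>2) ((pt r)\<^sup>2) ^ 4" for r
  \<comment> \<open>What is left of t - t' after (-1)^a t has been absorbed into U: -t' for odd k,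
    and 2 t - t' for even k.\<close>
  define W where "W r = (if odd k then - 1 / 2 else - 8 * pt r) * V r" for r
  have U: "(U \<longlongrightarrow> 0) (at_left 1)"
  proof (rule Lim_null_comparison)
    show "eventually (\<lambda>r. norm (U r) \<le> 4 / c * (norm (theta_quot (Suc a) (pt r)) / (1 - r))) (at_left 1)"
      using eventually_radial
    proof eventually_elim
      case (elim r)
      then have r: "0 < r" "r < 1"
        by auto
      \<comment> \<open>Replacing -1 by \<zeta>^k turns the plus sign into a minus sign, so that
        \<open>gap_radial\<close> applies to the exponent 2j + a + k, which is odd and hence not a
        multiple of 2k.\<close>
      have "c \<le> norm (1 + pt r ^ (2 * j + a))" for j
      proof -
        have "\<not> 2 dvd (2 * j + a + k)"
          using a(3) by simp
        then have "\<zeta> ^ (2 * j + a + k) \<noteq> 1"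
          unfolding eq_1_iff using dvd_mult_left by blast
        then have "c \<le> norm (1 - of_real (r ^ (2 * j + a)) * \<zeta> ^ (2 * j + a + k))"
          by (rule gap_radial[rotated 2]) (use r in \<open>auto intro: power_le_one\<close>)
        also have "1 - of_real (r ^ (2 * j + a)) * \<zeta> ^ (2 * j + a + k) = 1 + pt r ^ (2 * j + a)"
          unfolding pt_power power_add[of \<zeta> "2 * j + a"] half by simp
        finally show ?thesis .
      qed
      from S4_bound[OF _ pt_nonzero[OF r(1)] c(1) this a(1)] show ?case
        using r by (simp add: U_def t_def norm_pt)
    qed
    show "((\<lambda>r. 4 / c * (norm (theta_quot (Suc a) (pt r)) / (1 - r))) \<longlongrightarrow> 0) (at_left 1)"
      by (rule tendsto_mult_right_zero[OF theta_quot_over_tendsto_0[OF a(2,3)]])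
  qed
  have "(W \<longlongrightarrow> (if odd k then - 1 / 2 else - 8 * \<zeta>) * 0) (at_left 1)"
    unfolding W_def V_def
    by (intro tendsto_mult theta_quot_quartic_tendsto_0 a) (auto intro!: tendsto_intros pt_tendsto)
  then have W: "(W \<longlongrightarrow> 0) (at_left 1)"
    by simp
  have "((\<lambda>r. U r - 2 * (\<Sum>n. dual_term (pt r) n) + W r) \<longlongrightarrow> 0 - 2 * (\<Sum>n<k. dual_term \<zeta> n) + 0) (at_left 1)"
    by (intro tendsto_add tendsto_diff tendsto_mult tendsto_const dual_sum_tendsto U W)
  moreover have "eventually (\<lambda>r. U r - 2 * (\<Sum>n. dual_term (pt r) n) + W r = S4_one (pt r) + t r - t' r) (at_left 1)"
    using eventually_radial
  proof eventually_elim
    case (elim r)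
    then have n: "norm (pt r) < 1" "pt r \<noteq> 0"
      by (auto simp: norm_pt pt_nonzero)
    have "W r = t r - (- 1) ^ a * t r - t' r"
    proof (cases "odd k")
      case True
      then show ?thesis
        using theta_quartic_even[OF n] by (simp add: W_def V_def t'_def a_def)
    next
      case False
      then show ?thesis
        using theta_quartic_odd[OF n] by (simp add: W_def V_def t_def t'_def a_def numeral_2_eq_2)
    qed
    then show ?case
      by (simp add: U_def)
  qed
  ultimately show ?thesis
    unfolding t_def t'_def by (auto intro: Lim_transform_eventually)
qed

end

theorem theorem4p4:
  fixes k :: nat and \<zeta> :: complex
  assumes "k \<ge> 1" and "primitive_root_of_unity (2 * k) \<zeta>"
  shows "((\<lambda>r::real. let q = of_real r * \<zeta> in
             S4_one q + J 1 q ^ 3 / Jbar 0 1 q ^ 2 - Jbar 1 2 q ^ 4 / (2 * J 1 q ^ 3))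
          \<longlongrightarrow> - 2 * (\<Sum>n=0..k-1. \<zeta> ^ (n + 1) * (qpoch (- \<zeta>) \<zeta> n)\<^sup>2 / qpoch \<zeta> (\<zeta>\<^sup>2) (n + 1)))
         (at_left 1)"
proof -
  obtain c where "even_root k \<zeta> c"
    using even_root_exists[OF assms] by blast
  then interpret even_root k \<zeta> c .
  have "{0..k - 1} = {..<k}"
    using assms(1) by auto
  then show ?thesis
    using radial_limit by (simp add: pt_def dual_term_def Let_def)
qed

end
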